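(* Let $G=\operatorname{SL}(V)$ with $\dim V=n\ge 2$. Let $u\in G$ be unipotent and $V\cong V_{d_1}\oplus\cdots\oplus V_{d_t}$ as $K[u]$-modules ($t\ge1$, $d_r\ge1$, repetitions allowed). Set $\alpha=\nu_2(\gcd(d_1,\dots,d_t))$. Write $V\otimes V^*\cong\bigoplus_{d\ge1}V_d^{\lambda(d)}$ and $L_G(\varpi_1+\varpi_{n-1})\cong\bigoplus_{d\ge1}V_d^{\lambda'(d)}$ as $K[u]$-modules. Set $\varepsilon:=\varepsilon_{V\otimes V^*,b_V}$ and $\varepsilon':=\varepsilon_{L_G(\varpi_1+\varpi_{n-1}),b_V}$ (with $L_G(\varpi_1+\varpi_{n-1})$ identified with $\langle\gamma_V\rangle^\perp/\langle\gamma_V\rangle$ and its induced form). Then: (i) If $2\nmid n$: $\lambda'(1)=\lambda(1)-1$ and $\lambda'(d)=\lambda(d)$ for $d>1$. (ii) If $2\mid n$ and $\alpha=0$: $\lambda'(1)=\lambda(1)-2$ and $\lambda'(d)=\lambda(d)$ for $d>1$. (iii) If $2\mid n$ and $\alpha>0$: (a) if $2\mid n/2^\alpha$, then $\lambda'(2^\alpha)=\lambda(2^\alpha)-2$, $\lambda'(2^\alpha-1)=2$, and $\lambda'(d)=\lambda(d)$ for $d\ne 2^\alpha,2^\alpha-1$; (b) if $\alpha>1$ and $2\nmid n/2^\alpha$, then $\lambda'(2^\alpha)=\lambda(2^\alpha)-1$, $\lambda'(2^\alpha-2)=1$, and $\lambda'(d)=\lambda(d)$ for $d\ne2^\alpha,2^\alpha-2$;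 (c) if $\alpha=1$ and $2\nmid n/2$, then $\lambda'(2)=\lambda(2)-1$ and $\lambda'(d)=\lambda(d)$ for $d\neq 2$. (iv) $\varepsilon(d)=1$ if and only if $d=2^\beta>1$ for some power $2^\beta$ occurring in the consecutive-ones binary expansion of $d_r$ for some $1\le r\le t$. (v) If case (iii)(b) holds, then $\varepsilon(2^\alpha-2)=0$, $\varepsilon'(2^\alpha-2)=1$, and $\varepsilon'(d)=\varepsilon(d)$ for all $d\ne2^\alpha-2$. (vi) If case (iii)(b) does not hold, then $\varepsilon'(d)=\varepsilon(d)$ for all $d\ge1$.
   Context: $K$ is an algebraically closed field of characteristic $2$. For a unipotent element $u$ (of order a power of $2$, say $q$), $K[u]$ is the group algebra of $\langle u\rangle$, $X=u-1$, and $V_d$ ($1\le d\le q$) is the $d$-dimensional indecomposable $K[u]$-module on which $u$ acts as a single unipotent Jordan block; $V_0=0$, $V^m$ denotes the direct sum of $m$ copies. $\nu_2$ is the $2$-adic valuation. For a $K$-vector space $W$ with a $u$-invariant alternating bilinear form $b$ (not necessarily non-degenerate), define $\varepsilon_{W,b}:\mathbb{Z}_{\ge1}\to\{0,1\}$ by $\varepsilon_{W,b}(d)=0$ if $b(X^{d-1}v,v)=0$ for all $v\in W$ with $X^dv=0$, and $\varepsilon_{W,b}(d)=1$ otherwise. The bilinear form $b_V$ on $V\otimes V^*$ is defined by $b_V(v\otimes f,v'\otimes f')=f(v')f'(v)+f(v)f'(v')$; it is $\operatorname{SL}(V)$-invariant and alternating. With a basis $e_1,\dots,e_n$ of $V$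 and dual basis $e_i^*$, $\gamma_V=\sum_i e_i\otimes e_i^*$ (independent of the basis; spans the $G$-fixed points). $L_G(\lambda)$ denotes the irreducible rational $K[G]$-module of highest weight $\lambda$, with fundamental weights $\varpi_i$ labelled as in Bourbaki; $L_G(\varpi_1+\varpi_{n-1})\cong\langle\gamma_V\rangle^\perp/\langle\gamma_V\rangle$ (perp with respect to $b_V$), and $b_V$ induces a non-degenerate alternating form on this quotient. The consecutive-ones binary expansion of an integer $m>0$ is the expression $m=\sum_{i=1}^k(-1)^{i+1}2^{e_i}$ with $e_1>\cdots>e_k\ge0$ and $k$ minimal; a power $2^\beta$ "occurs" in it if $\beta=e_i$ for some $i$. *)

theory Defs
  imports "HOL-Analysis.Analysis" "HOL-Computational_Algebra.Computational_Algebra"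
begin

definition vsmult :: "'k::times \<Rightarrow> 'k^'n \<Rightarrow> 'k^'n" where
  "vsmult c v = (\<chi> i. c * v$i)"

definition msmult :: "'k::times \<Rightarrow> 'k^'n^'n \<Rightarrow> 'k^'n^'n" where
  "msmult c A = (\<chi> i j. c * A$i$j)"

definition unipotent :: "'k::comm_ring_1^'n^'n \<Rightarrow> bool" where
  "unipotent u \<longleftrightarrow> (\<exists>N. \<forall>v. (((\<lambda>x. (u - mat 1) *v x) ^^ N) v) = 0)"

(* V (x) V-dual identified with n x n matrices (v (x) f  <->  v f^T);
   u acts by A |-> u A u^{-1}; the operator X = u - 1 on V (x) V-dual. *)
definition XVV :: "'k::field^'n^'n \<Rightarrow> 'k^'n^'n \<Rightarrow> 'k^'n^'n" where
  "XVV u A = u ** A ** matrix_inv u - A"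

(* The form b_V: bilinear extension of
   b_V(v(x)f, v'(x)f') = f(v')f'(v) + f(v)f'(v'),
   i.e. b_V(e_i(x)e_j-dual, e_k(x)e_l-dual) = [j=k][l=i] + [i=j][k=l]. *)
definition bV :: "'k::comm_ring_1^'n^'n \<Rightarrow> 'k^'n^'n \<Rightarrow> 'k" where
  "bV A B = (\<Sum>i\<in>UNIV. \<Sum>j\<in>UNIV. A$i$j * B$j$i)
            + (\<Sum>i\<in>UNIV. A$i$i) * (\<Sum>j\<in>UNIV. B$j$j)"

(* gamma_V = sum e_i (x) e_i-dual = identity matrix *)
definition gammaV :: "'k::comm_ring_1^'n^'n" where
  "gammaV = mat 1"

definition span_gamma :: "('k::comm_ring_1^'n^'n) set" where
  "span_gamma = {msmult c gammaV | c. True}"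

definition perp_gamma :: "('k::comm_ring_1^'n^'n) set" where
  "perp_gamma = {A. \<forall>B\<in>span_gamma. bV A B = 0}"

(* Decomposition of the K[u]-module U/L (L \<subseteq> U invariant subspaces of an ambient
   space with scalar multiplication sm, X = u - 1) as a direct sum of
   Jordan blocks V_{s!0} + ... + V_{s!(length s - 1)}: there are w_i \<in> U with
   X^{s_i} w_i \<in> L such that the classes of X^j w_i (i < length s, j < s_i)
   form a basis of U/L.  With L = {0} this is an ordinary decomposition of U. *)
definition block_index :: "nat list \<Rightarrow> (nat \<times> nat) set" where
  "block_index s = {(i, j). i < length s \<and> j < s ! i}"

definition jordan_blocks ::
  "('k::field \<Rightarrow> 'w::ab_group_add \<Rightarrow> 'w) \<Rightarrow> ('w \<Rightarrow> 'w) \<Rightarrow> 'w set \<Rightarrow> 'w set \<Rightarrow> nat list \<Rightarrow> bool" where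
  "jordan_blocks sm X U L s \<longleftrightarrow>
     (\<exists>w :: nat \<Rightarrow> 'w.
        (\<forall>i<length s. 1 \<le> s ! i \<and> w i \<in> U \<and> (X ^^ (s ! i)) (w i) \<in> L) \<and>
        (\<forall>c :: nat \<times> nat \<Rightarrow> 'k.
            (\<Sum>(i, j)\<in>block_index s. sm (c (i, j)) ((X ^^ j) (w i))) \<in> L
            \<longrightarrow> (\<forall>p\<in>block_index s. c p = 0)) \<and>
        (\<forall>x\<in>U. \<exists>c :: nat \<times> nat \<Rightarrow> 'k.
            x - (\<Sum>(i, j)\<in>block_index s. sm (c (i, j)) ((X ^^ j) (w i))) \<in> L))"

definition mult :: "nat list \<Rightarrow> nat \<Rightarrow> nat" where
  "mult s d = count (mset s) d"

(* epsilon_{U/L, b}(d), for the form on U/L induced by b *)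
definition eps :: "('w \<Rightarrow> 'w \<Rightarrow> 'k::zero) \<Rightarrow> ('w \<Rightarrow> 'w) \<Rightarrow> 'w set \<Rightarrow> 'w set \<Rightarrow> nat \<Rightarrow> nat" where
  "eps b X U L d = (if (\<exists>v\<in>U. (X ^^ d) v \<in> L \<and> b ((X ^^ (d - 1)) v) v \<noteq> 0) then 1 else 0)"

definition cob_repr :: "nat \<Rightarrow> nat list \<Rightarrow> bool" where
  "cob_repr m es \<longleftrightarrow> es \<noteq> [] \<and> sorted_wrt (>) es \<and>
     int m = (\<Sum>i<length es. (-1) ^ i * 2 ^ (es ! i))"

definition cob_expansion :: "nat \<Rightarrow> nat list \<Rightarrow> bool" where
  "cob_expansion m es \<longleftrightarrow> cob_repr m es \<and> (\<forall>es'. cob_repr m es' \<longrightarrow> length es \<le> length es')"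

definition occurs_in_cob :: "nat \<Rightarrow> nat \<Rightarrow> bool" where
  "occurs_in_cob \<beta> m \<longleftrightarrow> (\<exists>es. cob_expansion m es \<and> \<beta> \<in> set es)"

end

theory Submission
  imports Defs
begin

text \<open>
  Write N = u - 1, v = u^-1 and D = [N, -]. Since X = Ad u - 1 satisfies X^k A = D^k(A) v^k, everything
  can be expressed by iterated commutators. Let q be the largest power of 2 dividing all d_r.

  Block sizes: the truncated sums of min(d, j) over the blocks are the dimension of ker X^j and, for
  the quotient and n even, one less than that of the space of traceless A with X^j A scalar. They are compared using a matrix A with X^(q-1) A = 1 of
  trace n/q (cut every block of V into pieces of length q), and a matrix of nonzero trace commuting
  with u^q; the latter excludes X^j A = 1 for j >= q.

  The form: after a substitution A -> A v^m, for d = 2m even the value b_V(X^(d-1) A, A) becomes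
  tr(N D^(d-1)(A) A). If d = 2p(2c + 1) with p a power of 2, then D^(2p-1) is the sum of the
  maps A -> N^i A N^(2p-1-i), and by symmetry of the trace only two terms survive: the square of
  tr(N^p D^(2pc) A), and a term which vanishes because a degree would have to satisfy
  2\<delta> + 2c + 1 = 0. The square vanishes unless c = 0, that is, unless d is a power of 2, and then
  the question becomes whether some A commuting with N^(2p) has tr(N^p A) nonzero. This trace is
  computed by counting positions in a Jordan block modulo 2p, which is what the consecutive-ones
  expansion records.
\<close>

section \<open>Consecutive-ones expansions\<close>

text \<open>Scalars and traces are linked by a duality: D is self-adjoint for the trace pairing, so
  X^j A = 1 and D^j B = 0 together force tr B = 0. For j < q such an A exists, hence ker X^j is
  traceless; for j >= q some B has nonzero trace, hence no A exists. Consequently, for n even, the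
  truncated sum for V (x) V-dual exceeds that for the quotient by 0 if j < q - 1, by 2 if j >= q,
  and by n/q mod 2 at j = q - 1. Multiplicities change by the second difference of this step
  function, so two blocks appear at q - 1 if n/q is even and one at q - 2 if n/q is odd, provided
  these sizes are positive.

  On the quotient the form is also tested on A with X^d A = c nonzero. There A = c A1 + B with A1 =
  X^(q-1-d) A0, X^(q-1) A0 = 1 and X^d B = 0. The quadratic value is additive on this sum, B
  contributes nothing because no power of 2 below q occurs in an expansion, and shifting all
  derivations onto one copy of A0 leaves tr A0 for d = q - 2 and 0 for smaller d.\<close>

definition cob_value :: "nat list \<Rightarrow> int" where
  "cob_value es = (\<Sum>i<length es. (-1) ^ i * 2 ^ (es ! i))"

lemma cob_value_Nil [simp]: "cob_value [] = 0"
  by (simp add: cob_value_def)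

lemma cob_value_Cons [simp]: "cob_value (e # es) = 2 ^ e - cob_value es"
proof -
  have "cob_value (e # es) = 2 ^ e + (\<Sum>i<length es. (-1) ^ Suc i * 2 ^ (es ! i))"
    unfolding cob_value_def length_Cons sum.lessThan_Suc_shift by simp
  also have "(\<Sum>i<length es. (-1) ^ Suc i * 2 ^ (es ! i)) = - cob_value es"
    by (simp add: cob_value_def sum_negf)
  finally show ?thesis by simp
qed

lemma cob_repr_iff: "cob_repr m es \<longleftrightarrow> es \<noteq> [] \<and> sorted_wrt (>) es \<and> int m = cob_value es"
  by (simp add: cob_repr_def cob_value_def)

text \<open>The tail is an alternating sum of the same kind with leading exponent below e, so it
  lies between 0 and 2^(e-1). Hence m determines its leading exponent unless it is a power of 2,
  where \<open>[e]\<close> and \<open>[e + 1, e]\<close> compete and minimality decides.\<close>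

lemma cob_value_bounds:
  assumes "sorted_wrt (>) (e # es)"
  shows "2 ^ e \<le> 2 * cob_value (e # es) \<and> cob_value (e # es) \<le> 2 ^ e \<and> 0 < cob_value (e # es)"
  using assms
proof (induction es arbitrary: e)
  case Nil
  then show ?case by simp
next
  case (Cons f es)
  then have "f < e" and IH: "cob_value (f # es) \<le> 2 ^ f" "0 < cob_value (f # es)"
    by auto
  have "(2::int) ^ f * 2 \<le> 2 ^ e"
    using power_increasing[of "Suc f" e "2::int"] \<open>f < e\<close> by simp
  moreover have "cob_value (e # f # es) = 2 ^ e - cob_value (f # es)"
    by (rule cob_value_Cons)
  moreover have "(0::int) < 2 ^ f" by simp
  ultimately show ?case using IH by linarith
qed

lemma cob_expansion_power: "cob_expansion (2 ^ e) es \<longleftrightarrow> es = [e]"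
proof -
  have 1: "cob_repr (2 ^ e) [e]" by (simp add: cob_repr_iff)
  have "es = [e]" if "cob_repr (2 ^ e) es" "length es \<le> 1"
  proof -
    from that obtain f where "es = [f]"
      by (cases es) (auto simp: cob_repr_iff)
    then show ?thesis using that(1) by (simp add: cob_repr_iff)
  qed
  moreover have "1 \<le> length es" if "cob_repr (2 ^ e) es" for es
    using that by (cases es) (auto simp: cob_repr_iff)
  ultimately show ?thesis
    unfolding cob_expansion_def using 1 by fastforce
qed

text \<open>The bounds exclude every other leading exponent, and m < 2^e forces a nonempty tail.
  Conversely 2^e - m < 2^(e-1) keeps the exponents of any representation of the remainder below
  e.\<close>

lemma cob_repr_between:
  assumes m: "2 ^ e < 2 * m" "m < 2 ^ e"
  shows "cob_repr m es \<longleftrightarrow> (\<exists>es'. es = e # es' \<and> cob_repr (2 ^ e - m) es')"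
proof
  assume r: "cob_repr m es"
  then obtain f fs where es: "es = f # fs" by (cases es) (auto simp: cob_repr_iff)
  have b: "2 ^ f \<le> 2 * int m" "int m \<le> 2 ^ f"
    using cob_value_bounds[of f fs] r es by (auto simp: cob_repr_iff)
  have b': "2 ^ f \<le> 2 * m" "m \<le> 2 ^ f"
    using b by (metis (mono_tags) of_nat_le_iff of_nat_mult of_nat_numeral of_nat_power)+
  have "f = e"
  proof (rule linorder_cases[of f e])
    assume "f < e"
    then have "(2::nat) ^ Suc f \<le> 2 ^ e" by (intro power_increasing) auto
    then show ?thesis using b' m by simp
  next
    assume "e < f"
    then have "(2::nat) ^ Suc e \<le> 2 ^ f" by (intro power_increasing) auto
    then show ?thesis using b' m by simp
  qed
  moreover have "fs \<noteq> []"
    using r es \<open>f = e\<close> m by (auto simp: cob_repr_iff)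
  ultimately show "\<exists>es'. es = e # es' \<and> cob_repr (2 ^ e - m) es'"
    using r es m by (auto simp: cob_repr_iff of_nat_diff)
next
  assume "\<exists>es'. es = e # es' \<and> cob_repr (2 ^ e - m) es'"
  then obtain es' where es: "es = e # es'" and r: "cob_repr (2 ^ e - m) es'" by blast
  obtain f fs where es': "es' = f # fs" using r by (cases es') (auto simp: cob_repr_iff)
  have v: "2 ^ e - int m = cob_value es'"
    using r m by (simp add: cob_repr_iff of_nat_diff)
  have "2 ^ f \<le> 2 * cob_value es'"
    using cob_value_bounds[of f fs] r es' by (auto simp: cob_repr_iff)
  moreover have "2 ^ e < 2 * int m"
    using m by (metis (mono_tags) of_nat_less_iff of_nat_mult of_nat_numeral of_nat_power)
  ultimately have "(2::int) ^ f < 2 ^ e" using v by linarith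
  then have "f < e" by simp
  then have "sorted_wrt (>) es"
    using r es es' by (auto simp: cob_repr_iff)
  then show "cob_repr m es"
    using es v by (simp add: cob_repr_iff)
qed

lemma cob_expansion_between:
  assumes m: "2 ^ e < 2 * m" "m < 2 ^ e"
  shows "cob_expansion m es \<longleftrightarrow> (\<exists>es'. es = e # es' \<and> cob_expansion (2 ^ e - m) es')"
  unfolding cob_expansion_def cob_repr_between[OF m] by fastforce

lemma occurs_in_cob_power: "occurs_in_cob \<beta> (2 ^ e) \<longleftrightarrow> \<beta> = e"
  by (auto simp: occurs_in_cob_def cob_expansion_power)

lemma pos_nat_cases_power2:
  assumes "0 < m"
  obtains (power) e where "m = 2 ^ e"
    | (between) e where "2 ^ e < 2 * m" "m < (2::nat) ^ e"
proof -
  obtain e where e: "2 ^ e \<le> m" "m < 2 ^ Suc e"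
    using ex_power_ivl1[of 2 m] assms by auto
  show ?thesis
  proof (cases "m = 2 ^ e")
    case False
    then show ?thesis using e between[of "Suc e"] by simp
  qed (rule power)
qed

lemma cob_expansion_ex: "0 < m \<Longrightarrow> \<exists>es. cob_expansion m es"
proof (induction m rule: less_induct)
  case (less m)
  from \<open>0 < m\<close> show ?case
  proof (cases rule: pos_nat_cases_power2)
    case (power e)
    then show ?thesis by (auto simp: cob_expansion_power)
  next
    case (between e)
    then obtain es where "cob_expansion (2 ^ e - m) es"
      using less.IH[of "2 ^ e - m"] by fastforce
    then show ?thesis using cob_expansion_between[OF between] by auto
  qed
qed

lemma occurs_in_cob_between:
  assumes "2 ^ e < 2 * m" "m < 2 ^ e"
  shows "occurs_in_cob \<beta> m \<longleftrightarrow> \<beta> = e \<or> occurs_in_cob \<beta> (2 ^ e - m)"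
proof -
  obtain es where "cob_expansion (2 ^ e - m) es"
    using cob_expansion_ex[of "2 ^ e - m"] assms by auto
  then show ?thesis
    unfolding occurs_in_cob_def cob_expansion_between[OF assms] by auto
qed

text \<open>For a positive digit index the expansion is read off two adjacent binary digits, except
  at the lowest run of ones when that run is a single digit; this is why the remainder is compared
  with half the modulus instead of looking at the lower digit alone.\<close>

definition cob_digit :: "nat \<Rightarrow> nat \<Rightarrow> bool" where
  "cob_digit p m \<longleftrightarrow> (if even (m div (2 * p)) then p < m mod (2 * p) else m mod (2 * p) < p)"

text \<open>Reflection in an even multiple of 2p: a nonzero remainder r becomes 2p - r while the
  parity of the quotient flips, which exchanges the two branches; a zero remainder keeps both. This
  matches the step m -> 2^e - m of the expansion.\<close>

lemma cob_digit_complement: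
  assumes "even K" "0 < m" "m < 2 * p * K" "0 < p"
  shows "cob_digit p (2 * p * K - m) \<longleftrightarrow> cob_digit p m"
proof -
  define k r where "k = m div (2 * p)" and "r = m mod (2 * p)"
  have m: "m = 2 * p * k + r" and r: "r < 2 * p"
    using assms by (simp_all add: k_def r_def)
  show ?thesis
  proof (cases "r = 0")
    case True
    then have "2 * p * K - m = 2 * p * (K - k)" "k < K"
      using m assms by (simp_all add: algebra_simps diff_mult_distrib2)
    then have "(2 * p * K - m) div (2 * p) = K - k" "(2 * p * K - m) mod (2 * p) = 0"
      using assms by simp_all
    then show ?thesis
      using True \<open>k < K\<close> assms unfolding cob_digit_def k_def[symmetric] r_def[symmetric] by simp
  next
    case False
    have "k < K"
      using m assms(3) by (metis add_lessD1 mult_less_cancel1)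
    then obtain j where j: "K = k + 1 + j" by (metis Suc_eq_plus1 less_iff_Suc_add add_Suc_right add.commute add.left_commute)
    have eq: "2 * p * K - m = 2 * p * j + (2 * p - r)"
      using m r j by (simp add: algebra_simps)
    have "(2 * p * K - m) div (2 * p) = j" "(2 * p * K - m) mod (2 * p) = 2 * p - r"
      unfolding eq using assms(4) False r by (simp_all only: div_mult_self2 mod_mult_self2 add.commute) simp_all
    moreover have "even j \<longleftrightarrow> odd k" using j assms(1) by presburger
    ultimately show ?thesis
      using r unfolding cob_digit_def k_def[symmetric] r_def[symmetric] by auto
  qed
qed

lemma cob_digit_power: "cob_digit (2 ^ b) (2 ^ e) \<longleftrightarrow> e = Suc b"
proof (cases "e < Suc b")
  case True
  then have "(2::nat) ^ e \<le> 2 ^ b" by (intro power_increasing) auto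
  moreover have "(0::nat) < 2 ^ b" by simp
  ultimately have "(2::nat) ^ e < 2 * 2 ^ b" by linarith
  then show ?thesis
    using True \<open>(2::nat) ^ e \<le> 2 ^ b\<close> by (simp add: cob_digit_def)
next
  case False
  then obtain j where j: "e = Suc b + j" using le_Suc_ex not_less by blast
  have "(2::nat) ^ e = 2 * 2 ^ b * 2 ^ j" by (simp add: j power_add)
  then have "(2::nat) ^ e div (2 * 2 ^ b) = 2 ^ j" "(2::nat) ^ e mod (2 * 2 ^ b) = 0"
    by simp_all
  then show ?thesis by (cases j) (simp_all add: cob_digit_def j)
qed

text \<open>Induction along m -> 2^e - m, with p = 2^b. If 2^e is an even multiple of 2p, reflection
  applies; if 2^e = 2p, then p < m < 2p and the digit is present; if 2^e <= p, both sides are false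
  because m and the remainder are below p.\<close>

lemma occurs_in_cob_iff:
  assumes "0 < m"
  shows "occurs_in_cob (Suc b) m \<longleftrightarrow> cob_digit (2 ^ b) m"
  using assms
proof (induction m rule: less_induct)
  case (less m)
  from \<open>0 < m\<close> show ?case
  proof (cases rule: pos_nat_cases_power2)
    case (power e)
    then show ?thesis by (auto simp: occurs_in_cob_power cob_digit_power)
  next
    case (between e)
    have IH: "occurs_in_cob (Suc b) (2 ^ e - m) \<longleftrightarrow> cob_digit (2 ^ b) (2 ^ e - m)"
      using less.IH[of "2 ^ e - m"] between by simp
    consider "Suc b < e" | "Suc b = e" | "e < Suc b" by linarith
    then show ?thesis
    proof cases
      case 1
      then obtain j where j: "e = Suc b + Suc j" by (metis add_Suc_right less_iff_Suc_add)
      have "(2::nat) ^ e = 2 * 2 ^ b * 2 ^ Suc j" by (simp add: j power_add)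
      then show ?thesis
        using IH 1 between less.prems cob_digit_complement[of "2 ^ Suc j" m "2 ^ b"]
        by (simp add: occurs_in_cob_between[OF between])
    next
      case 2
      then show ?thesis
        using between by (auto simp: occurs_in_cob_between[OF between] cob_digit_def)
    next
      case 3
      then have "(2::nat) ^ e \<le> 2 ^ b" by (intro power_increasing) auto
      then have "\<not> cob_digit (2 ^ b) x" if "x < 2 ^ e" for x
      proof -
        have "x < 2 ^ b" "x < 2 * 2 ^ b" using that \<open>(2::nat) ^ e \<le> 2 ^ b\<close> by linarith+
        then show ?thesis by (simp add: cob_digit_def)
      qed
      then have "\<not> cob_digit (2 ^ b) m" "\<not> cob_digit (2 ^ b) (2 ^ e - m)"
        using between less.prems by simp_all
      then show ?thesis using 3 IH by (simp add: occurs_in_cob_between[OF between])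
    qed
  qed
qed

section \<open>Iterated commutators in characteristic 2\<close>

lemma char2_add_self: "CHAR('a) = 2 \<Longrightarrow> x + x = (0::'a::ring_1)"
  by (metis add.right_inverse uminus_CHAR_2)

lemma char2_sum_symmetric:
  fixes f :: "'b \<Rightarrow> 'b \<Rightarrow> 'a::ring_1"
  assumes "CHAR('a) = 2" "finite S" "\<And>i j. i \<in> S \<Longrightarrow> j \<in> S \<Longrightarrow> f i j = f j i"
  shows "(\<Sum>i\<in>S. \<Sum>j\<in>S. f i j) = (\<Sum>i\<in>S. f i i)"
  using assms(2,3)
proof (induction S)
  case (insert x S)
  have "(\<Sum>i\<in>insert x S. \<Sum>j\<in>insert x S. f i j)
      = f x x + ((\<Sum>j\<in>S. f x j) + (\<Sum>i\<in>S. f i x)) + (\<Sum>i\<in>S. \<Sum>j\<in>S. f i j)"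
    using insert.hyps by (simp add: sum.distrib algebra_simps)
  also have "(\<Sum>i\<in>S. f i x) = (\<Sum>j\<in>S. f x j)"
    using insert.prems by (intro sum.cong) auto
  finally show ?case
    using insert by (simp add: char2_add_self[OF assms(1)])
qed simp

lemma char2_sum_palindrome:
  fixes f :: "nat \<Rightarrow> 'a::ring_1"
  assumes "CHAR('a) = 2" "\<And>a. 0 < a \<Longrightarrow> a < 2 * p \<Longrightarrow> f (2 * p - a) = f a" "0 < p"
  shows "(\<Sum>a\<in>{1..<2 * p}. f a) = f p"
proof -
  have "{1..<2 * p} = {1..<p} \<union> {p} \<union> {p<..<2 * p}" using \<open>0 < p\<close> by auto
  then have "sum f {1..<2 * p} = sum f {1..<p} + f p + sum f {p<..<2 * p}"
    by (simp add: sum.union_disjoint disjoint_iff)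
  moreover have "sum f {p<..<2 * p} = sum f {1..<p}"
    by (rule sum.reindex_bij_witness[of _ "\<lambda>a. 2 * p - a" "\<lambda>a. 2 * p - a"])
       (use assms(2) in auto)
  ultimately show ?thesis
    using char2_add_self[OF assms(1), of "sum f {1..<p}"] by (simp add: algebra_simps)
qed

definition commutator :: "'r::ring_1 \<Rightarrow> 'r \<Rightarrow> 'r" where
  "commutator N A = N * A - A * N"

abbreviation ad_pow :: "'r::ring_1 \<Rightarrow> nat \<Rightarrow> 'r \<Rightarrow> 'r" where
  "ad_pow N k \<equiv> commutator N ^^ k"

lemma ad_pow_add: "ad_pow N (j + k) A = ad_pow N j (ad_pow N k A)"
  by (simp add: funpow_add)

lemma ad_pow_Suc: "ad_pow N (Suc k) A = ad_pow N k (commutator N A)"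
  by (simp add: funpow_swap1)

lemma ad_pow_linear:
  "ad_pow N k (A + B) = ad_pow N k A + ad_pow N k B"
  "ad_pow N k 0 = 0"
  by (induction k) (simp_all add: commutator_def algebra_simps)

lemma ad_pow_sum: "ad_pow N k (sum f S) = (\<Sum>i\<in>S. ad_pow N k (f i))"
  by (induction S rule: infinite_finite_induct) (simp_all add: ad_pow_linear)

lemma ad_pow_zero_mono: "ad_pow N j A = 0 \<Longrightarrow> j \<le> k \<Longrightarrow> ad_pow N k A = 0"
  by (metis ad_pow_add ad_pow_linear(2) le_add_diff_inverse2)

lemma ad_pow_mult_left: "N * R = R * N \<Longrightarrow> ad_pow N k (R * A) = R * ad_pow N k A"
proof (induction k)
  case (Suc k)
  have "N * (R * x) = R * (N * x)" for x using Suc.prems by (metis mult.assoc)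
  then show ?case using Suc by (simp add: commutator_def algebra_simps)
qed simp

lemma ad_pow_mult_right: "N * R = R * N \<Longrightarrow> ad_pow N k (A * R) = ad_pow N k A * R"
proof (induction k)
  case (Suc k)
  then show ?case by (simp add: commutator_def algebra_simps)
qed simp

lemma commute_power: "x * y = y * x \<Longrightarrow> x * y ^ k = y ^ k * (x::'r::monoid_mult)"
  by (induction k) (simp_all, metis mult.assoc)

lemma commute_self_power: "x * x ^ k = x ^ k * (x::'r::monoid_mult)"
  by (rule power_commutes[symmetric])

text \<open>Until matrices enter, the trace is used only through additivity, cyclicity and the
  Frobenius rule for squares, so the identities are proved in an abstract ring.\<close>

locale char2_trace =
  fixes tr :: "'r::ring_1 \<Rightarrow> 'k::field"
  assumes tr_add: "tr (x + y) = tr x + tr y"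
    and tr_comm: "tr (x * y) = tr (y * x)"
    and tr_square: "tr (x * x) = (tr x)\<^sup>2"
    and char2_ring: "CHAR('r) = 2"
    and char2_field: "CHAR('k) = 2"
begin

lemma add_self: "x + x = (0::'r)"
  by (rule char2_add_self[OF char2_ring])

lemma add_self_field: "c + c = (0::'k)"
  by (rule char2_add_self[OF char2_field])

lemma minus_eq: "x - y = x + (y::'r)"
  by (simp add: minus_CHAR_2 char2_ring)

lemma minus_eq_field: "x - y = x + (y::'k)"
  by (simp add: minus_CHAR_2 char2_field)

lemma tr_zero [simp]: "tr 0 = 0"
  using tr_add[of 0 0] by (metis add.right_neutral add_left_imp_eq)

lemma tr_sum: "tr (sum f S) = (\<Sum>i\<in>S. tr (f i))"
  by (induction S rule: infinite_finite_induct) (simp_all add: tr_add)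

lemma tr_diff: "tr (x - y) = tr x - tr y"
  by (simp add: minus_eq minus_eq_field tr_add)

lemma tr_rotate: "tr (x * y * z) = tr (z * x * y)"
  using tr_comm[of "x * y" z] by (simp add: mult.assoc)

lemma tr_commutator [simp]: "tr (commutator N A) = 0"
  by (simp add: commutator_def tr_diff tr_comm[of N])

lemma tr_ad_pow: "0 < k \<Longrightarrow> tr (ad_pow N k A) = 0"
  by (cases k) simp_all

lemma tr_commutator_adjoint: "tr (commutator N A * B) = tr (A * commutator N B)"
proof -
  have "tr (commutator N A * B) = tr (N * A * B) + tr (A * N * B)"
    by (simp add: commutator_def minus_eq distrib_right tr_add)
  also have "tr (N * A * B) = tr (A * (B * N))"
    using tr_comm[of N "A * B"] by (simp add: mult.assoc)
  finally show ?thesis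
    by (simp add: commutator_def minus_eq distrib_left tr_add mult.assoc add.commute)
qed

text \<open>By cyclicity ad N is skew-adjoint for the pairing tr(A B), and in characteristic 2 the
  sign is invisible.\<close>

lemma tr_ad_adjoint: "tr (ad_pow N k A * B) = tr (A * ad_pow N k B)"
proof (induction k arbitrary: B)
  case (Suc k)
  have "tr (ad_pow N (Suc k) A * B) = tr (ad_pow N k A * commutator N B)"
    by (simp add: tr_commutator_adjoint)
  also have "\<dots> = tr (A * ad_pow N (Suc k) B)"
    by (simp only: Suc ad_pow_Suc)
  finally show ?case .
qed simp

lemma commutator_plus: "commutator N A = N * A + A * (N::'r)"
  by (simp add: commutator_def minus_eq)

lemma commutator_self_pow:
  "commutator N (commutator N A) = commutator (N * N) (A::'r)"
proof -
  have "commutator N (commutator N A) = N * N * A + (N * A * N + N * A * N) + A * N * N"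
    by (simp add: commutator_plus algebra_simps)
  then show ?thesis by (simp add: add_self commutator_plus mult.assoc)
qed

text \<open>ad N is the sum of two commuting operators, left and right multiplication by N, so
  Frobenius applies: the mixed terms of each squaring cancel.\<close>

lemma ad_pow_two_power: "ad_pow N (2 ^ e) (A::'r) = commutator (N ^ 2 ^ e) A"
proof (induction e arbitrary: A)
  case (Suc e)
  then show ?case
    by (simp add: mult_2 ad_pow_add commutator_self_pow power_add)
qed simp

lemma ad_pow_two_power_mult: "ad_pow N (2 ^ e * k) (A::'r) = ad_pow (N ^ 2 ^ e) k A"
  by (induction k arbitrary: A) (simp_all add: ad_pow_add ad_pow_two_power)

text \<open>With left and right multiplication by N as commuting variables x and y, this is (x -
  y)^(q-1) = (x^q - y^q) / (x - y) for q = 2^e in characteristic 2.\<close>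

lemma ad_pow_two_power_minus_1:
  "ad_pow N (2 ^ e - 1) (A::'r) = (\<Sum>i<2 ^ e. N ^ i * A * N ^ (2 ^ e - 1 - i))"
proof (induction e)
  case (Suc e)
  define q :: nat where "q = 2 ^ e"
  have q: "0 < q" by (simp add: q_def)
  have "ad_pow N (2 ^ Suc e - 1) A = ad_pow N q (ad_pow N (q - 1) A)"
    using q by (simp add: ad_pow_add[symmetric] q_def[symmetric]) (simp add: mult_2)
  also have "\<dots> = commutator (N ^ q) (\<Sum>i<q. N ^ i * A * N ^ (q - 1 - i))"
    using Suc by (simp add: ad_pow_two_power q_def)
  also have "\<dots> = (\<Sum>i<q. N ^ (q + i) * A * N ^ (q - 1 - i)) + (\<Sum>i<q. N ^ i * A * N ^ (2 * q - 1 - i))"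
  proof -
    have "N ^ (q - 1 - i) * N ^ q = N ^ (2 * q - 1 - i)" if "i < q" for i
      using that by (simp add: power_add[symmetric]) (simp add: mult_2 add.commute)
    then show ?thesis
      by (simp add: commutator_plus sum_distrib_left sum_distrib_right power_add mult.assoc)
  qed
  also have "(\<Sum>i<q. N ^ (q + i) * A * N ^ (q - 1 - i)) = (\<Sum>i\<in>{q..<2 * q}. N ^ i * A * N ^ (2 * q - 1 - i))"
    by (rule sum.reindex_bij_witness[of _ "\<lambda>i. i - q" "\<lambda>i. i + q"]) (auto simp: add.commute mult_2)
  also have "\<dots> + (\<Sum>i<q. N ^ i * A * N ^ (2 * q - 1 - i)) = (\<Sum>i<2 * q. N ^ i * A * N ^ (2 * q - 1 - i))"
    by (subst sum.union_disjoint[symmetric]) (auto intro!: sum.cong)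
  finally show ?case by (simp add: q_def)
qed simp

text \<open>A product of a nilpotent element with an element commuting with it is nilpotent, and in
  characteristic 2 the trace of a square is the square of the trace.\<close>

lemma tr_nilpotent_mult:
  assumes "N ^ m = 0" "N * C = C * N"
  shows "tr (N * C) = 0"
proof -
  have pow: "tr (x ^ 2 ^ e) = tr x ^ 2 ^ e" for x e
    by (induction e) (simp_all add: power_mult mult.commute[of 2] power2_eq_square tr_square)
  have "N ^ 2 ^ m = 0"
    using assms(1) less_imp_le[OF less_exp[of m]] by (metis le_add_diff_inverse mult_zero_left power_add)
  have dist: "(N * C) ^ k = N ^ k * C ^ k" for k
  proof (induction k)
    case (Suc k)
    then show ?case by (simp add: mult.assoc) (metis assms(2) commute_power mult.assoc)
  qed simp
  then have "tr (N * C) ^ 2 ^ m = tr (N ^ 2 ^ m * C ^ 2 ^ m)"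
    using pow[of "N * C" m] dist[of "2 ^ m"] by simp
  with \<open>N ^ 2 ^ m = 0\<close> show ?thesis by simp
qed

end

text \<open>With X = Ad(u) - 1 one has X^k A = ad(N)^k(A) v^k, so \<open>quad d A\<close> is the value of
  the form b_V at (X^(d-1) A, A), up to the term involving tr A.\<close>

locale unipotent_trace = char2_trace tr for tr :: "'r::ring_1 \<Rightarrow> 'k::field" +
  fixes N u v :: 'r
  assumes u_def: "u = 1 + N" and uv: "u * v = 1" and vu: "v * u = 1"
begin

definition quad :: "nat \<Rightarrow> 'r \<Rightarrow> 'k" where
  "quad d A = tr (ad_pow N (d - 1) A * v ^ (d - 1) * A)"

lemma N_u: "N * u = u * N" by (simp add: u_def algebra_simps)

lemma N_v: "N * v = v * N"
proof -
  have "v * (N * u) * v = v * (u * N) * v" by (simp add: N_u)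
  then show ?thesis by (metis mult.assoc mult.right_neutral mult_1_left uv vu)
qed

lemma N_v_pow: "N * v ^ k = v ^ k * N" by (rule commute_power[OF N_v])
lemma N_u_pow: "N * u ^ k = u ^ k * N" by (rule commute_power[OF N_u])

lemma uv_pow: "u ^ k * v ^ k = 1"
proof (induction k)
  case (Suc k)
  have "u ^ Suc k * v ^ Suc k = u ^ k * (u * v) * v ^ k"
    by (simp only: power_Suc2[of u] power_Suc[of v] mult.assoc)
  with Suc show ?case by (simp add: uv)
qed simp

lemma vu_pow: "v ^ k * u ^ k = 1"
proof (induction k)
  case (Suc k)
  have "v ^ Suc k * u ^ Suc k = v ^ k * (v * u) * u ^ k"
    by (simp only: power_Suc2[of v] power_Suc[of u] mult.assoc)
  with Suc show ?case by (simp add: vu)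
qed simp

lemma ad_v: "ad_pow N k (v ^ j * A) = v ^ j * ad_pow N k A" "ad_pow N k (A * v ^ j) = ad_pow N k A * v ^ j"
  "ad_pow N k (u ^ j * A) = u ^ j * ad_pow N k A" "ad_pow N k (A * u ^ j) = ad_pow N k A * u ^ j"
  by (simp_all add: ad_pow_mult_left ad_pow_mult_right N_v_pow N_u_pow)

lemma tr_mult_u_pow:
  assumes "\<And>t. t < m \<Longrightarrow> tr (A * N ^ t) = 0"
  shows "tr (A * u ^ m) = tr (A * N ^ m)"
proof -
  have "tr (A * N ^ s * u ^ k) = tr (A * N ^ (s + k))" if "s + k \<le> m" for s k
    using that
  proof (induction k arbitrary: s)
    case (Suc k)
    have "A * N ^ s * u ^ Suc k = A * N ^ s * u ^ k + A * N ^ Suc s * u ^ k"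
      using commute_self_power[of N s] by (simp add: u_def algebra_simps)
    then show ?case
      using Suc.IH[of s] Suc.IH[of "Suc s"] Suc.prems assms[of "s + k"] by (simp add: tr_add del: power_Suc)
  qed simp
  from this[of 0 m] show ?thesis by simp
qed

text \<open>Moving v from one side of D^c(A) to the other does not change the trace G, so v can be
  distributed evenly, which yields the trace of a square. The hypothesis also covers
  X^(2c+1) A scalar with tr A = 0.\<close>

lemma quad_odd:
  assumes "\<And>i j. i + j = 2 * c + 1 \<Longrightarrow> tr (A * v ^ i * ad_pow N (2 * c + 1) A * v ^ j) = 0"
  shows "quad (2 * c + 1) A = (tr (ad_pow N c A * v ^ c))\<^sup>2"
proof -
  define B where "B = ad_pow N c A"
  define G where "G j = tr (B * v ^ j * B * v ^ (2 * c - j))" for j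
  \<comment> \<open>Since v is the inverse of u, B v - v B = v [N, B] v. Shifting D^c from the first
    copy of B onto this factor produces D^(2c+1) A between j + 1 and 2c - j factors v, as in the
    assumption.\<close>
  have step: "G (Suc j) = G j" if "j < 2 * c" for j
  proof -
    have e: "v ^ (2 * c - j) = v * v ^ (2 * c - Suc j)"
      using that by (metis Suc_diff_Suc power_Suc)
    have "v * (commutator N B) * v = v * (u * B - B * u) * v"
      by (simp add: u_def commutator_def algebra_simps)
    also have "\<dots> = (v * u) * B * v - v * B * (u * v)" by (simp only: algebra_simps)
    finally have "B * v - v * B = v * commutator N B * v" by (simp add: uv vu)
    moreover define K L where "K = v ^ j" and "L = v ^ (2 * c - Suc j)"
    have vK: "v ^ Suc j = K * v" by (simp add: K_def power_commutes)
    have "G j - G (Suc j) = tr (B * K * (B * v - v * B) * L)"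
      unfolding G_def e vK K_def[symmetric] L_def[symmetric]
      by (simp add: tr_diff[symmetric] algebra_simps)
    ultimately have "G j - G (Suc j) = tr (B * K * (v * commutator N B * v) * L)" by simp
    also have "\<dots> = tr (B * (v ^ Suc j * commutator N B * v ^ (2 * c - j)))"
      unfolding e vK by (simp add: mult.assoc L_def)
    also have "\<dots> = tr (A * (v ^ Suc j * ad_pow N (2 * c + 1) A * v ^ (2 * c - j)))"
    proof -
      have "ad_pow N c (commutator N (ad_pow N c A)) = ad_pow N (2 * c + 1) A"
        using ad_pow_add[where N = N and j = c and k = "c + 1" and A = A] by (simp add: mult_2)
      then show ?thesis by (simp add: B_def tr_ad_adjoint ad_v del: power_Suc)
    qed
    also have "\<dots> = 0"
      using assms[of "Suc j" "2 * c - j"] that by (simp add: mult.assoc del: power_Suc)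
    finally show ?thesis by simp
  qed
  have const: "G j = G 0" if "j \<le> 2 * c" for j
    using that by (induction j) (auto simp: step)
  have "quad (2 * c + 1) A = tr (ad_pow N c B * (v ^ (2 * c) * A))"
    by (simp add: quad_def B_def mult_2 ad_pow_add mult.assoc)
  also have "\<dots> = G (2 * c)"
    unfolding tr_ad_adjoint ad_v by (simp add: G_def B_def mult.assoc)
  also have "\<dots> = G c" using const[of c] const[of "2 * c"] by simp
  also have "\<dots> = (tr (B * v ^ c))\<^sup>2"
    using tr_square[of "B * v ^ c"] by (simp add: G_def mult_2 mult.assoc)
  finally show ?thesis by (simp add: B_def)
qed

text \<open>D^(2m-1) A commutes with N, hence with v, so its 2m - 1 factors v can be redistributed:
  m go to each copy of A, and one factor u = 1 + N is left over to compensate. The part with 1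
  vanishes: splitting 2m - 1 as m + (m - 1) turns it into tr([N, B] B), which is twice tr(N B^2).
  The part with N remains.\<close>

lemma quad_even:
  assumes "0 < m" "ad_pow N (2 * m) A = 0"
  shows "quad (2 * m) A = tr (N * ad_pow N (2 * m - 1) (A * v ^ m) * (A * v ^ m))"
proof -
  define C where "C = ad_pow N (2 * m - 1) A"
  have "commutator N C = 0"
    using assms by (simp add: C_def flip: funpow.simps(2)[THEN fun_cong, unfolded o_apply])
  then have NC: "N * C = C * N" by (simp add: commutator_def)
  have uC: "C * u = u * C" using NC by (simp add: u_def algebra_simps)
  define A' C' where "A' = A * v ^ m" and "C' = C * v ^ m"
  have C': "C' = ad_pow N (2 * m - 1) A'" by (simp add: C'_def A'_def C_def ad_v)
  have "2 * m - 1 = m + (m - 1)" "Suc (m - 1) = m" using assms(1) by auto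
  then have "v ^ m = v ^ (m - 1) * v" by (metis power_Suc2)
  then have vm: "v ^ m * u = v ^ (m - 1)" by (simp add: mult.assoc vu)
  have "tr (C' * u * A') = tr (v ^ m * C * v ^ m * u * A)"
    unfolding C'_def A'_def using tr_comm[of "C * v ^ m * u * A" "v ^ m"] by (simp add: mult.assoc)
  also have "v ^ m * C = C * v ^ m"
  proof -
    have "v * C = C * v" using uC by (metis mult.assoc mult.right_neutral mult_1_left uv vu)
    then show ?thesis using commute_power by metis
  qed
  finally have "tr (C' * u * A') = tr (C * v ^ (2 * m - 1) * A)"
    using \<open>2 * m - 1 = m + (m - 1)\<close> vm by (simp add: mult.assoc power_add)
  then have 1: "quad (2 * m) A = tr (C' * A') + tr (C' * N * A')"
    by (simp add: quad_def C_def u_def algebra_simps tr_add)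
  have "tr (C' * A') = tr (ad_pow N (m - 1) (ad_pow N m A') * A')"
    unfolding C' by (simp only: ad_pow_add[symmetric] \<open>2 * m - 1 = m + (m - 1)\<close> add.commute)
  also have "\<dots> = tr (commutator N (ad_pow N (m - 1) A') * ad_pow N (m - 1) A')"
  proof -
    have "ad_pow N m A' = commutator N (ad_pow N (m - 1) A')"
      using assms(1) by (cases m) simp_all
    then show ?thesis by (simp only: tr_ad_adjoint)
  qed
  also have "\<dots> = 0"
  proof -
    define B where "B = ad_pow N (m - 1) A'"
    have "tr (commutator N B * B) = tr (N * (B * B)) + tr (B * N * B)"
      by (simp add: commutator_plus algebra_simps tr_add)
    also have "tr (B * N * B) = tr (N * (B * B))"
      using tr_comm[of B "N * B"] by (simp add: mult.assoc)
    finally show ?thesis by (simp add: add_self_field B_def)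
  qed
  finally have 2: "tr (C' * A') = 0" .
  have "C' * N = N * C'"
    using NC N_v_pow by (simp add: C'_def mult.assoc) (metis mult.assoc)
  with 1 2 show ?thesis by (simp add: C' A'_def)
qed

text \<open>Expanding D^(2p-1), the terms with exponents a and 2p - a cancel; a = p gives the square
  and a = 2p the other summand.\<close>

lemma tr_ad_pow_even:
  assumes d: "d = 2 * p * (2 * c + 1)" and p: "p = 2 ^ e" and A: "ad_pow N d A = 0"
  shows "tr (N * ad_pow N (d - 1) A * A)
       = (tr (N ^ p * ad_pow N (2 * p * c) A))\<^sup>2
         + tr (N ^ (2 * p) * ad_pow (N ^ (2 * p)) (2 * c) A * A)"
proof -
  define E where "E = ad_pow N (2 * p * (2 * c)) A"
  have p0: "0 < p" by (simp add: p)
  have q: "2 * p = 2 ^ Suc e" by (simp add: p)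
  have "d - 1 = (2 * p - 1) + 2 * p * (2 * c)" using d p0 by (simp add: algebra_simps)
  then have "ad_pow N (d - 1) A = ad_pow N (2 * p - 1) E"
    by (simp only: ad_pow_add E_def)
  also have "\<dots> = (\<Sum>i<2 * p. N ^ i * E * N ^ (2 * p - 1 - i))"
    unfolding q by (rule ad_pow_two_power_minus_1)
  finally have "tr (N * ad_pow N (d - 1) A * A) = (\<Sum>i<2 * p. tr (N ^ Suc i * E * N ^ (2 * p - Suc i) * A))"
    by (simp add: sum_distrib_left sum_distrib_right tr_sum mult.assoc)
  also have "\<dots> = (\<Sum>a\<in>{1..2 * p}. tr (N ^ a * E * N ^ (2 * p - a) * A))"
    by (rule sum.reindex_bij_witness[of _ "\<lambda>a. a - 1" Suc]) auto
  also have "{1..2 * p} = insert (2 * p) {1..<2 * p}" using p0 by auto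
  also have "(\<Sum>a\<in>insert (2 * p) {1..<2 * p}. tr (N ^ a * E * N ^ (2 * p - a) * A))
      = tr (N ^ (2 * p) * E * A) + (\<Sum>a\<in>{1..<2 * p}. tr (N ^ a * E * N ^ (2 * p - a) * A))"
    by simp
  also have "(\<Sum>a\<in>{1..<2 * p}. tr (N ^ a * E * N ^ (2 * p - a) * A)) = tr (N ^ p * E * N ^ (2 * p - p) * A)"
  proof (rule char2_sum_palindrome[OF char2_field _ p0])
    \<comment> \<open>Rotating the trace and moving the 4pc derivations in \<open>E\<close> to the
      other copy of \<open>A\<close> interchanges a and 2p - a.\<close>
    fix a assume a: "0 < a" "a < 2 * p"
    have "tr (N ^ (2 * p - a) * E * N ^ (2 * p - (2 * p - a)) * A) = tr (E * (N ^ a * A * N ^ (2 * p - a)))"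
      using a tr_comm[of "N ^ (2 * p - a)" "E * N ^ a * A"] by (simp add: mult.assoc)
    also have "\<dots> = tr (A * (N ^ a * E * N ^ (2 * p - a)))"
      unfolding E_def tr_ad_adjoint
      by (simp add: ad_pow_mult_left ad_pow_mult_right commute_self_power)
    also have "\<dots> = tr (N ^ a * E * N ^ (2 * p - a) * A)"
      by (rule tr_comm)
    finally show "tr (N ^ (2 * p - a) * E * N ^ (2 * p - (2 * p - a)) * A) = tr (N ^ a * E * N ^ (2 * p - a) * A)" .
  qed
  also have "tr (N ^ p * E * N ^ (2 * p - p) * A) = (tr (N ^ p * ad_pow N (2 * p * c) A))\<^sup>2"
  proof -
    have "2 * p * (2 * c) = 2 * p * c + 2 * p * c" by simp
    then have "N ^ p * E * N ^ (2 * p - p) * A = ad_pow N (2 * p * c) (N ^ p * ad_pow N (2 * p * c) A) * (N ^ p * A)"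
      by (simp only: E_def ad_pow_add ad_pow_mult_left[OF commute_self_power]) (simp add: mult.assoc mult_2)
    then show ?thesis
      by (simp only: tr_ad_adjoint) (simp add: ad_pow_mult_left commute_self_power tr_square)
  qed
  also have "E = ad_pow (N ^ (2 * p)) (2 * c) A"
    unfolding E_def q by (rule ad_pow_two_power_mult)
  finally show ?thesis by (simp add: add.commute)
qed

lemma u_two_power: "u ^ 2 ^ e = 1 + N ^ 2 ^ e"
proof (induction e)
  case (Suc e)
  have "u ^ 2 ^ Suc e = (1 + N ^ 2 ^ e) * (1 + N ^ 2 ^ e)"
    by (simp add: mult_2 power_add Suc)
  also have "\<dots> = 1 + (N ^ 2 ^ e + N ^ 2 ^ e) + N ^ 2 ^ e * N ^ 2 ^ e"
    by (simp add: algebra_simps)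
  also have "\<dots> = 1 + N ^ 2 ^ Suc e"
    by (simp add: add_self mult_2 power_add)
  finally show ?case .
qed (simp add: u_def)

text \<open>With y = N^(2p) and z = N^p one has z^2 = y, v^p = v^(2p) (1 + z) and v^(2p) = 1 - y
  v^(2p). Every correction term is thus the trace of y times an element commuting with y, which
  vanishes by nilpotency. This removes the twist by v^p that \<open>quad_even_value\<close> puts on
  a witness.\<close>

lemma tr_twist:
  assumes p: "p = 2 ^ e" and nil: "N ^ m = 0" and W: "commutator (N ^ (2 * p)) W = 0"
  shows "tr (N ^ p * (W * v ^ p)) = tr (N ^ p * W)"
proof -
  define y z V where "y = N ^ (2 * p)" and "z = N ^ p" and "V = v ^ (2 * p)"
  have "y ^ m = (N ^ m) ^ (2 * p)"
    unfolding y_def power_mult[symmetric] by (simp only: mult.commute)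
  then have y_nil: "y ^ m = 0" using p by (simp add: nil zero_power)
  have yW: "y * W = W * y" using W by (simp add: y_def commutator_def)
  have yz: "y * z = z * y" by (simp add: y_def z_def power_add[symmetric] add.commute)
  have yV: "y * V = V * y"
    unfolding y_def V_def by (metis N_v commute_power)
  have zz: "z * z = y" by (simp add: y_def z_def mult_2 power_add)
  have q: "2 * p = 2 ^ Suc e" by (simp add: p)
  have "V * (1 + y) = 1"
    using vu_pow[of "2 ^ Suc e"] u_two_power[of "Suc e"] unfolding V_def y_def q by simp
  then have V1: "V = 1 - y * V"
    by (simp add: yV algebra_simps)
  have nil_tr: "tr (y * C) = 0" if "y * C = C * y" for C
    using tr_nilpotent_mult[OF y_nil that] .
  have comm: "y * (A * B) = A * B * y" if "y * A = A * y" "y * B = B * y" for A B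
    using that by (metis mult.assoc)
  have "v ^ p = V * (1 + z)"
  proof -
    have "V * u ^ p = v ^ p * (v ^ p * u ^ p)" by (simp add: V_def mult_2 power_add mult.assoc)
    then show ?thesis using vu_pow[of p] u_two_power[of e] by (simp add: p z_def)
  qed
  then have "tr (z * (W * v ^ p)) = tr (z * W * V) + tr (z * W * V * z)"
    by (simp add: algebra_simps tr_add)
  also have "tr (z * W * V * z) = tr (y * (W * V))"
    using tr_comm[of "z * W * V" z] zz by (simp add: mult.assoc[symmetric])
  also have "\<dots> = 0" by (rule nil_tr) (intro comm yW yV)
  also have "tr (z * W * V) = tr (z * W) - tr (z * W * (y * V))"
    by (subst V1) (simp add: right_diff_distrib tr_diff)
  also have "z * W * (y * V) = y * (z * W * V)"
    using comm[OF yz yW] by (metis mult.assoc)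
  also have "tr (y * (z * W * V)) = 0" by (rule nil_tr) (intro comm yz yW yV)
  finally show ?thesis by (simp add: z_def)
qed

end

no_notation fps_nth (infixl \<open>$\<close> 75)

section \<open>Nilpotent matrices\<close>

text \<open>Square matrices as a type of their own, since the product of the type
  \<open>'a ^ 'n ^ 'n\<close> is componentwise.\<close>

typedef ('a, 'n) sqmat = "UNIV :: ('a ^ 'n ^ 'n) set"
  morphisms of_sqmat to_sqmat ..

setup_lifting type_definition_sqmat

lemma matrix_add_rdistrib: "(A + B) ** C = A ** C + B ** (C :: 'a::semiring_1 ^ 'n ^ 'n)"
  by (vector matrix_matrix_mult_def sum.distrib[symmetric] field_simps)

instantiation sqmat :: (comm_ring_1, finite) ring_1
begin

lift_definition zero_sqmat :: "('a, 'b) sqmat" is 0 .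
lift_definition one_sqmat :: "('a, 'b) sqmat" is "mat 1" .
lift_definition plus_sqmat :: "('a, 'b) sqmat \<Rightarrow> ('a, 'b) sqmat \<Rightarrow> ('a, 'b) sqmat" is "(+)" .
lift_definition minus_sqmat :: "('a, 'b) sqmat \<Rightarrow> ('a, 'b) sqmat \<Rightarrow> ('a, 'b) sqmat" is "(-)" .
lift_definition uminus_sqmat :: "('a, 'b) sqmat \<Rightarrow> ('a, 'b) sqmat" is uminus .
lift_definition times_sqmat :: "('a, 'b) sqmat \<Rightarrow> ('a, 'b) sqmat \<Rightarrow> ('a, 'b) sqmat" is "(**)" .

instance
proof
  show "(0::('a, 'b) sqmat) \<noteq> 1"
    by transfer (auto simp: vec_eq_iff mat_def)
qed (transfer; simp add: matrix_mul_assoc matrix_add_ldistrib matrix_add_rdistrib)+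

end

lift_definition entry :: "('a, 'n::finite) sqmat \<Rightarrow> 'n \<Rightarrow> 'n \<Rightarrow> 'a" is "\<lambda>A i j. A $ i $ j" .
lift_definition mk_sqmat :: "('n \<Rightarrow> 'n \<Rightarrow> 'a) \<Rightarrow> ('a, 'n::finite) sqmat" is "\<lambda>f. \<chi> i j. f i j" .
lift_definition sqtrace :: "('a::comm_ring_1, 'n::finite) sqmat \<Rightarrow> 'a" is trace .

lemma sqmat_eqI: "(\<And>i j. entry A i j = entry B i j) \<Longrightarrow> A = B"
  by transfer (simp add: vec_eq_iff)

lemma entry_simps [simp]:
  fixes A B :: "('a::comm_ring_1, 'n::finite) sqmat"
  shows "entry (0 :: ('a, 'n) sqmat) i j = 0"
    "entry (A + B) i j = entry A i j + entry B i j"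
    "entry (A - B) i j = entry A i j - entry B i j"
    "entry (1 :: ('a, 'n) sqmat) i j = (if i = j then 1 else 0)"
  by (transfer; simp add: mat_def)+

lemma entry_mk [simp]: "entry (mk_sqmat f) i j = f i j"
  by transfer simp

lemma entry_times: "entry (A * B) i j = (\<Sum>k\<in>UNIV. entry A i k * entry B k j)"
  by transfer (simp add: matrix_matrix_mult_def)

lemma entry_sum: "entry (sum f S) i j = (\<Sum>x\<in>S. entry (f x) i j)"
  for f :: "_ \<Rightarrow> ('a::comm_ring_1, 'n::finite) sqmat"
  by (induction S rule: infinite_finite_induct) simp_all

lemma sqtrace_eq: "sqtrace A = (\<Sum>i\<in>UNIV. entry A i i)"
  by transfer (simp add: trace_def)

lemma CHAR_sqmat:
  assumes "CHAR('a) = 2"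
  shows "CHAR(('a::field, 'n::finite) sqmat) = 2"
proof -
  have "(1::'a) + 1 = 0" by (rule char2_add_self[OF assms])
  then have "(1 :: ('a, 'n) sqmat) + 1 = 0"
    by (intro sqmat_eqI) (auto simp only: entry_simps add_0 split: if_splits)
  then have "of_nat 2 = (0 :: ('a, 'n) sqmat)" by simp
  then have "CHAR(('a, 'n) sqmat) dvd 2" by (metis of_nat_eq_0_iff_char_dvd)
  moreover have "CHAR(('a, 'n) sqmat) \<noteq> 1"
    by (metis of_nat_1 of_nat_CHAR zero_neq_one)
  ultimately show ?thesis using two_is_prime_nat by (metis prime_nat_iff)
qed

text \<open>Both sides are double sums symmetric in the two indices, so both collapse to the sum of
  the squared diagonal entries.\<close>

lemma sqtrace_square:
  assumes "CHAR('a) = 2"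
  shows "sqtrace (A * A) = (sqtrace (A :: ('a::field, 'n::finite) sqmat))\<^sup>2"
proof -
  have "sqtrace (A * A) = (\<Sum>i\<in>UNIV. \<Sum>j\<in>UNIV. entry A i j * entry A j i)"
    by (simp add: sqtrace_eq entry_times)
  also have "\<dots> = (\<Sum>i\<in>UNIV. entry A i i * entry A i i)"
    using assms by (intro char2_sum_symmetric) simp_all
  also have "\<dots> = (\<Sum>i\<in>UNIV. \<Sum>j\<in>UNIV. entry A i i * entry A j j)"
    using assms by (intro char2_sum_symmetric[symmetric]) simp_all
  also have "\<dots> = (sqtrace A)\<^sup>2"
    by (simp add: sqtrace_eq power2_eq_square sum_product)
  finally show ?thesis .
qed

lemma char2_trace_sqtrace:
  assumes "CHAR('a) = 2"
  shows "char2_trace (sqtrace :: ('a::field, 'n::finite) sqmat \<Rightarrow> 'a)"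
proof
  fix A B :: "('a, 'n) sqmat"
  show "sqtrace (A + B) = sqtrace A + sqtrace B" by transfer (rule trace_add)
  show "sqtrace (A * B) = sqtrace (B * A)" by transfer (rule trace_mul_sym)
qed (use assms in \<open>simp_all add: sqtrace_square CHAR_sqmat\<close>)

subsection \<open>Graded nilpotent matrices\<close>

text \<open>If y raises the degree by one, then only components of A of degree \<open>\<delta>\<close> with
  \<open>2\<delta> + 2c + 1 = 0\<close> could contribute to the trace below.\<close>

context
  fixes y :: "('k::field, 'n::finite) sqmat" and deg :: "'n \<Rightarrow> int"
  assumes char2: "CHAR('k) = 2"
    and deg: "\<And>i j. entry y i j \<noteq> 0 \<Longrightarrow> deg i = deg j + 1"
begin

definition component :: "int \<Rightarrow> ('k, 'n) sqmat \<Rightarrow> ('k, 'n) sqmat" where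
  "component \<delta> A = mk_sqmat (\<lambda>i j. if deg i - deg j = \<delta> then entry A i j else 0)"

lemma entry_component: "entry (component \<delta> A) i j = (if deg i - deg j = \<delta> then entry A i j else 0)"
  by (simp add: component_def)

lemma commutator_component: "commutator y (component \<delta> A) = component (\<delta> + 1) (commutator y A)"
proof (rule sqmat_eqI)
  fix i j
  have "entry y i k * entry (component \<delta> A) k j = (if deg i - deg j = \<delta> + 1 then entry y i k * entry A k j else 0)"
    for k using deg[of i k] by (cases "entry y i k = 0") (auto simp: entry_component)
  moreover have "entry (component \<delta> A) i k * entry y k j = (if deg i - deg j = \<delta> + 1 then entry A i k * entry y k j else 0)"
    for k using deg[of k j] by (cases "entry y k j = 0") (auto simp: entry_component)
  ultimately show "entry (commutator y (component \<delta> A)) i j = entry (component (\<delta> + 1) (commutator y A)) i j"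
    by (simp add: commutator_def entry_times entry_component)
qed

lemma ad_pow_component: "ad_pow y k (component \<delta> A) = component (\<delta> + int k) (ad_pow y k A)"
  by (induction k) (simp_all add: commutator_component algebra_simps)

lemma sum_component:
  "(\<Sum>\<delta>\<in>(\<lambda>(i, j). deg i - deg j) ` UNIV. component \<delta> A) = A"
  by (rule sqmat_eqI) (auto simp: entry_sum entry_component)

text \<open>The assumption makes ad(y)^(2c) of every component of A commute with y, so the form
  \<open>\<beta>\<close> is symmetric and only its diagonal survives in characteristic 2. A diagonal
  term is the trace of a homogeneous element of odd degree.\<close>

lemma sqtrace_graded:
  assumes A: "ad_pow y (2 * c + 1) A = 0"
  shows "sqtrace (y * ad_pow y (2 * c) A * A) = 0"
proof -
  interpret char2_trace "sqtrace :: ('k, 'n) sqmat \<Rightarrow> 'k" by (rule char2_trace_sqtrace[OF char2])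
  define S where "S = (\<lambda>(i, j). deg i - deg j) ` (UNIV :: ('n \<times> 'n) set)"
  define \<beta> where "\<beta> \<delta> \<epsilon> = sqtrace (y * ad_pow y (2 * c) (component \<delta> A) * component \<epsilon> A)" for \<delta> \<epsilon>
  have "component \<delta> 0 = 0" for \<delta> by (rule sqmat_eqI) (simp add: entry_component)
  then have comm: "y * ad_pow y (2 * c) (component \<delta> A) = ad_pow y (2 * c) (component \<delta> A) * y" for \<delta>
    using ad_pow_component[of "2 * c + 1" \<delta> A] A by (simp add: commutator_def)
  have sym: "\<beta> \<delta> \<epsilon> = \<beta> \<epsilon> \<delta>" for \<delta> \<epsilon>
  proof -
    have "\<beta> \<delta> \<epsilon> = sqtrace (ad_pow y (2 * c) (component \<delta> A) * (y * component \<epsilon> A))"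
      by (simp add: \<beta>_def comm mult.assoc)
    also have "\<dots> = sqtrace (component \<delta> A * (y * ad_pow y (2 * c) (component \<epsilon> A)))"
      by (simp add: tr_ad_adjoint ad_pow_mult_left)
    finally show ?thesis by (simp add: \<beta>_def tr_comm)
  qed
  have "\<beta> \<delta> \<delta> = 0" for \<delta>
  proof -
    have "entry (y * ad_pow y (2 * c) (component \<delta> A)) i j * entry (component \<delta> A) j i = 0" for i j
    proof (cases "deg j - deg i = \<delta>")
      case True
      have "entry y i k * entry (component (\<delta> + 2 * int c) B) k j = 0" for k B
      proof (cases "entry y i k = 0 \<or> deg k - deg j \<noteq> \<delta> + 2 * int c")
        case False
        then have "deg i = deg k + 1" "deg k - deg j = \<delta> + 2 * int c" using deg by auto
        with True have "2 * (\<delta> + int c) + 1 = 0" by simp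
        then have False by presburger
        then show ?thesis ..
      qed (auto simp: entry_component)
      then have "entry (y * ad_pow y (2 * c) (component \<delta> A)) i j = 0"
        unfolding ad_pow_component entry_times by (intro sum.neutral) simp
      then show ?thesis by simp
    qed (simp add: entry_component)
    then show ?thesis
      unfolding \<beta>_def sqtrace_eq entry_times[of _ "component \<delta> A"] by (simp only: sum.neutral_const)
  qed
  moreover have "sqtrace (y * ad_pow y (2 * c) A * A) = (\<Sum>\<delta>\<in>S. \<Sum>\<epsilon>\<in>S. \<beta> \<delta> \<epsilon>)"
  proof -
    have "A = (\<Sum>\<delta>\<in>S. component \<delta> A)" by (simp add: S_def sum_component)
    then have "sqtrace (y * ad_pow y (2 * c) A * A)
        = sqtrace (y * ad_pow y (2 * c) (\<Sum>\<delta>\<in>S. component \<delta> A) * (\<Sum>\<epsilon>\<in>S. component \<epsilon> A))"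
      by simp
    then show ?thesis
      by (simp add: \<beta>_def ad_pow_sum sum_distrib_left sum_distrib_right tr_sum) (rule sum.swap)
  qed
  moreover have "(\<Sum>\<delta>\<in>S. \<Sum>\<epsilon>\<in>S. \<beta> \<delta> \<epsilon>) = (\<Sum>\<delta>\<in>S. \<beta> \<delta> \<delta>)"
    by (rule char2_sum_symmetric[OF char2]) (simp_all add: S_def sym)
  ultimately show ?thesis by simp
qed

end

subsection \<open>Counting residues\<close>

lemma card_residue_class:
  assumes "j0 < (q::nat)"
  shows "card {j. j < m \<and> j mod q = j0} = m div q + (if j0 < m mod q then 1 else 0)"
proof -
  define K where "K = m div q + (if j0 < m mod q then 1 else 0)"
  have m: "q * (m div q) + m mod q = m" by simp
  have iff: "j0 + q * a < m \<longleftrightarrow> a < K" for a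
  proof -
    consider "a < m div q" | "a = m div q" | "m div q < a" by linarith
    then show ?thesis
    proof cases
      case 1
      then have "q * Suc a \<le> q * (m div q)" by (intro mult_le_mono2) simp
      moreover have "q * (m div q) \<le> m" by simp
      ultimately have "j0 + q * a < m" using assms unfolding mult_Suc_right by linarith
      then show ?thesis using 1 by (simp add: K_def)
    next
      case 2
      have "j0 + q * (m div q) < m \<longleftrightarrow> j0 < m mod q" using m by linarith
      then show ?thesis using 2 by (simp add: K_def)
    next
      case 3
      then have "q * Suc (m div q) \<le> q * a" by (intro mult_le_mono2) simp
      moreover have "m mod q < q" using assms by simp
      ultimately have "\<not> j0 + q * a < m" using m unfolding mult_Suc_right by linarith
      then show ?thesis using 3 by (simp add: K_def)
    qed
  qed
  have "{j. j < m \<and> j mod q = j0} = (\<lambda>a. j0 + q * a) ` {..<K}"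
  proof (intro set_eqI iffI)
    fix j assume j: "j \<in> {j. j < m \<and> j mod q = j0}"
    have eq: "j0 + q * (j div q) = j" using j mod_mult_div_eq[of j q] by simp
    have "j div q < K" using j iff[of "j div q"] unfolding eq by blast
    then show "j \<in> (\<lambda>a. j0 + q * a) ` {..<K}"
      unfolding image_iff lessThan_iff Bex_def using eq by metis
  next
    fix j assume "j \<in> (\<lambda>a. j0 + q * a) ` {..<K}"
    then obtain a where a: "j = j0 + q * a" "a < K" by blast
    then show "j \<in> {j. j < m \<and> j mod q = j0}" using iff[of a] assms by simp
  qed
  moreover have "inj_on (\<lambda>a. j0 + q * a) {..<K}" using assms by (auto simp: inj_on_def)
  ultimately show ?thesis by (simp add: card_image K_def)
qed

text \<open>Let k and r be quotient and remainder of m by 2p. Only the incomplete last period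
  matters: the class of j0 can be shifted by p below m iff j0 + p < r or r <= j0, and its size is k
  + 1 or k accordingly. Odd size therefore needs the first alternative for even k, possible iff p <
  r, and the second for odd k, possible iff r < p.\<close>

lemma cob_digit_iff_residue:
  assumes "0 < p"
  shows "cob_digit p m \<longleftrightarrow>
    (\<exists>j0<p. (\<forall>j<m. j mod (2 * p) = j0 \<longrightarrow> j + p < m) \<and> odd (card {j. j < m \<and> j mod (2 * p) = j0}))"
proof -
  define k r where "k = m div (2 * p)" and "r = m mod (2 * p)"
  have m: "m = 2 * p * k + r" and r: "r < 2 * p" using assms by (simp_all add: k_def r_def)
  have closed: "(\<forall>j<m. j mod (2 * p) = j0 \<longrightarrow> j + p < m) \<longleftrightarrow> j0 + p < r \<or> r \<le> j0" if "j0 < p" for j0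
  proof
    assume a: "\<forall>j<m. j mod (2 * p) = j0 \<longrightarrow> j + p < m"
    show "j0 + p < r \<or> r \<le> j0"
      using a[rule_format, of "2 * p * k + j0"] m that by auto
  next
    assume a: "j0 + p < r \<or> r \<le> j0"
    show "\<forall>j<m. j mod (2 * p) = j0 \<longrightarrow> j + p < m"
    proof (intro allI impI)
      fix j assume j: "j < m" "j mod (2 * p) = j0"
      define b where "b = j div (2 * p)"
      have jb: "j = 2 * p * b + j0" unfolding b_def using j(2) mod_mult_div_eq[of j "2 * p"] by linarith
      have "b \<le> k" using j(1) by (simp add: b_def k_def div_le_mono)
      show "j + p < m"
      proof (cases "b = k")
        case True
        then show ?thesis using a j m jb by auto
      next
        case False
        then have "2 * p * Suc b \<le> 2 * p * k" using \<open>b \<le> k\<close> by (intro mult_le_mono2) simp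
        then show ?thesis using jb that m by simp
      qed
    qed
  qed
  have "(\<exists>j0<p. (j0 + p < r \<or> r \<le> j0) \<and> odd (k + (if j0 < r then 1 else 0))) \<longleftrightarrow> cob_digit p m"
  proof (cases "even k")
    case True
    have "(\<exists>j0<p. (j0 + p < r \<or> r \<le> j0) \<and> odd (k + (if j0 < r then 1 else 0))) \<longleftrightarrow> p < r"
    proof
      assume "p < r"
      then have "0 < p \<and> (0 + p < r \<or> r \<le> 0) \<and> odd (k + (if 0 < r then 1 else 0))"
        using True assms by simp
      then show "\<exists>j0<p. (j0 + p < r \<or> r \<le> j0) \<and> odd (k + (if j0 < r then 1 else 0))" by blast
    qed (use True in \<open>auto split: if_splits\<close>)
    then show ?thesis using True by (simp add: cob_digit_def k_def r_def)
  next
    case False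
    have "(\<exists>j0<p. (j0 + p < r \<or> r \<le> j0) \<and> odd (k + (if j0 < r then 1 else 0))) \<longleftrightarrow> r < p"
      using False by (auto split: if_splits)
    then show ?thesis using False by (simp add: cob_digit_def k_def r_def)
  qed
  moreover have "card {j. j < m \<and> j mod (2 * p) = j0} = k + (if j0 < r then 1 else 0)" if "j0 < p" for j0
    using that card_residue_class[of j0 "2 * p" m] by (simp add: k_def r_def)
  ultimately show ?thesis by (simp add: closed cong: conj_cong)
qed

text \<open>Here f j stands for the entry in row j and column j + p of a diagonal block of size m,
  for a matrix commuting with J^(2p): such entries are 2p-periodic and vanish where the period would
  leave the block. A residue class contributes its size times a common value.\<close>

lemma sum_periodic_eq_0:
  fixes f :: "nat \<Rightarrow> 'k::field"
  assumes char2: "CHAR('k) = 2" and p: "0 < p"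
    and per: "\<And>j. j + 3 * p < m \<Longrightarrow> f (j + 2 * p) = f j"
    and first: "\<And>j. p \<le> j \<Longrightarrow> j < 2 * p \<Longrightarrow> j + p < m \<Longrightarrow> f j = 0"
    and last: "\<And>j. j + 2 * p < m \<Longrightarrow> m \<le> j + 3 * p \<Longrightarrow> f j = 0"
    and cob: "\<not> cob_digit p m"
  shows "(\<Sum>j<m - p. f j) = 0"
proof -
  define R where "R j0 = {j \<in> {..<m - p}. j mod (2 * p) = j0}" for j0
  have const: "f j = f (j mod (2 * p))" if "j + p < m" for j
    using that
  proof (induction j rule: less_induct)
    case (less j)
    show ?case
    proof (cases "j < 2 * p")
      case False
      then have "f j = f (j - 2 * p)" using per[of "j - 2 * p"] less.prems by simp
      also have "\<dots> = f ((j - 2 * p) mod (2 * p))" using less.IH[of "j - 2 * p"] less.prems False p by simp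
      finally show ?thesis using False by (simp add: le_mod_geq)
    qed simp
  qed
  have "sum f (R j0) = 0" if j0: "j0 < 2 * p" for j0
  proof -
    have R: "sum f (R j0) = of_nat (card (R j0)) * f j0"
    proof -
      have "sum f (R j0) = (\<Sum>j\<in>R j0. f j0)"
        by (rule sum.cong) (auto simp: R_def intro!: const)
      then show ?thesis by simp
    qed
    show ?thesis
    proof (cases "R j0 = {}")
      case False
      then obtain j1 where j1: "j1 + p < m" "j1 mod (2 * p) = j0" by (auto simp: R_def less_diff_conv)
      have "j0 \<le> j1" using j1(2) mod_less_eq_dividend by blast
      show ?thesis
      \<comment> \<open>A class is forced to 0 by \<open>first\<close> if its residue is at least p,
        and by \<open>last\<close> if one of its elements cannot be shifted by p; \<open>cob\<close>
        makes every other class even.\<close>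
      proof (cases "p \<le> j0 \<or> (\<exists>j<m. j mod (2 * p) = j0 \<and> m \<le> j + p)")
        case True
        have "f j0 = 0"
        proof (cases "p \<le> j0")
          case True
          then show ?thesis using first[of j0] j0 j1 \<open>j0 \<le> j1\<close> by simp
        next
          case F: False
          with True obtain j where j: "j < m" "j mod (2 * p) = j0" "m \<le> j + p" by blast
          \<comment> \<open>\<open>j\<close> is the top of its class. It is not also the bottom,
            because \<open>j1\<close> in the same class can still be shifted by p; so
            \<open>j - 2 * p\<close> is available for \<open>last\<close>.\<close>
          have "2 * p \<le> j"
          proof (rule ccontr)
            assume "\<not> 2 * p \<le> j"
            then have "j = j0" using j(2) by simp
            then show False using j(3) j1(1) \<open>j0 \<le> j1\<close> by simp
          qed
          then have "f (j - 2 * p) = 0" using last[of "j - 2 * p"] j by simp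
          moreover have "f (j - 2 * p) = f j0"
            using const[of "j - 2 * p"] \<open>2 * p \<le> j\<close> j p by (simp add: le_mod_geq)
          ultimately show ?thesis by simp
        qed
        with R show ?thesis by simp
      next
        case False
        then have "R j0 = {j. j < m \<and> j mod (2 * p) = j0}"
          by (force simp: R_def)
        moreover have "even (card {j. j < m \<and> j mod (2 * p) = j0})"
          using cob False cob_digit_iff_residue[OF p, of m] by (meson leI)
        ultimately show ?thesis
          using R char2 by (simp add: of_nat_eq_0_iff_char_dvd)
      qed
    qed simp
  qed
  moreover have "(\<Sum>j<m - p. f j) = (\<Sum>j0<2 * p. sum f (R j0))"
    unfolding R_def by (rule sum.group[symmetric]) (use p in auto)
  ultimately show ?thesis by simp
qed

subsection \<open>Matrices in Jordan form\<close>

lemma finite_block_index [simp]: "finite (block_index s)"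
proof -
  have "block_index s = Sigma {..<length s} (\<lambda>i. {..<s ! i})" by (auto simp: block_index_def)
  then show ?thesis by simp
qed

text \<open>The Jordan matrix maps the basis vector with label \<open>(i, j)\<close>, the j-th vector of
  block i, to the one with label \<open>(i, j + 1)\<close>. The first argument of F in
  \<open>lmat F\<close> is the row label.\<close>

locale jordan_labelling =
  fixes ds :: "nat list" and lab :: "'n::finite \<Rightarrow> nat \<times> nat"
  assumes lab: "bij_betw lab UNIV (block_index ds)"
begin

definition lmat :: "(nat \<times> nat \<Rightarrow> nat \<times> nat \<Rightarrow> 'k::field) \<Rightarrow> ('k, 'n) sqmat" where
  "lmat F = mk_sqmat (\<lambda>a b. F (lab a) (lab b))"

definition J :: "('k::field, 'n) sqmat" where
  "J = lmat (\<lambda>x y. if x = (fst y, Suc (snd y)) then 1 else 0)"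

lemma lab_mem: "lab a \<in> block_index ds"
  using lab by (auto simp: bij_betw_def)

lemma lab_block: "fst (lab a) < length ds" "snd (lab a) < ds ! fst (lab a)"
  using lab_mem[of a] by (auto simp: block_index_def)

lemma lab_eq_iff [simp]: "lab a = lab b \<longleftrightarrow> a = b"
  using lab by (auto simp: bij_betw_def inj_on_def)

lemma sum_block_index: "(\<Sum>x\<in>block_index ds. g x) = (\<Sum>i<length ds. \<Sum>j<ds ! i. g (i, j))"
proof -
  have "block_index ds = Sigma {..<length ds} (\<lambda>i. {..<ds ! i})"
    by (auto simp: block_index_def)
  moreover have "(\<Sum>i<length ds. \<Sum>j<ds ! i. g (i, j)) = (\<Sum>(i, j)\<in>Sigma {..<length ds} (\<lambda>i. {..<ds ! i}). g (i, j))"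
    by (rule sum.Sigma) auto
  ultimately show ?thesis by (simp add: case_prod_unfold)
qed

lemma sum_lab: "(\<Sum>a\<in>UNIV. g (lab a)) = (\<Sum>x\<in>block_index ds. g x)"
  by (rule sum.reindex_bij_betw[OF lab])

lemma lmat_eqI:
  assumes "\<And>i j i' j'. \<lbrakk>i < length ds; j < ds ! i; i' < length ds; j' < ds ! i'\<rbrakk>
      \<Longrightarrow> F (i, j) (i', j') = G (i, j) (i', j')"
  shows "lmat F = lmat G"
proof (rule sqmat_eqI)
  fix a b
  show "entry (lmat F) a b = entry (lmat G) a b"
    using assms[OF lab_block[of a] lab_block[of b]] by (simp add: lmat_def)
qed

lemma lmat_eqD:
  assumes "lmat F = lmat G" "x \<in> block_index ds" "y \<in> block_index ds"
  shows "F x y = G x y"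
proof -
  obtain a b where "x = lab a" "y = lab b"
    using assms(2,3) bij_betw_imp_surj_on[OF lab] by (metis imageE)
  then show ?thesis
    using arg_cong[OF assms(1), of "\<lambda>A. entry A a b"] by (simp add: lmat_def)
qed

lemma ex_lmat: "\<exists>F. A = lmat F"
proof
  show "A = lmat (\<lambda>x y. entry A (inv lab x) (inv lab y))"
    using bij_betw_imp_inj_on[OF lab] by (intro sqmat_eqI) (simp add: lmat_def)
qed

lemma lmat_times: "lmat F * lmat G = lmat (\<lambda>x y. \<Sum>z\<in>block_index ds. F x z * G z y)"
  by (rule sqmat_eqI) (simp add: lmat_def entry_times sum_lab[symmetric])

lemma one_eq_lmat: "1 = lmat (\<lambda>x y. if x = y then 1 else 0)"
  by (rule sqmat_eqI) (simp add: lmat_def)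

lemma lmat_sum: "(\<Sum>t\<in>S. lmat (F t)) = lmat (\<lambda>x y. \<Sum>t\<in>S. F t x y)"
  by (rule sqmat_eqI) (simp add: lmat_def entry_sum)

lemma sqtrace_lmat: "sqtrace (lmat F) = (\<Sum>i<length ds. \<Sum>j<ds ! i. F (i, j) (i, j))"
  by (simp add: sqtrace_eq lmat_def sum_lab[of "\<lambda>x. F x x"] sum_block_index)

lemma J_times: "J * lmat F = lmat (\<lambda>x y. if 0 < snd x then F (fst x, snd x - 1) y else 0)"
  unfolding J_def lmat_times
proof (rule lmat_eqI)
  fix i j i' j' assume *: "i < length ds" "j < ds ! i"
  have "(\<Sum>z\<in>block_index ds. (if (i, j) = (fst z, Suc (snd z)) then 1 else 0) * F z (i', j'))
      = (\<Sum>z\<in>block_index ds. if z = (i, j - 1) then (if 0 < j then F z (i', j') else 0) else 0)"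
    by (rule sum.cong) auto
  also have "\<dots> = (if 0 < j then F (i, j - 1) (i', j') else 0)"
    using * finite_block_index[of ds] by (auto simp: block_index_def)
  finally show "(\<Sum>z\<in>block_index ds. (if (i, j) = (fst z, Suc (snd z)) then 1 else 0) * F z (i', j'))
      = (if 0 < snd (i, j) then F (fst (i, j), snd (i, j) - 1) (i', j') else 0)" by simp
qed

lemma times_J: "lmat F * J = lmat (\<lambda>x y. if Suc (snd y) < ds ! fst y then F x (fst y, Suc (snd y)) else 0)"
  unfolding J_def lmat_times
proof (rule lmat_eqI)
  fix i j i' j' assume *: "i' < length ds" "j' < ds ! i'"
  have "(\<Sum>z\<in>block_index ds. F (i, j) z * (if z = (fst (i', j'), Suc (snd (i', j'))) then 1 else 0))
      = (\<Sum>z\<in>block_index ds. if z = (i', Suc j') then F (i, j) z else 0)"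
    by (rule sum.cong) auto
  also have "\<dots> = (if Suc j' < ds ! i' then F (i, j) (i', Suc j') else 0)"
    using * finite_block_index[of ds] by (auto simp: block_index_def)
  finally show "(\<Sum>z\<in>block_index ds. F (i, j) z * (if z = (fst (i', j'), Suc (snd (i', j'))) then 1 else 0))
      = (if Suc (snd (i', j')) < ds ! fst (i', j') then F (i, j) (fst (i', j'), Suc (snd (i', j'))) else 0)"
    by simp
qed

lemma J_pow_times: "J ^ k * lmat F = lmat (\<lambda>x y. if k \<le> snd x then F (fst x, snd x - k) y else 0)"
proof (induction k)
  case (Suc k)
  then show ?case by (simp add: mult.assoc J_times) (rule lmat_eqI, auto)
qed (auto intro: lmat_eqI)

lemma times_J_pow:
  "lmat F * J ^ k = lmat (\<lambda>x y. if snd y + k < ds ! fst y then F x (fst y, snd y + k) else 0)"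
proof (induction k)
  case (Suc k)
  have "lmat F * J ^ Suc k = lmat F * J ^ k * J" by (simp only: power_Suc2 mult.assoc)
  then show ?case by (simp add: Suc times_J) (rule lmat_eqI, auto)
qed (auto intro: lmat_eqI)

lemma J_pow: "J ^ k = lmat (\<lambda>x y. if k \<le> snd x \<and> (fst x, snd x - k) = y then 1 else 0)"
proof -
  have "J ^ k = J ^ k * lmat (\<lambda>x y. if x = y then 1 else 0)"
    by (simp add: one_eq_lmat[symmetric])
  also have "\<dots> = lmat (\<lambda>x y. if k \<le> snd x \<and> (fst x, snd x - k) = y then 1 else 0)"
    unfolding J_pow_times by (rule lmat_eqI) auto
  finally show ?thesis .
qed

lemma J_nilpotent: "(J :: ('k::field, 'n) sqmat) ^ sum_list ds = 0"
proof -
  have "(J :: ('k, 'n) sqmat) ^ sum_list ds = lmat (\<lambda>x y. 0)"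
    unfolding J_pow
    by (rule lmat_eqI) (auto dest!: leD member_le_sum_list[OF nth_mem])
  then show ?thesis by (intro sqmat_eqI) (simp add: lmat_def)
qed

text \<open>Supplies the grading for \<open>sqtrace_graded\<close>: positions inside a block,
  measured in units of q and rounded down.\<close>

lemma J_pow_degree:
  assumes "0 < q" "entry (J ^ q) a b \<noteq> 0"
  shows "int (snd (lab a) div q) = int (snd (lab b) div q) + 1"
proof -
  have "q \<le> snd (lab a)" "(fst (lab a), snd (lab a) - q) = lab b"
    using assms(2) by (auto simp: J_pow lmat_def split: if_splits)
  then have "snd (lab a) = snd (lab b) + q" by (metis le_add_diff_inverse2 snd_conv)
  then show ?thesis using assms(1) by simp
qed

end

locale char2_jordan = jordan_labelling ds lab
  for ds and lab :: "'n::finite \<Rightarrow> nat \<times> nat" +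
  fixes ty :: "'k::field itself"
  assumes char2: "CHAR('k) = 2"
begin

sublocale char2_trace "sqtrace :: ('k, 'n) sqmat \<Rightarrow> 'k"
  by (rule char2_trace_sqtrace[OF char2])

text \<open>A sends the last vector of each piece of length q to the first one. In the sum of the
  J^t A J^(q-1-t), a vector at offset t of its piece is moved to the last place, then to the first,
  then back; every other term kills it. Divisibility by q ensures that all pieces are complete. Only
  A J^(q-1) has diagonal entries, one for each piece.\<close>

lemma ad_pow_J_root_of_one:
  assumes q: "q = 2 ^ e" and dvd: "\<And>d. d \<in> set ds \<Longrightarrow> q dvd d"
  obtains A :: "('k, 'n) sqmat"
  where "ad_pow J (q - 1) A = 1" "\<And>t. t < q - 1 \<Longrightarrow> sqtrace (A * J ^ t) = 0"
    "sqtrace (A * J ^ (q - 1)) = of_nat (sum_list ds div q)"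
proof
  define F :: "nat \<times> nat \<Rightarrow> nat \<times> nat \<Rightarrow> 'k" where
    "F x y = (if fst x = fst y \<and> snd y = snd x + (q - 1) \<and> q dvd snd x then 1 else 0)" for x y
  have q0: "0 < q" by (simp add: q)
  have dvd': "q dvd ds ! i" if "i < length ds" for i using dvd that by simp
  have room: "j - t + (q - 1) < ds ! i" if *: "i < length ds" "j < ds ! i" "q dvd j - t" for i j t
  proof -
    obtain a b where ab: "j - t = q * a" "ds ! i = q * b" using *(3) dvd'[OF *(1)] by (auto simp: dvd_def)
    have "q * a < q * b" using ab *(2) by linarith
    then have "q * Suc a \<le> q * b" using q0 by (intro mult_le_mono2) simp
    then show ?thesis using ab q0 by simp
  qed
  have "ad_pow J (q - 1) (lmat F) = (\<Sum>t<q. J ^ t * lmat F * J ^ (q - 1 - t))"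
    unfolding q by (rule ad_pow_two_power_minus_1)
  also have "\<dots> = lmat (\<lambda>x y. \<Sum>t<q. if snd y + (q - 1 - t) < ds ! fst y \<and> t \<le> snd x
      then F (fst x, snd x - t) (fst y, snd y + (q - 1 - t)) else 0)"
    unfolding J_pow_times times_J_pow lmat_sum
    by (intro arg_cong[of _ _ lmat] ext sum.cong) auto
  also have "\<dots> = 1" unfolding one_eq_lmat
  proof (rule lmat_eqI)
    fix i j i' j' assume *: "i < length ds" "j < ds ! i" "i' < length ds" "j' < ds ! i'"
    have "(if snd (i', j') + (q - 1 - t) < ds ! fst (i', j') \<and> t \<le> snd (i, j)
        then F (fst (i, j), snd (i, j) - t) (fst (i', j'), snd (i', j') + (q - 1 - t)) else 0)
      = (if t = j mod q then (if (i, j) = (i', j') then 1 else 0) else 0)" if "t < q" for t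
    proof -
      have "t = j mod q \<longleftrightarrow> t \<le> j \<and> q dvd j - t"
      proof
        assume "t \<le> j \<and> q dvd j - t"
        then show "t = j mod q" using that by (metis mod_eq_dvd_iff_nat mod_less)
      qed (simp add: minus_mod_eq_mult_div)
      moreover have "j' + (q - 1 - t) = j - t + (q - 1) \<longleftrightarrow> j = j'" if "t \<le> j"
        using that \<open>t < q\<close> by auto
      ultimately show ?thesis using room[of i j t] * by (auto simp: F_def)
    qed
    then have "(\<Sum>t<q. if snd (i', j') + (q - 1 - t) < ds ! fst (i', j') \<and> t \<le> snd (i, j)
        then F (fst (i, j), snd (i, j) - t) (fst (i', j'), snd (i', j') + (q - 1 - t)) else 0)
      = (\<Sum>t<q. if t = j mod q then (if (i, j) = (i', j') then 1 else 0) else 0)"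
      by (intro sum.cong) auto
    also have "\<dots> = (if (i, j) = (i', j') then 1 else 0)" using q0 by simp
    finally show "(\<Sum>t<q. if snd (i', j') + (q - 1 - t) < ds ! fst (i', j') \<and> t \<le> snd (i, j)
        then F (fst (i, j), snd (i, j) - t) (fst (i', j'), snd (i', j') + (q - 1 - t)) else 0)
      = (if (i, j) = (i', j') then 1 else 0)" .
  qed
  finally show "ad_pow J (q - 1) (lmat F) = 1" .
  have tr: "sqtrace (lmat F * J ^ t) = (\<Sum>i<length ds. \<Sum>j<ds ! i. if j + t < ds ! i \<and> t = q - 1 \<and> q dvd j then 1 else 0)"
    for t unfolding times_J_pow sqtrace_lmat
    by (intro sum.cong) (auto simp: F_def)
  show "sqtrace (lmat F * J ^ t) = 0" if "t < q - 1" for t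
    unfolding tr using that by (intro sum.neutral ballI) auto
  have "sqtrace (lmat F * J ^ (q - 1)) = (\<Sum>i<length ds. \<Sum>j<ds ! i. if j mod q = 0 then 1 else 0)"
    unfolding tr
  proof (intro sum.cong refl)
    fix i j assume "i \<in> {..<length ds}" "j \<in> {..<ds ! i}"
    then show "(if j + (q - 1) < ds ! i \<and> q - 1 = q - 1 \<and> q dvd j then 1 else 0 :: 'k) = (if j mod q = 0 then 1 else 0)"
      using room[of i j 0] by (auto simp: dvd_eq_mod_eq_0)
  qed
  also have "\<dots> = (\<Sum>i<length ds. of_nat (ds ! i div q))"
  proof (rule sum.cong[OF refl])
    fix i assume i: "i \<in> {..<length ds}"
    have "(\<Sum>j<ds ! i. if j mod q = 0 then 1 else 0 :: 'k) = of_nat (card {j. j < ds ! i \<and> j mod q = 0})"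
      by (simp add: sum.If_cases Int_def)
    then show "(\<Sum>j<ds ! i. if j mod q = 0 then 1 else 0 :: 'k) = of_nat (ds ! i div q)"
      using card_residue_class[of 0 q "ds ! i"] q0 dvd' i by auto
  qed
  also have "\<dots> = of_nat (\<Sum>d\<leftarrow>ds. d div q)"
    by (simp add: sum_list_sum_nth atLeast0LessThan)
  also have "(\<Sum>d\<leftarrow>ds. d div q) = sum_list ds div q"
    using dvd
  proof (induction ds)
    case (Cons d ds)
    then have "q dvd d" by simp
    with Cons show ?case by (simp add: div_plus_div_distrib_dvd_left)
  qed simp
  finally show "sqtrace (lmat F * J ^ (q - 1)) = of_nat (sum_list ds div q)" .
qed

text \<open>P is the projection onto the basis vectors of block r at positions divisible by q. J^q
  preserves their span and that of the remaining ones, and the rank of P is d_r / q.\<close>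

lemma commutator_J_trace_ne0:
  assumes r: "r < length ds" "q dvd ds ! r" "odd (ds ! r div q)"
  obtains P :: "('k, 'n) sqmat" where "commutator (J ^ q) P = 0" "sqtrace P \<noteq> 0"
proof
  have q0: "0 < q" using r by (cases q) auto
  define F :: "nat \<times> nat \<Rightarrow> nat \<times> nat \<Rightarrow> 'k" where
    "F x y = (if x = y \<and> fst x = r \<and> snd x mod q = 0 then 1 else 0)" for x y
  have "J ^ q * lmat F = lmat F * J ^ q"
    unfolding J_pow_times times_J_pow by (rule lmat_eqI) (auto simp: F_def le_mod_geq)
  then show "commutator (J ^ q) (lmat F) = 0" by (simp add: commutator_def)
  have "sqtrace (lmat F) = (\<Sum>i<length ds. if i = r then (\<Sum>j<ds ! i. if j mod q = 0 then 1 else 0) else 0)"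
    unfolding sqtrace_lmat by (intro sum.cong) (auto simp: F_def)
  also have "\<dots> = (\<Sum>j<ds ! r. if j mod q = 0 then 1 else 0)"
    using r by simp
  also have "\<dots> = of_nat (card {j. j < ds ! r \<and> j mod q = 0})"
    by (simp add: sum.If_cases Int_def)
  also have "\<dots> = of_nat (ds ! r div q)"
    using card_residue_class[of 0 q "ds ! r"] q0 r by simp
  finally show "sqtrace (lmat F) \<noteq> 0"
    using r(3) char2 by (simp add: of_nat_eq_0_iff_char_dvd)
qed

text \<open>W sends position j + p of block r to position j, for all j in the residue class given by
  \<open>cob_digit_iff_residue\<close>. Since every such j leaves room for j + p, W commutes with
  J^(2p) also at the ends of the block, and tr(J^p W) is the odd size of the class. Trace 0 is
  recorded so that W also represents a vector of the quotient for even n.\<close>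

lemma cob_digit_witness:
  assumes r: "r < length ds" "cob_digit p (ds ! r)" and p: "0 < p"
  obtains W :: "('k, 'n) sqmat"
  where "commutator (J ^ (2 * p)) W = 0" "sqtrace W = 0" "sqtrace (J ^ p * W) \<noteq> 0"
proof -
  define m where "m = ds ! r"
  obtain j0 where j0: "j0 < p" "\<And>j. j < m \<Longrightarrow> j mod (2 * p) = j0 \<Longrightarrow> j + p < m"
    "odd (card {j. j < m \<and> j mod (2 * p) = j0})"
    using r(2) cob_digit_iff_residue[OF p] by (auto simp: m_def)
  define F :: "nat \<times> nat \<Rightarrow> nat \<times> nat \<Rightarrow> 'k" where
    "F x y = (if fst x = r \<and> fst y = r \<and> snd y = snd x + p \<and> snd x mod (2 * p) = j0 then 1 else 0)" for x y
  have "J ^ (2 * p) * lmat F = lmat F * J ^ (2 * p)"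
    unfolding J_pow_times times_J_pow
  proof (rule lmat_eqI)
    fix i j i' j' assume *: "i < length ds" "j < ds ! i" "i' < length ds" "j' < ds ! i'"
    \<comment> \<open>At the lower end j' >= 0 gives j >= p, and j0 < p excludes the positions from
      p to 2p - 1.\<close>
    have 1: "2 * p \<le> j" if "j' + 2 * p = j + p" "j mod (2 * p) = j0"
    proof (rule ccontr)
      assume "\<not> 2 * p \<le> j"
      then show False using that j0(1) by simp
    qed
    have 2: "(j - 2 * p) mod (2 * p) = j mod (2 * p)" if "2 * p \<le> j"
      using that by (simp add: le_mod_geq)
    define c where "c \<longleftrightarrow> i = r \<and> i' = r \<and> j' + 2 * p = j + p \<and> j mod (2 * p) = j0"
    have "(if 2 * p \<le> j then F (i, j - 2 * p) (i', j') else 0) = (if c then 1 else 0)"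
    proof (cases "2 * p \<le> j")
      case True
      then have "j' = j - 2 * p + p \<longleftrightarrow> j' + 2 * p = j + p" by linarith
      then show ?thesis using True 2 by (simp add: F_def c_def)
    next
      case False
      then have "\<not> c" using 1 unfolding c_def by blast
      then show ?thesis using False by simp
    qed
    moreover have "(if j' + 2 * p < ds ! i' then F (i, j) (i', j' + 2 * p) else 0) = (if c then 1 else 0)"
      using j0(2)[of j] * by (auto simp: F_def c_def m_def)
    ultimately show "(if 2 * p \<le> snd (i, j) then F (fst (i, j), snd (i, j) - 2 * p) (i', j') else 0)
      = (if snd (i', j') + 2 * p < ds ! fst (i', j') then F (i, j) (fst (i', j'), snd (i', j') + 2 * p) else 0)"
      by (simp only: fst_conv snd_conv)
  qed
  then have "commutator (J ^ (2 * p)) (lmat F) = 0" by (simp add: commutator_def)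
  moreover have "sqtrace (lmat F) = 0"
    unfolding sqtrace_lmat using p by (intro sum.neutral ballI) (simp add: F_def)
  moreover have "sqtrace (J ^ p * lmat F) \<noteq> 0"
  proof -
    have "sqtrace (J ^ p * lmat F)
        = (\<Sum>i<length ds. if i = r then (\<Sum>j<ds ! i. if p \<le> j \<and> (j - p) mod (2 * p) = j0 then 1 else 0) else 0)"
      unfolding J_pow_times sqtrace_lmat
    proof (rule sum.cong[OF refl])
      fix i
      show "(\<Sum>j<ds ! i. if p \<le> snd (i, j) then F (fst (i, j), snd (i, j) - p) (i, j) else 0)
          = (if i = r then (\<Sum>j<ds ! i. if p \<le> j \<and> (j - p) mod (2 * p) = j0 then 1 else 0) else 0)"
        by (cases "i = r") (auto simp: F_def intro!: sum.cong sum.neutral)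
    qed
    also have "\<dots> = (\<Sum>j<m. if p \<le> j \<and> (j - p) mod (2 * p) = j0 then 1 else 0)"
      using r(1) by (simp add: m_def)
    also have "\<dots> = of_nat (card {j. j < m \<and> p \<le> j \<and> (j - p) mod (2 * p) = j0})"
      by (simp add: sum.If_cases Int_def)
    also have "card {j. j < m \<and> p \<le> j \<and> (j - p) mod (2 * p) = j0} = card {j. j < m \<and> j mod (2 * p) = j0}"
      by (rule bij_betw_same_card[of "\<lambda>j. j - p"], rule bij_betwI[of _ _ _ "\<lambda>j. j + p"])
         (use j0(2) in auto)
    finally show ?thesis using j0(3) char2 by (simp add: of_nat_eq_0_iff_char_dvd)
  qed
  ultimately show ?thesis by (rule that)
qed

text \<open>Only diagonal blocks enter the trace. Comparing entries of J^(2p) A and A J^(2p) inside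
  one of them gives periodicity, and where the shift leaves the block on one side, the vanishing
  required by \<open>sum_periodic_eq_0\<close>.\<close>

lemma no_cob_digit_trace:
  assumes p: "0 < p" and cob: "\<And>d. d \<in> set ds \<Longrightarrow> \<not> cob_digit p d"
    and A: "commutator (J ^ (2 * p)) (A :: ('k, 'n) sqmat) = 0"
  shows "sqtrace (J ^ p * A) = 0"
proof -
  obtain F where F: "A = lmat F" using ex_lmat by blast
  have eq: "lmat (\<lambda>x y. if 2 * p \<le> snd x then F (fst x, snd x - 2 * p) y else 0)
      = lmat (\<lambda>x y. if snd y + 2 * p < ds ! fst y then F x (fst y, snd y + 2 * p) else 0)"
    using A by (simp add: commutator_def F J_pow_times times_J_pow)
  have comm: "(if 2 * p \<le> j then F (i, j - 2 * p) (i, j') else 0)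
      = (if j' + 2 * p < ds ! i then F (i, j) (i, j' + 2 * p) else 0)"
    if "i < length ds" "j < ds ! i" "j' < ds ! i" for i j j'
    using lmat_eqD[OF eq, of "(i, j)" "(i, j')"] that unfolding fst_conv snd_conv
    by (simp add: block_index_def)
  have "(\<Sum>j<ds ! i. if p \<le> j then F (i, j - p) (i, j) else 0) = 0" if i: "i < length ds" for i
  proof -
    have "(\<Sum>j<ds ! i. if p \<le> j then F (i, j - p) (i, j) else 0)
        = (\<Sum>j\<in>{p..<ds ! i}. F (i, j - p) (i, j))"
      by (simp add: sum.If_cases) (rule sum.cong, auto)
    also have "\<dots> = (\<Sum>j<ds ! i - p. F (i, j) (i, j + p))"
      by (rule sum.reindex_bij_witness[of _ "\<lambda>j. j + p" "\<lambda>j. j - p"]) auto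
    also have "\<dots> = 0"
    proof (rule sum_periodic_eq_0[OF char2 p])
      show "F (i, j + 2 * p) (i, j + 2 * p + p) = F (i, j) (i, j + p)" if "j + 3 * p < ds ! i" for j
        using comm[OF i, of "j + 2 * p" "j + p"] that by (simp add: algebra_simps)
      show "F (i, j) (i, j + p) = 0" if "p \<le> j" "j < 2 * p" "j + p < ds ! i" for j
        using comm[OF i, of j "j - p"] that by (simp add: mult_2)
      show "F (i, j) (i, j + p) = 0" if "j + 2 * p < ds ! i" "ds ! i \<le> j + 3 * p" for j
        using comm[OF i, of "j + 2 * p" "j + p"] that p by simp
    qed (use cob i in auto)
    finally show ?thesis .
  qed
  then show ?thesis
    unfolding F J_pow_times sqtrace_lmat fst_conv snd_conv by simp
qed

end

section \<open>Block multiplicities from dimensions\<close>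

text \<open>The function d -> min(e, d) is linear except for a kink at d = e, which its second
  difference detects.\<close>

lemma mult_eq_second_difference:
  assumes "1 \<le> d"
  shows "int (mult s d) = 2 * int (\<Sum>e\<leftarrow>s. min e d) - int (\<Sum>e\<leftarrow>s. min e (d - 1)) - int (\<Sum>e\<leftarrow>s. min e (d + 1))"
proof (induction s)
  case (Cons e s)
  then show ?case using assms by (auto simp: mult_def min_def)
qed (simp add: mult_def)

text \<open>The quotient U/L is never formed: kernels of X^j on it are represented by their
  preimages in U, at the price of an extra dim L in every dimension.\<close>

locale subquotient_operator = finite_dimensional_vector_space scale Basis
  for scale :: "'k::field \<Rightarrow> 'w::ab_group_add \<Rightarrow> 'w" and Basis +
  fixes X :: "'w \<Rightarrow> 'w" and U L :: "'w set"
  assumes X_add: "X (a + b) = X a + X b" and X_scale: "X (scale c a) = scale c (X a)"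
    and subspace_U: "subspace U" and subspace_L: "subspace L" and L_le_U: "L \<subseteq> U"
    and X_U: "a \<in> U \<Longrightarrow> X a \<in> U" and X_L: "a \<in> L \<Longrightarrow> X a \<in> L"
begin

lemma X_pow_add: "(X ^^ j) (a + b) = (X ^^ j) a + (X ^^ j) b"
  by (induction j) (simp_all add: X_add)

lemma X_pow_scale: "(X ^^ j) (scale c a) = scale c ((X ^^ j) a)"
  by (induction j) (simp_all add: X_scale)

lemma X_pow_zero: "(X ^^ j) 0 = 0"
  using X_pow_scale[of j 0 0] by simp

lemma X_pow_diff: "(X ^^ j) (a - b) = (X ^^ j) a - (X ^^ j) b"
  using X_pow_add[of j "a - b" b] by (simp add: algebra_simps)

lemma X_pow_sum: "(X ^^ j) (sum f S) = (\<Sum>x\<in>S. (X ^^ j) (f x))"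
  by (induction S rule: infinite_finite_induct) (simp_all add: X_pow_add X_pow_zero)

lemma X_pow_L: "a \<in> L \<Longrightarrow> (X ^^ j) a \<in> L"
  by (induction j) (simp_all add: X_L)

lemma X_pow_U: "a \<in> U \<Longrightarrow> (X ^^ j) a \<in> U"
  by (induction j) (simp_all add: X_U)

lemma subspace_preimage: "subspace {v \<in> U. (X ^^ j) v \<in> L}"
  using subspace_U subspace_L
  by (auto simp: subspace_def X_pow_zero X_pow_add X_pow_scale)

end

locale subquotient_blocks = subquotient_operator +
  fixes s :: "nat list" and w :: "nat \<Rightarrow> 'b"
  assumes w: "\<And>i. i < length s \<Longrightarrow> 1 \<le> s ! i \<and> w i \<in> U \<and> (X ^^ (s ! i)) (w i) \<in> L"
    and indep: "\<And>c p. (\<Sum>(i, j)\<in>block_index s. scale (c (i, j)) ((X ^^ j) (w i))) \<in> L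
        \<Longrightarrow> p \<in> block_index s \<Longrightarrow> c p = 0"
    and spans: "\<And>x. x \<in> U \<Longrightarrow> \<exists>c. x - (\<Sum>(i, j)\<in>block_index s. scale (c (i, j)) ((X ^^ j) (w i))) \<in> L"
begin

definition bv :: "nat \<times> nat \<Rightarrow> 'b" where
  "bv p = (X ^^ snd p) (w (fst p))"

definition comb :: "(nat \<times> nat \<Rightarrow> 'a) \<Rightarrow> 'b" where
  "comb c = (\<Sum>p\<in>block_index s. scale (c p) (bv p))"

lemma comb_eq: "(\<Sum>(i, j)\<in>block_index s. scale (c (i, j)) ((X ^^ j) (w i))) = comb c"
  by (simp add: comb_def bv_def case_prod_unfold)

lemma comb_indep: "comb c \<in> L \<Longrightarrow> p \<in> block_index s \<Longrightarrow> c p = 0"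
  using indep[of c p] by (simp add: comb_eq)

lemma comb_spans: "x \<in> U \<Longrightarrow> \<exists>c. x - comb c \<in> L"
  using spans[of x] by (simp add: comb_eq)

lemma comb_diff: "comb c - comb d = comb (\<lambda>p. c p - d p)"
  by (simp add: comb_def scale_left_diff_distrib sum_subtractf)

lemma bv_eq_comb: "p \<in> block_index s \<Longrightarrow> bv p = comb (\<lambda>q. if q = p then 1 else 0)"
  by (simp add: comb_def if_distrib[of "\<lambda>c. scale c _"] cong: if_cong)

lemma bv_U: "p \<in> block_index s \<Longrightarrow> bv p \<in> U"
  using w by (auto simp: bv_def block_index_def X_pow_U)

lemma X_pow_bv: "(X ^^ m) (bv (i, j)) = bv (i, j + m)"
  by (simp add: bv_def add.commute flip: funpow_add[THEN fun_cong, unfolded o_apply])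

lemma bv_L: "i < length s \<Longrightarrow> s ! i \<le> j \<Longrightarrow> bv (i, j) \<in> L"
  using X_pow_L[of "bv (i, s ! i)" "j - s ! i"] w[of i] unfolding X_pow_bv by (simp add: bv_def)

text \<open>Modulo L, X^m shifts coefficients along each block; the terms pushed past the end of a
  block lie in L by \<open>bv_L\<close>.\<close>

lemma X_pow_comb: "(X ^^ m) (comb c) - comb (\<lambda>(i, j). if m \<le> j then c (i, j - m) else 0) \<in> L"
proof -
  define A where "A = {(i, j). i < length s \<and> j + m < s ! i}"
  have A: "A \<subseteq> block_index s" by (auto simp: A_def block_index_def)
  have "(X ^^ m) (comb c) = (\<Sum>(i, j)\<in>block_index s. scale (c (i, j)) (bv (i, j + m)))"
    by (simp add: comb_def X_pow_sum X_pow_scale case_prod_unfold flip: X_pow_bv)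
  also have "\<dots> = (\<Sum>(i, j)\<in>block_index s - A. scale (c (i, j)) (bv (i, j + m))) + (\<Sum>(i, j)\<in>A. scale (c (i, j)) (bv (i, j + m)))"
    by (rule sum.subset_diff[OF A]) simp
  also have "(\<Sum>(i, j)\<in>A. scale (c (i, j)) (bv (i, j + m)))
      = (\<Sum>(i, j)\<in>{(i, j)\<in>block_index s. m \<le> j}. scale (c (i, j - m)) (bv (i, j)))"
    by (rule sum.reindex_bij_witness[of _ "\<lambda>(i, j). (i, j - m)" "\<lambda>(i, j). (i, j + m)"])
       (auto simp: A_def block_index_def)
  also have "\<dots> = comb (\<lambda>(i, j). if m \<le> j then c (i, j - m) else 0)"
    unfolding comb_def by (rule sum.mono_neutral_cong_left) (auto split: if_splits)
  finally have "(X ^^ m) (comb c) - comb (\<lambda>(i, j). if m \<le> j then c (i, j - m) else 0)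
      = (\<Sum>(i, j)\<in>block_index s - A. scale (c (i, j)) (bv (i, j + m)))" by simp
  also have "\<dots> \<in> L"
    using subspace_L by (intro subspace_sum) (auto simp: A_def block_index_def intro!: subspace_scale bv_L)
  finally show ?thesis .
qed

lemma span_L_bv:
  assumes "F \<subseteq> block_index s" "x \<in> span (L \<union> bv ` F)"
  shows "\<exists>c. x - (\<Sum>p\<in>F. scale (c p) (bv p)) \<in> L"
proof -
  have "finite F" using finite_subset[OF assms(1)] by simp
  define T where "T = {x. \<exists>c. x - (\<Sum>p\<in>F. scale (c p) (bv p)) \<in> L}"
  have "L \<union> bv ` F \<subseteq> T"
  proof
    fix x assume "x \<in> L \<union> bv ` F"
    then show "x \<in> T"
    proof
      assume "x \<in> L"
      then show ?thesis by (auto simp: T_def intro!: exI[of _ "\<lambda>_. 0"])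
    next
      assume "x \<in> bv ` F"
      then obtain p where "p \<in> F" "x = bv p" by blast
      then have "x - (\<Sum>q\<in>F. scale (if q = p then 1 else 0) (bv q)) = 0"
        using \<open>finite F\<close> by (simp add: if_distrib[of "\<lambda>c. scale c _"] cong: if_cong)
      then have "x - (\<Sum>q\<in>F. scale (if q = p then 1 else 0) (bv q)) \<in> L"
        using subspace_0[OF subspace_L] by simp
      then show ?thesis unfolding T_def by (intro CollectI exI[of _ "\<lambda>q. if q = p then 1 else 0"])
    qed
  qed
  moreover have "subspace T"
    unfolding subspace_def
  proof (intro conjI ballI allI)
    show "0 \<in> T" using subspace_0[OF subspace_L] by (auto simp: T_def intro!: exI[of _ "\<lambda>_. 0"])
  next
    fix x y assume "x \<in> T" "y \<in> T"
    then obtain c d where "x - (\<Sum>p\<in>F. scale (c p) (bv p)) \<in> L" "y - (\<Sum>p\<in>F. scale (d p) (bv p)) \<in> L"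
      by (auto simp: T_def)
    from subspace_add[OF subspace_L this]
    have "x + y - (\<Sum>p\<in>F. scale (c p + d p) (bv p)) \<in> L"
      by (simp add: scale_left_distrib sum.distrib algebra_simps)
    then show "x + y \<in> T" unfolding T_def by (auto intro!: exI[of _ "\<lambda>p. c p + d p"])
  next
    fix x a assume "x \<in> T"
    then obtain c where "x - (\<Sum>p\<in>F. scale (c p) (bv p)) \<in> L" by (auto simp: T_def)
    from subspace_scale[OF subspace_L this, of a]
    have "scale a x - (\<Sum>p\<in>F. scale (a * c p) (bv p)) \<in> L"
      by (simp add: scale_right_diff_distrib scale_sum_right)
    then show "scale a x \<in> T" unfolding T_def by (auto intro!: exI[of _ "\<lambda>p. a * c p"])
  qed
  ultimately have "span (L \<union> bv ` F) \<subseteq> T" by (rule span_minimal)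
  then show ?thesis using assms(2) by (auto simp: T_def)
qed

lemma dim_L_bv:
  assumes "F \<subseteq> block_index s"
  shows "dim (L \<union> bv ` F) = dim L + card F"
proof -
  have "finite F" using finite_subset[OF assms] by simp
  then show ?thesis using assms
  proof (induction F)
    case (insert p F)
    have "bv p \<notin> span (L \<union> bv ` F)"
    proof
      assume "bv p \<in> span (L \<union> bv ` F)"
      then obtain c where c: "bv p - (\<Sum>q\<in>F. scale (c q) (bv q)) \<in> L"
        using span_L_bv[of F] insert.prems by auto
      have "(\<Sum>q\<in>F. scale (c q) (bv q)) = comb (\<lambda>q. if q \<in> F then c q else 0)"
        unfolding comb_def using insert.prems by (intro sum.mono_neutral_cong_left) auto
      with c have "comb (\<lambda>q. (if q = p then 1 else 0) - (if q \<in> F then c q else 0)) \<in> L"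
        using bv_eq_comb[of p] insert.prems by (simp add: comb_diff)
      from comb_indep[OF this, of p] show False using insert by simp
    qed
    then show ?case using insert by (simp add: dim_insert)
  qed simp
qed

text \<open>On U/L the kernel of X^j is spanned by the last j vectors of each block, or by the whole
  block if it is shorter.\<close>

lemma preimage_eq_span:
  "{v \<in> U. (X ^^ j) v \<in> L} = span (L \<union> bv ` {(i, k) \<in> block_index s. s ! i \<le> k + j})" (is "?S = span (L \<union> bv ` ?I)")
proof
  have "L \<union> bv ` ?I \<subseteq> ?S"
    using L_le_U X_pow_L bv_U by (auto simp: X_pow_bv block_index_def intro!: bv_L)
  then show "span (L \<union> bv ` ?I) \<subseteq> ?S"
    using subspace_preimage by (rule span_minimal)
  show "?S \<subseteq> span (L \<union> bv ` ?I)"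
  proof
    fix v assume "v \<in> ?S"
    then have v: "v \<in> U" "(X ^^ j) v \<in> L" by auto
    obtain c where c: "v - comb c \<in> L" using comb_spans[OF v(1)] by blast
    define c' where "c' = (\<lambda>(i, k). if j \<le> k then c (i, k - j) else 0)"
    have "(X ^^ j) v - (X ^^ j) (v - comb c) - ((X ^^ j) (comb c) - comb c') \<in> L"
      using subspace_diff[OF subspace_L subspace_diff[OF subspace_L v(2) X_pow_L[OF c]] X_pow_comb[of j c]]
      by (simp only: c'_def)
    then have "comb c' \<in> L" by (simp add: X_pow_diff)
    have "c p = 0" if "p \<in> block_index s - ?I" for p
    proof -
      obtain i k where p: "p = (i, k)" by (cases p)
      with that have "(i, k + j) \<in> block_index s" by (auto simp: block_index_def)
      from comb_indep[OF \<open>comb c' \<in> L\<close> this] show ?thesis by (simp add: c'_def p)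
    qed
    then have "comb c = (\<Sum>p\<in>?I. scale (c p) (bv p))"
      unfolding comb_def by (intro sum.mono_neutral_right) auto
    also have "\<dots> \<in> span (L \<union> bv ` ?I)"
      by (intro span_sum span_scale span_base) auto
    finally have "(v - comb c) + comb c \<in> span (L \<union> bv ` ?I)"
      using c by (intro span_add) (auto intro: span_base)
    then show "v \<in> span (L \<union> bv ` ?I)" by simp
  qed
qed

lemma dim_preimage: "dim {v \<in> U. (X ^^ j) v \<in> L} = dim L + (\<Sum>e\<leftarrow>s. min e j)"
proof -
  let ?I = "{(i, k) \<in> block_index s. s ! i \<le> k + j}"
  have "?I = Sigma {..<length s} (\<lambda>i. {s ! i - j..<s ! i})"
    by (auto simp: block_index_def)
  then have "card ?I = (\<Sum>i<length s. s ! i - (s ! i - j))"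
    by simp
  also have "\<dots> = (\<Sum>i<length s. min (s ! i) j)"
    by (intro sum.cong) auto
  also have "\<dots> = (\<Sum>e\<leftarrow>s. min e j)"
    by (simp add: sum_list_sum_nth atLeast0LessThan)
  finally show ?thesis
    unfolding preimage_eq_span dim_span by (subst dim_L_bv) auto
qed

text \<open>The last vector of a block of length at most m would lie in ker X and hence be some X^m
  b, but X^m b has coefficient 0 at all positions below m.\<close>

lemma blocks_large:
  assumes "L = {0}" and surj: "\<And>b. b \<in> U \<Longrightarrow> X b = 0 \<Longrightarrow> \<exists>c\<in>U. (X ^^ m) c = b"
    and i: "i < length s"
  shows "m < s ! i"
proof (rule ccontr)
  assume "\<not> m < s ! i"
  define k where "k = s ! i - 1"
  have k: "Suc k = s ! i" "k < m" using w[OF i] \<open>\<not> m < s ! i\<close> by (auto simp: k_def)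
  have mem: "(i, k) \<in> block_index s" using i k by (auto simp: block_index_def)
  have "X (bv (i, k)) = bv (i, Suc k)" by (simp add: bv_def)
  also have "\<dots> = 0" using bv_L[of i "Suc k"] i k assms(1) by simp
  finally obtain b where b: "b \<in> U" "(X ^^ m) b = bv (i, k)"
    using surj[of "bv (i, k)"] bv_U[OF mem] by blast
  obtain c where "b = comb c" using comb_spans[OF b(1)] assms(1) by auto
  with X_pow_comb[of m c] b(2) bv_eq_comb[OF mem]
  have "comb (\<lambda>q. (if q = (i, k) then 1 else 0) - (case q of (i, j) \<Rightarrow> if m \<le> j then c (i, j - m) else 0)) \<in> L"
    by (simp add: comb_diff)
  from comb_indep[OF this mem] show False using k by simp
qed

end

lemma (in subquotient_operator) subquotient_blocks_ex:
  assumes "jordan_blocks scale X U L s"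
  shows "\<exists>w. subquotient_blocks scale Basis X U L s w"
proof -
  obtain w where w: "\<forall>i<length s. 1 \<le> s ! i \<and> w i \<in> U \<and> (X ^^ (s ! i)) (w i) \<in> L"
    "\<forall>c. (\<Sum>(i, j)\<in>block_index s. scale (c (i, j)) ((X ^^ j) (w i))) \<in> L \<longrightarrow> (\<forall>p\<in>block_index s. c p = 0)"
    "\<forall>x\<in>U. \<exists>c. x - (\<Sum>(i, j)\<in>block_index s. scale (c (i, j)) ((X ^^ j) (w i))) \<in> L"
    using assms unfolding jordan_blocks_def by (elim exE conjE) rule
  have "subquotient_blocks scale Basis X U L s w"
  proof
    show "1 \<le> s ! i \<and> w i \<in> U \<and> (X ^^ (s ! i)) (w i) \<in> L" if "i < length s" for i
      using w(1) that by simp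
    show "c p = 0" if "(\<Sum>(i, j)\<in>block_index s. scale (c (i, j)) ((X ^^ j) (w i))) \<in> L" "p \<in> block_index s" for c p
      using w(2)[rule_format, OF that] .
    show "\<exists>c. x - (\<Sum>(i, j)\<in>block_index s. scale (c (i, j)) ((X ^^ j) (w i))) \<in> L" if "x \<in> U" for x
      using w(3) that by (rule bspec)
  qed
  then show ?thesis by blast
qed

section \<open>The adjoint action of a unipotent matrix\<close>

lemma vsmult_eq: "vsmult = (*s)"
  by (intro ext) (simp add: vsmult_def vec_eq_iff)

lemma matrix_inv_inverse:
  "invertible A \<Longrightarrow> A ** matrix_inv A = mat 1 \<and> matrix_inv A ** A = mat 1"
  unfolding invertible_def matrix_inv_def by (rule someI_ex)

lemma matrix_vector_nth: "(A *v x) $ i = (\<Sum>j\<in>UNIV. A $ i $ j * x $ j)"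
  by (simp add: matrix_vector_mult_def)

lemma to_sqmat_simps:
  "to_sqmat (A ** B) = to_sqmat A * to_sqmat (B :: 'k::comm_ring_1 ^ 'n::finite ^ 'n)"
  "to_sqmat (A + B) = to_sqmat A + to_sqmat B"
  "to_sqmat (A - B) = to_sqmat A - to_sqmat B"
  "to_sqmat (mat 1 :: 'k ^ 'n ^ 'n) = 1"
  "to_sqmat (0 :: 'k ^ 'n ^ 'n) = 0"
  "sqtrace (to_sqmat A) = trace A"
  by (simp_all add: times_sqmat.abs_eq plus_sqmat.abs_eq minus_sqmat.abs_eq one_sqmat.abs_eq
      zero_sqmat.abs_eq sqtrace.abs_eq)

text \<open>The columns of P are the vectors of the Jordan basis, indexed through an arbitrary
  bijection between the index type and the labels.\<close>

lemma jordan_labelling_ex: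
  fixes u :: "'k::field ^ 'n::finite ^ 'n"
  assumes "jordan_blocks vsmult (\<lambda>v. (u - mat 1) *v v) UNIV {0} ds"
  obtains lab :: "'n \<Rightarrow> nat \<times> nat" and P Q :: "('k, 'n) sqmat"
  where "jordan_labelling ds lab" "P * Q = 1" "Q * P = 1"
    "to_sqmat (u - mat 1) * P = P * jordan_labelling.J lab" "sum_list ds = CARD('n)"
proof -
  interpret subquotient_operator "(*s)" "cart_basis :: ('k ^ 'n) set" "\<lambda>v. (u - mat 1) *v v" UNIV "{0}"
    by unfold_locales
       (auto simp: matrix_vector_right_distrib vec.subspace_0 vec.subspace_def vector_scalar_commute)
  obtain w where "subquotient_blocks (*s) cart_basis (\<lambda>v. (u - mat 1) *v v) UNIV {0} ds w"
    using subquotient_blocks_ex assms unfolding vsmult_eq by blast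
  then interpret subquotient_blocks "(*s)" "cart_basis :: ('k ^ 'n) set" "\<lambda>v. (u - mat 1) *v v" UNIV "{0}" ds w .
  have "UNIV = vec.span ({0} \<union> bv ` block_index ds)"
  proof -
    have "x \<in> vec.span ({0} \<union> bv ` block_index ds)" for x
    proof -
      obtain c where "x = comb c" using comb_spans[of x] by auto
      show ?thesis unfolding \<open>x = comb c\<close> comb_def
        by (intro vec.span_sum vec.span_scale vec.span_base) auto
    qed
    then show ?thesis by blast
  qed
  then have card: "card (block_index ds) = CARD('n)"
    using dim_L_bv[OF subset_refl] vec_dim_card[where 'a = 'k and 'n = 'n] vec.dim_span[of "{0} \<union> bv ` block_index ds"]
      vec.dim_insert[of 0 "{}"] vec.span_zero by simp
  have "block_index ds = Sigma {..<length ds} (\<lambda>i. {..<ds ! i})"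
    by (auto simp: block_index_def)
  then have sum: "sum_list ds = CARD('n)"
    using card by (simp add: sum_list_sum_nth atLeast0LessThan)
  obtain lab :: "'n \<Rightarrow> nat \<times> nat" where lab: "bij_betw lab UNIV (block_index ds)"
    using finite_same_card_bij[of "UNIV :: 'n set" "block_index ds"] card by auto
  then interpret lb: jordan_labelling ds lab by unfold_locales
  define P' :: "'k ^ 'n ^ 'n" where "P' = (\<chi> a b. bv (lab b) $ a)"
  have "x = 0" if "P' *v x = 0" for x
  proof -
    define c where "c p = x $ inv lab p" for p
    have "P' *v x = (\<Sum>b\<in>UNIV. x $ b *s bv (lab b))"
      by (simp add: vec_eq_iff matrix_vector_mult_def P'_def sum_component mult.commute)
    also have "\<dots> = (\<Sum>b\<in>UNIV. c (lab b) *s bv (lab b))"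
      using bij_betw_imp_inj_on[OF lab] by (simp add: c_def)
    also have "\<dots> = comb c"
      unfolding comb_def by (rule lb.sum_lab)
    finally have "comb c \<in> {0}" using that by simp
    then have "c (lab b) = 0" for b using comb_indep lb.lab_mem by blast
    then show ?thesis using bij_betw_imp_inj_on[OF lab] by (simp add: c_def vec_eq_iff)
  qed
  then have "\<exists>Q'. Q' ** P' = mat 1"
    unfolding matrix_left_invertible_ker by simp
  then obtain Q' where inv1: "Q' ** P' = mat 1" ..
  then have inv2: "P' ** Q' = mat 1" by (simp add: matrix_left_right_inverse)
  note inv = inv1 inv2
  define N where "N = to_sqmat (u - mat 1)"
  have "N * to_sqmat P' = to_sqmat P' * lb.J"
  proof (rule sqmat_eqI)
    fix a b
    have P'_nth: "P' $ a $ c = bv (lab c) $ a" for a c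
      by (simp add: P'_def)
    obtain i j where ij: "lab b = (i, j)" by (cases "lab b")
    have b: "i < length ds" "j < ds ! i" using lb.lab_block[of b] ij by auto
    have "entry (N * to_sqmat P') a b = ((u - mat 1) *v bv (i, j)) $ a"
      by (simp add: entry_times P'_nth N_def entry.abs_eq matrix_vector_nth ij)
    also have "(u - mat 1) *v bv (i, j) = bv (i, Suc j)" by (simp add: bv_def)
    finally have 1: "entry (N * to_sqmat P') a b = bv (i, Suc j) $ a" .
    have "entry (to_sqmat P' * lb.J) a b = (\<Sum>c\<in>UNIV. bv (lab c) $ a * (if lab c = (i, Suc j) then 1 else 0))"
      by (simp add: entry_times P'_nth entry.abs_eq lb.J_def lb.lmat_def ij)
    also have "\<dots> = (\<Sum>p\<in>block_index ds. bv p $ a * (if p = (i, Suc j) then 1 else 0))"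
      by (rule lb.sum_lab)
    also have "\<dots> = (\<Sum>p\<in>block_index ds. if p = (i, Suc j) then bv p $ a else 0)"
      by (rule sum.cong) auto
    also have "\<dots> = bv (i, Suc j) $ a"
    proof (cases "Suc j < ds ! i")
      case True
      then have "(i, Suc j) \<in> block_index ds" using b by (simp add: block_index_def)
      then show ?thesis by simp
    next
      case False
      then have "bv (i, Suc j) = 0" using bv_L[of i "Suc j"] b by simp
      then show ?thesis by simp
    qed
    finally show "entry (N * to_sqmat P') a b = entry (to_sqmat P' * lb.J) a b" using 1 by simp
  qed
  then show ?thesis
    using that[of lab "to_sqmat P'" "to_sqmat Q'"] inv sum lb.jordan_labelling_axioms
    by (simp add: N_def to_sqmat_simps(1,4)[symmetric])
qed

section \<open>Transfer from the Jordan matrix J to N = u - 1\<close>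

locale char2_unipotent = char2_jordan ds lab "TYPE('k)"
  for ds and lab :: "'n::finite \<Rightarrow> nat \<times> nat" and u :: "'k::field ^ 'n ^ 'n" +
  fixes P Q :: "('k, 'n) sqmat"
  assumes inv: "invertible u" and ds_pos: "d \<in> set ds \<Longrightarrow> 0 < d" and sum_ds: "sum_list ds = CARD('n)"
    and PQ: "P * Q = 1" "Q * P = 1" and N_P: "to_sqmat (u - mat 1) * P = P * J"
begin

definition N :: "('k, 'n) sqmat" where "N = to_sqmat (u - mat 1)"
definition U :: "('k, 'n) sqmat" where "U = to_sqmat u"
definition V :: "('k, 'n) sqmat" where "V = to_sqmat (matrix_inv u)"

sublocale unipotent_trace "sqtrace :: ('k, 'n) sqmat \<Rightarrow> 'k" N U V
proof -
  show "unipotent_trace (sqtrace :: ('k, 'n) sqmat \<Rightarrow> 'k) N U V"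
    by unfold_locales
       (simp_all add: N_def U_def V_def to_sqmat_simps[symmetric] matrix_inv_inverse[OF inv])
qed

definition conjg :: "('k, 'n) sqmat \<Rightarrow> ('k, 'n) sqmat" where "conjg A = P * A * Q"

lemma conjg_mult: "conjg A * conjg B = conjg (A * B)"
proof -
  have "conjg A * conjg B = P * A * (Q * P) * B * Q" by (simp only: conjg_def mult.assoc)
  then show ?thesis by (simp add: PQ conjg_def mult.assoc)
qed

lemma conjg_one: "conjg 1 = 1" by (simp add: conjg_def PQ)
lemma conjg_zero: "conjg 0 = 0" by (simp add: conjg_def)
lemma conjg_pow: "conjg A ^ k = conjg (A ^ k)"
  by (induction k) (simp_all add: conjg_one conjg_mult)

lemma conjg_J: "N = conjg J"
proof -
  have "N = N * P * Q" using PQ(1) by (simp add: mult.assoc)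
  then show ?thesis by (simp add: N_P[folded N_def] conjg_def)
qed

lemma conjg_surj: "\<exists>B. A = conjg B"
proof
  have "A = (P * Q) * A * (P * Q)" by (simp add: PQ)
  then show "A = conjg (Q * A * P)" by (simp only: conjg_def mult.assoc)
qed

lemma conjg_eq_iff: "conjg A = conjg B \<longleftrightarrow> A = B"
proof
  assume "conjg A = conjg B"
  then have "Q * (P * A * Q) * P = Q * (P * B * Q) * P" by (simp add: conjg_def)
  then have "(Q * P) * A * (Q * P) = (Q * P) * B * (Q * P)" by (simp only: mult.assoc)
  then show "A = B" by (simp add: PQ)
qed simp

lemma commutator_conjg: "commutator (conjg A) (conjg B) = conjg (commutator A B)"
proof -
  have "conjg (x - y) = conjg x - conjg y" for x y by (simp add: conjg_def algebra_simps)
  then show ?thesis by (simp add: commutator_def conjg_mult)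
qed

lemma ad_pow_conjg: "ad_pow (conjg A) k (conjg B) = conjg (ad_pow A k B)"
  by (induction k) (simp_all add: commutator_conjg)

lemma sqtrace_conjg: "sqtrace (conjg A) = sqtrace A"
  unfolding conjg_def using tr_rotate[of P A Q] by (simp add: PQ)

lemma N_nilpotent: "N ^ CARD('n) = 0"
  using J_nilpotent[where 'k = 'k] by (simp add: conjg_J conjg_pow conjg_zero flip: sum_ds)

text \<open>The conjugated matrix of \<open>ad_pow_J_root_of_one\<close> is multiplied by U^(q-1) so
  that X^(q-1) sends it to 1. Since its traces against lower powers of N vanish, only N^(q-1) counts
  in the expansion of U^(q-1).\<close>

lemma root_of_one:
  assumes q: "q = 2 ^ e" and dvd: "\<And>d. d \<in> set ds \<Longrightarrow> q dvd d"
  obtains A where "ad_pow N (q - 1) A = U ^ (q - 1)" "sqtrace A = of_nat (CARD('n) div q)"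
proof -
  obtain A :: "('k, 'n) sqmat" where A: "ad_pow J (q - 1) A = 1"
    "\<And>t. t < q - 1 \<Longrightarrow> sqtrace (A * J ^ t) = 0"
    "sqtrace (A * J ^ (q - 1)) = of_nat (sum_list ds div q)"
    using ad_pow_J_root_of_one[OF assms] by metis
  have tr: "sqtrace (conjg A * N ^ t) = sqtrace (A * J ^ t)" for t
    by (simp add: conjg_J conjg_pow conjg_mult sqtrace_conjg)
  have "ad_pow N (q - 1) (conjg A * U ^ (q - 1)) = U ^ (q - 1)"
    using A(1) ad_pow_conjg[where A = J and k = "q - 1" and B = A] by (simp add: ad_v conjg_one flip: conjg_J)
  moreover have "sqtrace (conjg A * U ^ (q - 1)) = of_nat (CARD('n) div q)"
    using tr_mult_u_pow[of "q - 1" "conjg A"] A(2,3) by (simp add: tr sum_ds)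
  ultimately show ?thesis by (rule that)
qed

lemma kernel_trace_ne0:
  assumes q: "q = 2 ^ e" and r: "r < length ds" "q dvd ds ! r" "odd (ds ! r div q)"
  obtains B where "ad_pow N q B = 0" "sqtrace B \<noteq> 0"
proof -
  obtain B :: "('k, 'n) sqmat" where "commutator (J ^ q) B = 0" "sqtrace B \<noteq> 0"
    using commutator_J_trace_ne0[OF r] by metis
  then have "ad_pow N q (conjg B) = 0" "sqtrace (conjg B) \<noteq> 0"
    by (simp_all add: q ad_pow_two_power conjg_J conjg_pow commutator_conjg conjg_zero sqtrace_conjg)
  then show ?thesis by (rule that)
qed

lemma two_power_odd_decomp:
  assumes "0 < (d::nat)"
  obtains e c where "d = 2 ^ e * (2 * c + 1)"
proof -
  obtain k where "d = 2 ^ multiplicity 2 d * k" "\<not> 2 dvd k"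
    using multiplicity_decompose'[of d 2] assms by auto
  then show ?thesis using that by (metis oddE)
qed

text \<open>The second summand of \<open>tr_ad_pow_even\<close> vanishes by
  \<open>sqtrace_graded\<close>, applied after conjugation to J^(2p) with the grading of
  \<open>J_pow_degree\<close>.\<close>

lemma quad_even_value:
  assumes d: "d = 2 ^ Suc b * (2 * c + 1)" and A: "ad_pow N d A = 0"
  shows "quad d A = (sqtrace (N ^ 2 ^ b * ad_pow N (2 ^ Suc b * c) (A * V ^ (2 ^ b * (2 * c + 1)))))\<^sup>2"
proof -
  define m p A' where "m = 2 ^ b * (2 * c + 1)" and "p = (2::nat) ^ b" and "A' = A * V ^ m"
  have m: "d = 2 * m" "0 < m" and dp: "d = 2 * p * (2 * c + 1)" by (simp_all add: d m_def p_def)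
  have A': "ad_pow N d A' = 0" by (simp add: A'_def ad_v A)
  obtain B where B: "A' = conjg B" using conjg_surj by blast
  define y where "y = (J :: ('k, 'n) sqmat) ^ (2 * p)"
  have "ad_pow (N ^ (2 * p)) (2 * c + 1) A' = ad_pow N d A'"
    using ad_pow_two_power_mult[where N = N and e = "Suc b" and k = "2 * c + 1" and A = A'] by (simp add: dp p_def)
  then have "ad_pow y (2 * c + 1) B = 0"
    unfolding A' using conjg_eq_iff[of _ 0] by (simp only: B conjg_J conjg_pow ad_pow_conjg y_def conjg_zero)
  moreover have "int (snd (lab i) div (2 * p)) = int (snd (lab j) div (2 * p)) + 1" if "entry y i j \<noteq> 0" for i j
    using J_pow_degree[of "2 * p" i j] that by (simp add: y_def p_def)
  ultimately have "sqtrace (y * ad_pow y (2 * c) B * B) = 0"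
    using sqtrace_graded[OF char2, where y = y and deg = "\<lambda>a. int (snd (lab a) div (2 * p))"] by blast
  then have "sqtrace (N ^ (2 * p) * ad_pow (N ^ (2 * p)) (2 * c) A' * A') = 0"
    by (simp only: B conjg_J conjg_pow ad_pow_conjg conjg_mult sqtrace_conjg y_def)
  then have "sqtrace (N * ad_pow N (d - 1) A' * A') = (sqtrace (N ^ p * ad_pow N (2 * p * c) A'))\<^sup>2"
    using tr_ad_pow_even[OF dp p_def A'] by simp
  then have "quad d A = (sqtrace (N ^ p * ad_pow N (2 * p * c) A'))\<^sup>2"
    using quad_even[OF m(2), of A] A by (simp add: m(1)[symmetric] A'_def[symmetric])
  then show ?thesis by (simp only: A'_def m_def p_def power_Suc)
qed

lemma quad_eq_0:
  assumes d: "2 \<le> d" and A: "ad_pow N d A = 0"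
    and no: "\<And>b r. d = 2 ^ Suc b \<Longrightarrow> r < length ds \<Longrightarrow> \<not> cob_digit (2 ^ b) (ds ! r)"
  shows "quad d A = 0"
proof -
  obtain e c where e: "d = 2 ^ e * (2 * c + 1)" using two_power_odd_decomp[of d] d by auto
  show ?thesis
  proof (cases e)
    case 0
    \<comment> \<open>For odd d the value is the square of the trace of a c-fold commutator, and d
      >= 2 provides c > 0.\<close>
    then have dc: "d = 2 * c + 1" "0 < c" using e d by auto
    have "quad d A = (sqtrace (ad_pow N c (A * V ^ c)))\<^sup>2"
      using quad_odd[of c A] A by (simp add: dc ad_v)
    then show ?thesis using tr_ad_pow[OF dc(2)] by simp
  next
    case (Suc b)
    define A' where "A' = A * V ^ (2 ^ b * (2 * c + 1))"
    have q: "quad d A = (sqtrace (N ^ 2 ^ b * ad_pow N (2 ^ Suc b * c) A'))\<^sup>2"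
      unfolding A'_def using quad_even_value[of d b c A] e A Suc by simp
    show ?thesis
    proof (cases "c = 0")
      case False
      have "N ^ 2 ^ b * ad_pow N (2 ^ Suc b * c) A' = ad_pow N (2 ^ Suc b * c) (N ^ 2 ^ b * A')"
        by (rule ad_pow_mult_left[symmetric]) (rule commute_self_power)
      then show ?thesis using q False tr_ad_pow[of "2 ^ Suc b * c"] by simp
    next
      case True
      then have d2: "d = 2 ^ Suc b" using e Suc by simp
      obtain B where B: "A' = conjg B" using conjg_surj by blast
      have "ad_pow N (2 ^ Suc b) A' = 0"
        using A unfolding d2 A'_def ad_v by simp
      then have "commutator (N ^ (2 * 2 ^ b)) A' = 0"
        unfolding ad_pow_two_power by simp
      then have "commutator (J ^ (2 * 2 ^ b)) B = 0"
        using conjg_eq_iff[of _ 0] by (simp only: B conjg_J conjg_pow commutator_conjg conjg_zero)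
      then have "sqtrace (J ^ 2 ^ b * B) = 0"
        using no[OF d2] by (intro no_cob_digit_trace) (auto simp: in_set_conv_nth)
      then show ?thesis
        using q True by (simp add: B conjg_J conjg_pow conjg_mult sqtrace_conjg)
    qed
  qed
qed

lemma quad_witness:
  assumes r: "r < length ds" "cob_digit (2 ^ b) (ds ! r)"
  obtains W where "ad_pow N (2 ^ Suc b) W = 0" "sqtrace W = 0" "quad (2 ^ Suc b) W \<noteq> 0"
proof -
  obtain W :: "('k, 'n) sqmat" where W: "commutator (J ^ (2 * 2 ^ b)) W = 0" "sqtrace W = 0"
    "sqtrace (J ^ 2 ^ b * W) \<noteq> 0"
    using cob_digit_witness[OF r] by auto
  have c: "commutator (N ^ (2 * 2 ^ b)) (conjg W) = 0"
    using W(1) by (simp add: conjg_J conjg_pow commutator_conjg conjg_zero)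
  then have ad: "ad_pow N (2 ^ Suc b) (conjg W) = 0"
    using ad_pow_two_power[where N = N and e = "Suc b"] by simp
  have "quad (2 ^ Suc b) (conjg W) = (sqtrace (N ^ 2 ^ b * (conjg W * V ^ 2 ^ b)))\<^sup>2"
    using quad_even_value[of "2 ^ Suc b" b 0 "conjg W"] ad by simp
  also have "sqtrace (N ^ 2 ^ b * (conjg W * V ^ 2 ^ b)) = sqtrace (N ^ 2 ^ b * conjg W)"
    by (rule tr_twist[OF refl N_nilpotent c])
  also have "\<dots> = sqtrace (J ^ 2 ^ b * W)"
    by (simp add: conjg_J conjg_pow conjg_mult sqtrace_conjg)
  finally have "quad (2 ^ Suc b) (conjg W) \<noteq> 0" using W(3) by simp
  with ad W(2) show ?thesis using that by (simp add: sqtrace_conjg)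
qed

end

section \<open>Scalar matrices and the form b_V\<close>

definition scalar :: "'k::comm_ring_1 \<Rightarrow> ('k, 'n::finite) sqmat" where
  "scalar c = to_sqmat (msmult c (mat 1))"

lemma entry_scalar: "entry (scalar c) i j = (if i = j then c else 0)"
  by (simp add: scalar_def entry.abs_eq msmult_def mat_def)

lemma entry_scalar_mult: "entry (scalar c * A) i j = c * entry A i j"
  by (simp add: entry_times entry_scalar if_distrib[of "\<lambda>x. x * _"] cong: if_cong)

lemma scalar_commute: "A * scalar c = scalar c * A"
proof (rule sqmat_eqI)
  show "entry (A * scalar c) i j = entry (scalar c * A) i j" for i j
    unfolding entry_scalar_mult
    by (simp add: entry_times entry_scalar if_distrib[of "\<lambda>x. _ * x"] mult.commute cong: if_cong)
qed

lemma scalar_simps: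
  "scalar 0 = 0" "scalar 1 = 1" "sqtrace (scalar c * A) = c * sqtrace A"
  "scalar c * scalar d = scalar (c * d)"
  by (simp_all add: sqtrace_eq entry_scalar_mult entry_scalar sum_distrib_left sqmat_eqI)

lemma to_sqmat_msmult: "to_sqmat (msmult c A) = scalar c * to_sqmat A"
  by (rule sqmat_eqI) (simp add: entry_scalar_mult entry.abs_eq msmult_def)

lemma to_sqmat_eq_iff: "to_sqmat A = to_sqmat B \<longleftrightarrow> A = B"
  by (simp add: to_sqmat_inject)

lemma to_sqmat_surj: "\<exists>A. B = to_sqmat A"
  using to_sqmat_cases by blast

lemma bV_eq: "bV A B = sqtrace (to_sqmat A * to_sqmat B) + sqtrace (to_sqmat A) * sqtrace (to_sqmat B)"
  by (simp add: bV_def to_sqmat_simps trace_def matrix_matrix_mult_def to_sqmat_simps(1)[symmetric])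

context char2_unipotent
begin

text \<open>One step is u A v - A = (u A - A u) v = [N, A] v with v the inverse of u; as v commutes
  with N, its powers collect on the right.\<close>

lemma to_sqmat_XVV: "to_sqmat ((XVV u ^^ j) A) = ad_pow N j (to_sqmat A) * V ^ j"
proof (induction j)
  case (Suc j)
  have "to_sqmat (XVV u B) = commutator N (to_sqmat B) * V" for B
  proof -
    have "commutator N (to_sqmat B) = U * to_sqmat B - to_sqmat B * U"
      by (simp add: u_def commutator_def algebra_simps)
    then have "commutator N (to_sqmat B) * V = U * to_sqmat B * V - to_sqmat B * (U * V)"
      by (simp only: left_diff_distrib mult.assoc)
    then have "commutator N (to_sqmat B) * V = U * to_sqmat B * V - to_sqmat B" by (simp add: uv)
    then show ?thesis by (simp add: XVV_def to_sqmat_simps U_def V_def)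
  qed
  then have "to_sqmat ((XVV u ^^ Suc j) A) = commutator N (ad_pow N j (to_sqmat A) * V ^ j) * V"
    by (simp add: Suc)
  also have "commutator N (ad_pow N j (to_sqmat A) * V ^ j) = ad_pow N (Suc j) (to_sqmat A) * V ^ j"
    using ad_v(2)[of 1 "ad_pow N j (to_sqmat A)" j] by simp
  finally show ?case by (simp only: mult.assoc power_Suc2)
qed (simp add: to_sqmat_simps)

lemma mult_V_pow_eq_iff: "x * V ^ j = y \<longleftrightarrow> x = y * U ^ j"
proof
  assume "x * V ^ j = y"
  then have "y * U ^ j = x * (V ^ j * U ^ j)" by (simp only: mult.assoc[symmetric])
  then show "x = y * U ^ j" by (simp add: vu_pow)
next
  assume "x = y * U ^ j"
  then show "x * V ^ j = y" by (simp add: mult.assoc uv_pow)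
qed

lemma XVV_eq_scalar_iff:
  "(XVV u ^^ j) A = msmult c (mat 1) \<longleftrightarrow> ad_pow N j (to_sqmat A) = scalar c * U ^ j"
proof -
  have "(XVV u ^^ j) A = msmult c (mat 1) \<longleftrightarrow> ad_pow N j (to_sqmat A) * V ^ j = scalar c"
    by (simp add: to_sqmat_XVV scalar_def flip: to_sqmat_eq_iff)
  also have "\<dots> \<longleftrightarrow> ad_pow N j (to_sqmat A) = scalar c * U ^ j"
    by (rule mult_V_pow_eq_iff)
  finally show ?thesis .
qed

lemma XVV_eq_0_iff: "(XVV u ^^ j) A = 0 \<longleftrightarrow> ad_pow N j (to_sqmat A) = 0"
proof -
  have "msmult 0 (mat 1) = (0 :: 'k ^ 'n ^ 'n)" by (simp add: msmult_def vec_eq_iff)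
  then show ?thesis using XVV_eq_scalar_iff[of j A 0] by (simp add: scalar_simps)
qed

text \<open>For d = 1 the two terms of b_V(A, A) agree because tr(A^2) = (tr A)^2; for d > 1 the
  factor tr(X^(d-1) A) is 0.\<close>

lemma bV_XVV:
  assumes "1 \<le> d"
  shows "bV ((XVV u ^^ (d - 1)) A) A = (if d = 1 then 0 else quad d (to_sqmat A))"
proof (cases "d = 1")
  case True
  then show ?thesis
    by (simp add: bV_eq tr_square power2_eq_square add_self_field)
next
  case False
  with assms have "0 < d - 1" by simp
  then have "sqtrace (ad_pow N (d - 1) (to_sqmat A) * V ^ (d - 1)) = 0"
    using tr_ad_pow[of "d - 1" N "to_sqmat A * V ^ (d - 1)"] by (simp add: ad_v)
  with False show ?thesis by (simp add: bV_eq to_sqmat_XVV quad_def)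
qed

definition occurs :: "nat \<Rightarrow> bool" where
  "occurs d \<longleftrightarrow> (\<exists>\<beta>. d = 2 ^ \<beta> \<and> d > 1 \<and> (\<exists>r<length ds. occurs_in_cob \<beta> (ds ! r)))"

lemma occurs_iff: "occurs d \<longleftrightarrow> (\<exists>b. d = 2 ^ Suc b \<and> (\<exists>r<length ds. cob_digit (2 ^ b) (ds ! r)))"
proof
  assume "occurs d"
  then obtain \<beta> r where *: "d = 2 ^ \<beta>" "d > 1" "r < length ds" "occurs_in_cob \<beta> (ds ! r)"
    by (auto simp: occurs_def)
  then obtain b where "\<beta> = Suc b" by (cases \<beta>) auto
  with * ds_pos[of "ds ! r"] show "\<exists>b. d = 2 ^ Suc b \<and> (\<exists>r<length ds. cob_digit (2 ^ b) (ds ! r))"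
    using occurs_in_cob_iff[of "ds ! r" b] by auto
next
  assume "\<exists>b. d = 2 ^ Suc b \<and> (\<exists>r<length ds. cob_digit (2 ^ b) (ds ! r))"
  then obtain b r where *: "d = 2 ^ Suc b" "r < length ds" "cob_digit (2 ^ b) (ds ! r)" by blast
  then have "occurs_in_cob (Suc b) (ds ! r)" using occurs_in_cob_iff ds_pos by simp
  moreover have "(1::nat) < 2 ^ Suc b" by (rule one_less_power) auto
  ultimately show "occurs d" using * unfolding occurs_def by blast
qed

lemma quad_ne0_imp_occurs: "2 \<le> d \<Longrightarrow> ad_pow N d A = 0 \<Longrightarrow> quad d A \<noteq> 0 \<Longrightarrow> occurs d"
  using quad_eq_0[of d A] unfolding occurs_iff by blast

lemma occurs_witness:
  assumes "occurs d"
  obtains W where "2 \<le> d" "ad_pow N d W = 0" "sqtrace W = 0" "quad d W \<noteq> 0"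
proof -
  obtain b r where *: "d = 2 ^ Suc b" "r < length ds" "cob_digit (2 ^ b) (ds ! r)"
    using assms by (auto simp: occurs_iff)
  obtain W where "ad_pow N (2 ^ Suc b) W = 0" "sqtrace W = 0" "quad (2 ^ Suc b) W \<noteq> 0"
    using quad_witness[OF *(2,3)] .
  then show ?thesis using that[of W] by (simp add: *(1))
qed

text \<open>Pair X^d A = c with B and shift the d derivations onto B. Given a solution for c = 1,
  this makes ker X^d traceless; given a kernel element of nonzero trace, it leaves only c =
  0.\<close>

lemma scalar_trace_pairing:
  assumes "ad_pow N d A = scalar c * U ^ d" "ad_pow N d B = 0"
  shows "c * sqtrace B = 0"
proof -
  have "c * sqtrace B = sqtrace (ad_pow N d A * (V ^ d * B))"
    by (simp add: assms(1) mult.assoc scalar_simps) (simp add: uv_pow flip: mult.assoc)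
  also have "\<dots> = 0" by (simp add: tr_ad_adjoint ad_v assms(2))
  finally show ?thesis .
qed

text \<open>All traces required to vanish by \<open>quad_odd\<close> equal c tr A. The remaining
  square is that of tr A for d = 1 and of the trace of an iterated commutator otherwise.\<close>

lemma quad_scalar_odd:
  assumes "odd d" "ad_pow N d A = scalar c * U ^ d" "sqtrace A = 0"
  shows "quad d A = 0"
proof -
  obtain k where d: "d = 2 * k + 1" using assms(1) by (rule oddE)
  have "quad d A = (sqtrace (ad_pow N k A * V ^ k))\<^sup>2"
    unfolding d
  proof (rule quad_odd)
    fix i j assume ij: "i + j = 2 * k + 1"
    have "V ^ i * U ^ d * V ^ j = V ^ i * (U ^ i * U ^ j) * V ^ j"
      by (simp add: d ij flip: power_add)
    also have "\<dots> = (V ^ i * U ^ i) * (U ^ j * V ^ j)" by (simp only: mult.assoc)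
    finally have 1: "V ^ i * U ^ d * V ^ j = 1" by (simp add: uv_pow vu_pow)
    have "A * V ^ i * (scalar c * U ^ d) * V ^ j = (A * V ^ i * scalar c) * (U ^ d * V ^ j)"
      by (simp only: mult.assoc)
    also have "\<dots> = scalar c * A * (V ^ i * U ^ d * V ^ j)"
      unfolding scalar_commute[of "A * V ^ i"] by (simp only: mult.assoc)
    finally have "A * V ^ i * (scalar c * U ^ d) * V ^ j = scalar c * A * (V ^ i * U ^ d * V ^ j)" .
    then show "sqtrace (A * V ^ i * ad_pow N (2 * k + 1) A * V ^ j) = 0"
      using assms(2,3) 1 by (simp add: d scalar_simps)
  qed
  moreover have "sqtrace (ad_pow N k A * V ^ k) = 0"
    using tr_ad_pow[of k N "A * V ^ k"] assms(3) by (cases "k = 0") (simp_all add: ad_v)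
  ultimately show ?thesis by simp
qed

text \<open>The two cross terms agree and cancel: D^d B = 0 makes D^(d-1) B commute with N, hence
  with V, and adjointness then turns one term into the other.\<close>

lemma quad_add:
  assumes "1 \<le> d" "ad_pow N d B = 0"
  shows "quad d (A + B) = quad d A + quad d B"
proof -
  define C where "C = ad_pow N (d - 1) B"
  have "commutator N C = ad_pow N d B" using assms(1) by (cases d) (simp_all add: C_def)
  then have "N * C = C * N" using assms(2) by (simp add: commutator_def)
  then have "C * U = U * C" by (simp add: u_def algebra_simps)
  then have "V * (C * U) * V = V * (U * C) * V" by simp
  then have "V * C * (U * V) = (V * U) * C * V" by (simp only: mult.assoc)
  then have "C * V = V * C" by (simp add: uv vu)
  then have CV: "C * V ^ (d - 1) = V ^ (d - 1) * C" by (rule commute_power)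
  have "sqtrace (ad_pow N (d - 1) A * V ^ (d - 1) * B) = sqtrace (A * (V ^ (d - 1) * C))"
    by (simp add: mult.assoc tr_ad_adjoint ad_v C_def)
  also have "\<dots> = sqtrace (C * V ^ (d - 1) * A)"
    unfolding CV by (rule tr_comm)
  finally have cross: "sqtrace (ad_pow N (d - 1) A * V ^ (d - 1) * B) = sqtrace (C * V ^ (d - 1) * A)" .
  have "quad d (A + B) = quad d A + quad d B
      + (sqtrace (ad_pow N (d - 1) A * V ^ (d - 1) * B) + sqtrace (C * V ^ (d - 1) * A))"
    by (simp add: quad_def ad_pow_linear C_def algebra_simps tr_add)
  then show ?thesis unfolding cross add_self_field by simp
qed

lemma ad_scalar: "ad_pow N k (scalar c * A) = scalar c * ad_pow N k A"
  by (rule ad_pow_mult_left) (rule scalar_commute)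

lemma quad_scalar: "quad d (scalar c * A) = c\<^sup>2 * quad d A"
proof -
  have "scalar c * x * y * (scalar c * z) = scalar (c * c) * (x * y * z)" for x y z :: "('k, 'n) sqmat"
  proof -
    have "scalar c * x * y * (scalar c * z) = scalar c * (x * y * scalar c) * z"
      by (simp only: mult.assoc)
    also have "\<dots> = (scalar c * scalar c) * (x * y * z)"
      unfolding scalar_commute[of "x * y"] by (simp only: mult.assoc)
    finally show ?thesis by (simp only: scalar_simps)
  qed
  then show ?thesis by (simp add: quad_def ad_scalar scalar_simps power2_eq_square)
qed

end

section \<open>Matrices A with X^d A scalar\<close>

locale char2_unipotent_divisible = char2_unipotent ds lab u P Q
  for ds and lab :: "'n::finite \<Rightarrow> nat \<times> nat" and u :: "'k::field ^ 'n ^ 'n" and P Q +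
  fixes e q :: nat and A0 :: "('k, 'n) sqmat"
  assumes q: "q = 2 ^ e" and q_dvd: "d \<in> set ds \<Longrightarrow> q dvd d"
    and q_max: "\<exists>r<length ds. odd (ds ! r div q)"
    and A0: "ad_pow N (q - 1) A0 = U ^ (q - 1)" "sqtrace A0 = of_nat (CARD('n) div q)"
begin

lemma q_pos: "0 < q" by (simp add: q)

lemma sqtrace_A0: "sqtrace A0 \<noteq> 0 \<longleftrightarrow> odd (CARD('n) div q)"
  using char2 by (simp add: A0(2) of_nat_eq_0_iff_char_dvd)

lemma kernel_trace_ne0':
  obtains B where "ad_pow N q B = 0" "sqtrace B \<noteq> 0"
proof -
  obtain r where "r < length ds" "odd (ds ! r div q)" using q_max by blast
  then show ?thesis using kernel_trace_ne0[OF q, of r] q_dvd that by (metis nth_mem)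
qed

text \<open>If d = 2p < q with p a power of 2, every d_r is a multiple of 4p; modulo 2p it has
  remainder 0 and even quotient, so the digit is absent.\<close>

lemma not_occurs_small:
  assumes "d < q"
  shows "\<not> occurs d"
proof
  assume "occurs d"
  then obtain b r where *: "d = 2 ^ Suc b" "r < length ds" "cob_digit (2 ^ b) (ds ! r)"
    by (auto simp: occurs_iff)
  have "(2::nat) ^ Suc b < 2 ^ e" using * assms q by simp
  then have "Suc b < e" by (rule power_less_imp_less_exp[rotated]) simp
  then have "(2::nat) ^ Suc (Suc b) dvd 2 ^ e" by (intro le_imp_power_dvd) simp
  then have "2 ^ Suc (Suc b) dvd ds ! r" using q_dvd[of "ds ! r"] q * by (metis dvd_trans nth_mem)
  then obtain k where "ds ! r = 2 * 2 ^ b * (2 * k)" by (auto simp: dvd_def mult.assoc)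
  then show False using *(3) by (simp add: cob_digit_def)
qed

lemma ad_scalar_large:
  assumes "q \<le> d" "ad_pow N d A = scalar c * U ^ d"
  shows "c = 0"
proof -
  obtain B where "ad_pow N q B = 0" "sqtrace B \<noteq> 0" by (rule kernel_trace_ne0')
  then show ?thesis
    using scalar_trace_pairing[OF assms(2)] ad_pow_zero_mono assms(1) by fastforce
qed

text \<open>This is X^(q-1-d) A0, chosen so that X^d sends it to X^(q-1) A0 = 1.\<close>

definition A1 :: "nat \<Rightarrow> ('k, 'n) sqmat" where
  "A1 d = ad_pow N (q - 1 - d) A0 * V ^ (q - 1 - d)"

lemma ad_A1:
  assumes "d < q"
  shows "ad_pow N d (A1 d) = U ^ d"
proof -
  have s: "d + (q - 1 - d) = q - 1" using assms by simp
  have "ad_pow N d (A1 d) = ad_pow N (d + (q - 1 - d)) A0 * V ^ (q - 1 - d)"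
    by (simp only: A1_def ad_v ad_pow_add)
  also have "\<dots> = U ^ (d + (q - 1 - d)) * V ^ (q - 1 - d)"
    by (simp only: s A0)
  also have "\<dots> = U ^ d"
    by (simp only: power_add mult.assoc uv_pow mult.right_neutral)
  finally show ?thesis .
qed

lemma sqtrace_A1: "d < q - 1 \<Longrightarrow> sqtrace (A1 d) = 0"
  using tr_ad_pow[of "q - 1 - d" N "A0 * V ^ (q - 1 - d)"] by (simp add: A1_def ad_v)

lemma ker_sqtrace_0:
  assumes "d < q" "ad_pow N d B = 0"
  shows "sqtrace B = 0"
  using scalar_trace_pairing[of d "A1 d" 1 B] ad_A1 assms by (simp add: scalar_simps)

text \<open>Put k = q - 1 - d. Moving the k derivations of the second argument to the first pairs
  D^(k+q-2) A0 with A0. As D^(q-1) A0 is a power of U, D^q A0 = 0; so only k = 1 remains, with value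
  tr A0.\<close>

lemma quad_A1:
  assumes "2 \<le> d" "d + 2 \<le> q"
  shows "quad d (A1 d) = (if d + 2 = q then sqtrace A0 else 0)"
proof -
  define k where "k = q - 1 - d"
  have dk: "d - 1 + k = q - 2" "d + k = q - 1" using assms by (auto simp: k_def)
  have "ad_pow N (d - 1) (A1 d) * V ^ (d - 1) = ad_pow N (q - 2) A0 * V ^ (q - 2)"
    by (simp only: A1_def k_def[symmetric] ad_v ad_pow_add[symmetric] dk mult.assoc power_add[symmetric]
        add.commute[of k])
  then have "quad d (A1 d) = sqtrace (ad_pow N (q - 2) A0 * V ^ (q - 2) * (ad_pow N k A0 * V ^ k))"
    by (simp only: quad_def) (simp only: A1_def k_def)
  also have "\<dots> = sqtrace (ad_pow N k A0 * (V ^ k * ad_pow N (q - 2) A0 * V ^ (q - 2)))"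
    using tr_comm[of "ad_pow N (q - 2) A0 * V ^ (q - 2)" "ad_pow N k A0 * V ^ k"] by (simp only: mult.assoc)
  also have "\<dots> = sqtrace (A0 * (V ^ k * ad_pow N (k + (q - 2)) A0 * V ^ (q - 2)))"
    by (simp only: tr_ad_adjoint ad_v ad_pow_add)
  finally have eq: "quad d (A1 d) = sqtrace (A0 * (V ^ k * ad_pow N (k + (q - 2)) A0 * V ^ (q - 2)))" .
  show ?thesis
  proof (cases "d + 2 = q")
    case True
    then have k: "k + (q - 2) = q - 1" by (auto simp: k_def)
    have "V ^ k * U ^ (k + (q - 2)) * V ^ (q - 2) = (V ^ k * U ^ k) * (U ^ (q - 2) * V ^ (q - 2))"
      by (simp only: power_add mult.assoc)
    then have "V ^ k * ad_pow N (k + (q - 2)) A0 * V ^ (q - 2) = 1"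
      using A0(1) by (simp only: k vu_pow uv_pow) simp
    then show ?thesis using eq True by simp
  next
    case False
    then have "q \<le> k + (q - 2)" using assms by (simp add: k_def)
    moreover have "ad_pow N q A0 = 0"
    proof -
      have "ad_pow N (Suc (q - 1)) A0 = commutator N (U ^ (q - 1))" using A0(1) by simp
      then show ?thesis using q_pos N_u_pow by (simp add: commutator_def)
    qed
    ultimately have "ad_pow N (k + (q - 2)) A0 = 0" by (rule ad_pow_zero_mono[rotated])
    then show ?thesis using eq False by simp
  qed
qed

text \<open>For c nonzero, \<open>ad_scalar_large\<close> gives d < q. For even d, subtracting c
  times \<open>A1 d\<close> leaves a kernel element, whose value is 0 since d < q does not occur.
  Odd d, among them d = q - 1 outside the range of \<open>quad_A1\<close>, are covered by
  \<open>quad_scalar_odd\<close>.\<close>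

lemma quad_scalar_value:
  assumes "2 \<le> d" "ad_pow N d A = scalar c * U ^ d" "sqtrace A = 0"
  shows "quad d A \<noteq> 0 \<longleftrightarrow> (if c = 0 then quad d A \<noteq> 0 else d + 2 = q \<and> sqtrace A0 \<noteq> 0)"
proof (cases "c = 0")
  case False
  then have "d < q" using ad_scalar_large[OF _ assms(2)] by force
  have "even q" using \<open>d < q\<close> assms(1) q by (cases e) auto
  show ?thesis
  proof (cases "odd d")
    case True
    then have "d + 2 \<noteq> q" using \<open>even q\<close> by auto
    then show ?thesis using quad_scalar_odd[OF True assms(2,3)] False by simp
  next
    case even: False
    then have "d + 2 \<le> q" using \<open>d < q\<close> \<open>even q\<close> by presburger
    define B where "B = A - scalar c * A1 d"
    have "ad_pow N d B = ad_pow N d A + ad_pow N d (scalar c * A1 d)"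
      by (simp only: B_def minus_eq ad_pow_linear)
    also have "\<dots> = 0" using ad_A1[OF \<open>d < q\<close>] by (simp add: ad_scalar assms(2) add_self)
    finally have B: "ad_pow N d B = 0" .
    then have "quad d B = 0"
      using quad_ne0_imp_occurs[OF assms(1)] not_occurs_small[OF \<open>d < q\<close>] by blast
    moreover have "A = scalar c * A1 d + B" by (simp add: B_def)
    ultimately have "quad d A = c\<^sup>2 * quad d (A1 d)"
      using quad_add[OF _ B, of "scalar c * A1 d"] assms(1) by (simp add: quad_scalar)
    then show ?thesis using quad_A1[OF assms(1) \<open>d + 2 \<le> q\<close>] False by simp
  qed
qed simp

end

section \<open>The space of matrices, gamma and its orthogonal space\<close>

lemma msmult_vector_space: "vector_space (msmult :: 'k::field \<Rightarrow> 'k ^ 'n ^ 'n \<Rightarrow> 'k ^ 'n ^ 'n)"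
  by unfold_locales (simp_all add: msmult_def vec_eq_iff algebra_simps)

lemma msmult_finite_dimensional:
  "\<exists>B. finite_dimensional_vector_space (msmult :: 'k::field \<Rightarrow> 'k ^ 'n::finite ^ 'n \<Rightarrow> 'k ^ 'n ^ 'n) B"
proof -
  interpret vector_space "msmult :: 'k \<Rightarrow> 'k ^ 'n ^ 'n \<Rightarrow> 'k ^ 'n ^ 'n" by (rule msmult_vector_space)
  define E :: "'n \<times> 'n \<Rightarrow> 'k ^ 'n ^ 'n" where "E p = (\<chi> i j. if (i, j) = p then 1 else 0)" for p
  have "A \<in> span (range E)" for A
  proof -
    have "A = (\<Sum>p\<in>UNIV. msmult (A $ fst p $ snd p) (E p))"
    proof -
      have "(\<Sum>p\<in>UNIV. msmult (A $ fst p $ snd p) (E p)) $ i $ j = A $ i $ j" for i j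
        by (simp add: msmult_def E_def if_distrib[of "\<lambda>x. _ * x"] cong: if_cong)
      then show ?thesis by (simp add: vec_eq_iff)
    qed
    also have "\<dots> \<in> span (range E)" by (intro span_sum span_scale span_base) simp
    finally show ?thesis .
  qed
  moreover obtain B where B: "independent B" "UNIV \<subseteq> span B"
    using basis_exists[of UNIV] by metis
  ultimately have "finite B"
    using independent_span_bound[of "range E" B] by auto
  with B have "finite_dimensional_vector_space msmult B"
    by unfold_locales auto
  then show ?thesis ..
qed

lemma (in finite_dimensional_vector_space) dim_hyperplane:
  assumes K: "subspace K" "K \<subseteq> S" and S: "subspace S" and a: "a \<in> S" "a \<notin> K"
    and ex: "\<And>x. x \<in> S \<Longrightarrow> \<exists>c. x - scale c a \<in> K"
  shows "dim S = dim K + 1"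
proof -
  have "span (insert a K) = S"
  proof
    show "span (insert a K) \<subseteq> S" using K a by (intro span_minimal S) auto
    show "S \<subseteq> span (insert a K)"
    proof
      fix x assume "x \<in> S"
      then obtain c where "x - scale c a \<in> K" using ex by blast
      then have "(x - scale c a) + scale c a \<in> span (insert a K)"
        by (intro span_add span_scale span_base) auto
      then show "x \<in> span (insert a K)" by simp
    qed
  qed
  moreover have "a \<notin> span K" using K(1) a(2) by (simp add: span_eq_iff[THEN iffD2])
  ultimately show ?thesis using dim_insert[of a K] dim_span[of "insert a K"] by simp
qed

lemma mem_span_gamma: "A \<in> span_gamma \<longleftrightarrow> (\<exists>c. A = msmult c (mat 1))"
  by (auto simp: span_gamma_def gammaV_def)

context char2_unipotent
begin

lemma of_nat_char2: "(of_nat m :: 'k) = (if even m then 0 else 1)"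
proof (cases "even m")
  case False
  then have "even (m - 1)" "m = (m - 1) + 1" by (auto elim: oddE)
  then have "(of_nat m :: 'k) = of_nat (m - 1) + 1" "(of_nat (m - 1) :: 'k) = 0"
    using char2 by (metis of_nat_1 of_nat_add, simp add: of_nat_eq_0_iff_char_dvd)
  then show ?thesis using False by simp
qed (use char2 in \<open>simp add: of_nat_eq_0_iff_char_dvd\<close>)

lemma sqtrace_scalar: "sqtrace (scalar c :: ('k, 'n) sqmat) = (if even CARD('n) then 0 else c)"
proof -
  have "sqtrace (scalar c :: ('k, 'n) sqmat) = of_nat CARD('n) * c"
    by (simp add: sqtrace_eq entry_scalar)
  then show ?thesis by (simp add: of_nat_char2)
qed

lemma XVV_span_gamma_iff:
  "(XVV u ^^ j) A \<in> span_gamma \<longleftrightarrow> (\<exists>c. ad_pow N j (to_sqmat A) = scalar c * U ^ j)"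
  by (simp add: mem_span_gamma XVV_eq_scalar_iff)

text \<open>Pairing A with the scalar matrix c gives (1 + n) c tr A. So gamma is in the radical of
  b_V for odd n, and its orthogonal space consists of the traceless matrices for even n.\<close>

lemma mem_perp_gamma:
  fixes A :: "'k ^ 'n ^ 'n"
  shows "A \<in> perp_gamma \<longleftrightarrow> odd CARD('n) \<or> sqtrace (to_sqmat A) = 0"
proof -
  have bV: "bV A (msmult c (mat 1)) = (if odd CARD('n) then 0 else c * sqtrace (to_sqmat A))" for c
  proof -
    have "bV A (msmult c (mat 1)) = c * sqtrace (to_sqmat A) + sqtrace (to_sqmat A) * sqtrace (scalar c :: ('k, 'n) sqmat)"
      by (simp add: bV_eq scalar_commute scalar_simps flip: scalar_def)
    then show ?thesis by (simp add: sqtrace_scalar mult.commute add_self_field)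
  qed
  have "A \<in> perp_gamma \<longleftrightarrow> (\<forall>c. bV A (msmult c (mat 1)) = 0)"
    unfolding perp_gamma_def mem_Collect_eq by (auto simp: Ball_def mem_span_gamma)
  then show ?thesis
    unfolding bV by (cases "odd CARD('n)") (auto dest: spec[of _ 1])
qed

text \<open>X^j A has trace 0 for j >= 1, whereas the scalar matrix c has trace n c = c.\<close>

lemma scalar_odd_card:
  assumes "odd CARD('n)" "1 \<le> j" "ad_pow N j A = scalar c * U ^ j"
  shows "c = 0"
proof -
  have "ad_pow N j (A * V ^ j) = scalar c"
    by (simp add: ad_v assms(3) mult.assoc uv_pow)
  then have "sqtrace (scalar c :: ('k, 'n) sqmat) = 0"
    using tr_ad_pow[of j N "A * V ^ j"] assms(2) by simp
  then show ?thesis using assms(1) by (simp add: sqtrace_scalar)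
qed

lemma eps_full:
  assumes "1 \<le> d"
  shows "eps bV (XVV u) UNIV {0} d = (if occurs d then 1 else 0)"
proof -
  have "(\<exists>v\<in>UNIV. (XVV u ^^ d) v \<in> {0} \<and> bV ((XVV u ^^ (d - 1)) v) v \<noteq> 0) \<longleftrightarrow> occurs d"
  proof
    assume "\<exists>v\<in>UNIV. (XVV u ^^ d) v \<in> {0} \<and> bV ((XVV u ^^ (d - 1)) v) v \<noteq> 0"
    then obtain v where v: "(XVV u ^^ d) v = 0" "bV ((XVV u ^^ (d - 1)) v) v \<noteq> 0" by blast
    then have "d \<noteq> 1" "quad d (to_sqmat v) \<noteq> 0"
      using bV_XVV[OF assms, of v] by (auto split: if_splits)
    then show "occurs d"
      using assms v(1) unfolding XVV_eq_0_iff by (intro quad_ne0_imp_occurs) auto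
  next
    assume "occurs d"
    then obtain W where W: "2 \<le> d" "ad_pow N d W = 0" "quad d W \<noteq> 0" by (rule occurs_witness)
    obtain v where "W = to_sqmat v" using to_sqmat_surj by blast
    with W show "\<exists>v\<in>UNIV. (XVV u ^^ d) v \<in> {0} \<and> bV ((XVV u ^^ (d - 1)) v) v \<noteq> 0"
      using bV_XVV[OF assms, of v] by (intro bexI[of _ v]) (simp_all add: XVV_eq_0_iff)
  qed
  then show ?thesis by (simp add: eps_def)
qed

lemma eps_quotient_odd:
  assumes "1 \<le> d" "odd CARD('n)"
  shows "eps bV (XVV u) perp_gamma span_gamma d = eps bV (XVV u) UNIV {0} d"
proof -
  have "perp_gamma = (UNIV :: ('k ^ 'n ^ 'n) set)" using assms(2) by (auto simp: mem_perp_gamma)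
  moreover have "(XVV u ^^ d) v \<in> span_gamma \<longleftrightarrow> (XVV u ^^ d) v \<in> {0}" for v
  proof
    assume "(XVV u ^^ d) v \<in> span_gamma"
    then obtain c where c: "ad_pow N d (to_sqmat v) = scalar c * U ^ d"
      by (auto simp: XVV_span_gamma_iff)
    then show "(XVV u ^^ d) v \<in> {0}"
      using scalar_odd_card[OF assms(2,1) c] by (simp add: XVV_eq_0_iff scalar_simps)
  next
    assume "(XVV u ^^ d) v \<in> {0}"
    then have "ad_pow N d (to_sqmat v) = scalar 0 * U ^ d"
      by (simp add: XVV_eq_0_iff scalar_simps)
    then show "(XVV u ^^ d) v \<in> span_gamma" unfolding XVV_span_gamma_iff by (rule exI)
  qed
  ultimately show ?thesis by (simp add: eps_def)
qed

lemma XVV_linear: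
  "XVV u (A + B) = XVV u A + XVV u B" "XVV u (msmult c A) = msmult c (XVV u A)"
proof -
  have X: "to_sqmat (XVV u A) = commutator N (to_sqmat A) * V" for A
    using to_sqmat_XVV[of 1 A] by simp
  show "XVV u (A + B) = XVV u A + XVV u B"
    by (simp add: X to_sqmat_simps commutator_def algebra_simps flip: to_sqmat_eq_iff)
  show "XVV u (msmult c A) = msmult c (XVV u A)"
    using ad_scalar[of 1 c "to_sqmat A"]
    by (simp add: X to_sqmat_msmult mult.assoc flip: to_sqmat_eq_iff)
qed

lemma XVV_scalar: "XVV u (msmult c (mat 1)) = 0"
  using XVV_eq_0_iff[of 1 "msmult c (mat 1)"]
  by (simp add: commutator_def scalar_commute flip: scalar_def)

lemma XVV_one: "XVV u (mat 1) = 0"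
proof -
  have "msmult 1 (mat 1) = (mat 1 :: 'k ^ 'n ^ 'n)" by (simp add: msmult_def vec_eq_iff)
  then show ?thesis using XVV_scalar[of 1] by simp
qed

lemma sqtrace_XVV: "sqtrace (to_sqmat (XVV u A)) = 0"
proof -
  have "to_sqmat (XVV u A) = commutator N (to_sqmat A * V)"
    using to_sqmat_XVV[of 1 A] ad_v(2)[of 1 "to_sqmat A" 1] by simp
  then show ?thesis by simp
qed

lemma msmult_simps: "msmult c (msmult d A) = msmult (c * d) A"
  "msmult c A + msmult d A = msmult (c + d) A" "msmult 0 A = (0 :: 'k ^ 'n ^ 'n)"
  "msmult c 0 = (0 :: 'k ^ 'n ^ 'n)"
  by (simp_all add: msmult_def vec_eq_iff algebra_simps)

lemma subquotient_full:
  assumes "finite_dimensional_vector_space (msmult :: 'k \<Rightarrow> 'k ^ 'n ^ 'n \<Rightarrow> _) B"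
  shows "subquotient_operator msmult B (XVV u) UNIV {0 :: 'k ^ 'n ^ 'n}"
proof -
  interpret finite_dimensional_vector_space "msmult :: 'k \<Rightarrow> 'k ^ 'n ^ 'n \<Rightarrow> _" B by fact
  show ?thesis
    by unfold_locales (use XVV_scalar[of 0] in \<open>simp_all add: XVV_linear msmult_simps\<close>)
qed

lemma subquotient_perp:
  assumes "finite_dimensional_vector_space (msmult :: 'k \<Rightarrow> 'k ^ 'n ^ 'n \<Rightarrow> _) B"
  shows "subquotient_operator msmult B (XVV u) perp_gamma (span_gamma :: ('k ^ 'n ^ 'n) set)"
proof -
  interpret finite_dimensional_vector_space "msmult :: 'k \<Rightarrow> 'k ^ 'n ^ 'n \<Rightarrow> _" B by fact
  have "subspace (perp_gamma :: ('k ^ 'n ^ 'n) set)"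
    by (rule subspaceI) (auto simp: mem_perp_gamma to_sqmat_simps to_sqmat_msmult tr_add scalar_simps)
  moreover have "subspace (span_gamma :: ('k ^ 'n ^ 'n) set)"
    by (rule subspaceI) (auto simp: mem_span_gamma msmult_simps intro: exI[of _ 0])
  moreover have "span_gamma \<subseteq> (perp_gamma :: ('k ^ 'n ^ 'n) set)"
    by (auto simp: mem_span_gamma mem_perp_gamma sqtrace_scalar simp flip: scalar_def)
  moreover have "0 \<in> (span_gamma :: ('k ^ 'n ^ 'n) set)"
    by (auto simp: mem_span_gamma msmult_simps intro: exI[of _ 0])
  ultimately show ?thesis
    by unfold_locales (auto simp: XVV_linear mem_perp_gamma sqtrace_XVV mem_span_gamma XVV_one msmult_simps)
qed

lemma dim_span_gamma:
  assumes "finite_dimensional_vector_space (msmult :: 'k \<Rightarrow> 'k ^ 'n ^ 'n \<Rightarrow> _) B"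
  shows "vector_space.dim msmult (span_gamma :: ('k ^ 'n ^ 'n) set) = 1"
proof -
  interpret subquotient_operator msmult B "XVV u" perp_gamma "span_gamma :: ('k ^ 'n ^ 'n) set"
    by (rule subquotient_perp) fact
  have "dim (span_gamma :: ('k ^ 'n ^ 'n) set) = dim {0 :: 'k ^ 'n ^ 'n} + 1"
  proof (rule dim_hyperplane[where a = "mat 1"])
    show "mat 1 \<in> (span_gamma :: ('k ^ 'n ^ 'n) set)"
      by (auto simp: mem_span_gamma msmult_def vec_eq_iff intro!: exI[of _ 1])
    show "(mat 1 :: 'k ^ 'n ^ 'n) \<notin> {0}"
      by (simp add: to_sqmat_simps flip: to_sqmat_eq_iff)
    show "{0} \<subseteq> (span_gamma :: ('k ^ 'n ^ 'n) set)" using subspace_0[OF subspace_L] by simp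
  qed (auto simp: mem_span_gamma subspace_L)
  moreover have "dim {0 :: 'k ^ 'n ^ 'n} = 0"
    using dim_insert[of 0 "{}"] span_zero[of "{}"] by simp
  ultimately show ?thesis by simp
qed

end

section \<open>Dimensions of kernels and block multiplicities\<close>

abbreviation truncated_sum :: "nat list \<Rightarrow> nat \<Rightarrow> nat" where
  "truncated_sum s j \<equiv> (\<Sum>e\<leftarrow>s. min e j)"

context char2_unipotent
begin

abbreviation "mdim \<equiv> vector_space.dim (msmult :: 'k \<Rightarrow> 'k ^ 'n ^ 'n \<Rightarrow> 'k ^ 'n ^ 'n)"

definition ker :: "nat \<Rightarrow> ('k ^ 'n ^ 'n) set" where
  "ker j = {A. ad_pow N j (to_sqmat A) = 0}"

definition quotient_ker :: "nat \<Rightarrow> ('k ^ 'n ^ 'n) set" where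
  "quotient_ker j = {A \<in> perp_gamma. \<exists>c. ad_pow N j (to_sqmat A) = scalar c * U ^ j}"

lemma subspace_ker: "module.subspace msmult (ker j)" "module.subspace msmult (quotient_ker j)"
proof -
  obtain B where B: "finite_dimensional_vector_space (msmult :: 'k \<Rightarrow> 'k ^ 'n ^ 'n \<Rightarrow> _) B"
    using msmult_finite_dimensional by blast
  interpret S: subquotient_operator msmult B "XVV u" UNIV "{0 :: 'k ^ 'n ^ 'n}"
    by (rule subquotient_full[OF B])
  interpret T: subquotient_operator msmult B "XVV u" perp_gamma "span_gamma :: ('k ^ 'n ^ 'n) set"
    by (rule subquotient_perp[OF B])
  show "module.subspace msmult (ker j)"
    using S.subspace_preimage[of j] by (simp add: ker_def XVV_eq_0_iff)
  show "module.subspace msmult (quotient_ker j)"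
    using T.subspace_preimage[of j] by (simp add: quotient_ker_def XVV_span_gamma_iff)
qed

lemma mdim_ker:
  assumes "jordan_blocks msmult (XVV u) UNIV {0 :: 'k ^ 'n ^ 'n} s"
  shows "mdim (ker j) = truncated_sum s j"
proof -
  obtain B where B: "finite_dimensional_vector_space (msmult :: 'k \<Rightarrow> 'k ^ 'n ^ 'n \<Rightarrow> _) B"
    using msmult_finite_dimensional by blast
  interpret subquotient_operator msmult B "XVV u" UNIV "{0 :: 'k ^ 'n ^ 'n}"
    by (rule subquotient_full[OF B])
  obtain w where "subquotient_blocks msmult B (XVV u) UNIV {0 :: 'k ^ 'n ^ 'n} s w"
    using subquotient_blocks_ex[OF assms] by blast
  then interpret subquotient_blocks msmult B "XVV u" UNIV "{0 :: 'k ^ 'n ^ 'n}" s w .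
  have "dim {0 :: 'k ^ 'n ^ 'n} = 0"
    using dim_insert[of 0 "{}"] span_zero[of "{}"] by simp
  then show ?thesis using dim_preimage[of j] by (simp add: ker_def XVV_eq_0_iff)
qed

lemma mdim_quotient_ker:
  assumes "jordan_blocks msmult (XVV u) perp_gamma (span_gamma :: ('k ^ 'n ^ 'n) set) s"
  shows "mdim (quotient_ker j) = 1 + truncated_sum s j"
proof -
  obtain B where B: "finite_dimensional_vector_space (msmult :: 'k \<Rightarrow> 'k ^ 'n ^ 'n \<Rightarrow> _) B"
    using msmult_finite_dimensional by blast
  interpret subquotient_operator msmult B "XVV u" perp_gamma "span_gamma :: ('k ^ 'n ^ 'n) set"
    by (rule subquotient_perp[OF B])
  obtain w where "subquotient_blocks msmult B (XVV u) perp_gamma (span_gamma :: ('k ^ 'n ^ 'n) set) s w"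
    using subquotient_blocks_ex[OF assms] by blast
  then interpret subquotient_blocks msmult B "XVV u" perp_gamma "span_gamma :: ('k ^ 'n ^ 'n) set" s w .
  show ?thesis using dim_preimage[of j] dim_span_gamma[OF B] by (simp add: quotient_ker_def XVV_span_gamma_iff)
qed

text \<open>The two kernels coincide for j >= 1, and the 1 is the dimension of
  \<open>span_gamma\<close>, which is divided out. At j = 0 both sums vanish.\<close>

lemma truncated_sum_odd:
  assumes "odd CARD('n)" "1 \<le> j"
    and "jordan_blocks msmult (XVV u) UNIV {0 :: 'k ^ 'n ^ 'n} s"
    and "jordan_blocks msmult (XVV u) perp_gamma (span_gamma :: ('k ^ 'n ^ 'n) set) s'"
  shows "truncated_sum s j = 1 + truncated_sum s' j"
proof -
  have "quotient_ker j = ker j"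
  proof (intro set_eqI iffI)
    fix A assume "A \<in> quotient_ker j"
    then obtain c where c: "ad_pow N j (to_sqmat A) = scalar c * U ^ j" by (auto simp: quotient_ker_def)
    then show "A \<in> ker j" using scalar_odd_card[OF assms(1,2) c] by (simp add: ker_def scalar_simps)
  next
    fix A assume "A \<in> ker j"
    then show "A \<in> quotient_ker j"
      using assms(1) by (auto simp: quotient_ker_def ker_def mem_perp_gamma scalar_simps intro!: exI[of _ 0])
  qed
  then show ?thesis using mdim_ker[OF assms(3)] mdim_quotient_ker[OF assms(4)] by metis
qed


end


context char2_unipotent_divisible
begin

lemma mdim_hyperplane:
  assumes "module.subspace msmult K" "K \<subseteq> S" "module.subspace msmult S" "a \<in> S" "a \<notin> K"
    and "\<And>x. x \<in> S \<Longrightarrow> \<exists>c. x - msmult c a \<in> K"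
  shows "mdim S = mdim K + 1"
proof -
  obtain B where B: "finite_dimensional_vector_space (msmult :: 'k \<Rightarrow> 'k ^ 'n ^ 'n \<Rightarrow> _) B"
    using msmult_finite_dimensional by blast
  then interpret finite_dimensional_vector_space "msmult :: 'k \<Rightarrow> 'k ^ 'n ^ 'n \<Rightarrow> _" B .
  show ?thesis by (rule dim_hyperplane[OF assms])
qed

lemma quotient_ker_even:
  assumes "even CARD('n)"
  shows "quotient_ker j = {A. sqtrace (to_sqmat A) = 0 \<and> (\<exists>c. ad_pow N j (to_sqmat A) = scalar c * U ^ j)}"
  using assms by (auto simp: quotient_ker_def mem_perp_gamma)

text \<open>For j >= q only the scalar 0 is reached, so \<open>quotient_ker j\<close> is the
  traceless part of \<open>ker j\<close>; a kernel element of nonzero trace makes it a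
  hyperplane.\<close>

lemma mdim_large:
  assumes "even CARD('n)" "q \<le> j"
  shows "mdim (ker j) = mdim (quotient_ker j) + 1"
proof -
  obtain B' where B': "ad_pow N q B' = 0" "sqtrace B' \<noteq> 0" by (rule kernel_trace_ne0')
  obtain B where B: "B' = to_sqmat B" using to_sqmat_surj by blast
  have qk: "quotient_ker j = {A \<in> ker j. sqtrace (to_sqmat A) = 0}"
  proof (intro set_eqI iffI)
    fix A assume "A \<in> quotient_ker j"
    then obtain c where c: "sqtrace (to_sqmat A) = 0" "ad_pow N j (to_sqmat A) = scalar c * U ^ j"
      using assms(1) by (auto simp: quotient_ker_even)
    then show "A \<in> {A \<in> ker j. sqtrace (to_sqmat A) = 0}"
      using ad_scalar_large[OF assms(2) c(2)] by (simp add: ker_def scalar_simps)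
  next
    fix A assume "A \<in> {A \<in> ker j. sqtrace (to_sqmat A) = 0}"
    then show "A \<in> quotient_ker j"
      using assms(1) by (auto simp: quotient_ker_even ker_def scalar_simps intro!: exI[of _ 0])
  qed
  have BK: "B \<in> ker j"
    using ad_pow_zero_mono[OF B'(1) assms(2)] by (simp add: ker_def B)
  show ?thesis
  proof (rule mdim_hyperplane[OF subspace_ker(2) _ subspace_ker(1) BK])
    show "quotient_ker j \<subseteq> ker j" by (auto simp: qk)
    show "B \<notin> quotient_ker j" using B'(2) by (simp add: qk B)
    fix A assume A: "A \<in> ker j"
    define c where "c = sqtrace (to_sqmat A) / sqtrace B'"
    have e: "to_sqmat (A - msmult c B) = to_sqmat A - scalar c * B'"
      by (simp add: to_sqmat_simps(3) to_sqmat_msmult B)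
    have "ad_pow N j (to_sqmat (A - msmult c B)) = 0"
      using A BK by (simp add: e minus_eq ad_pow_linear ad_scalar ker_def flip: B)
    moreover have "sqtrace (to_sqmat (A - msmult c B)) = 0"
      using B'(2) by (simp only: e tr_diff scalar_simps) (simp add: c_def)
    ultimately have "A - msmult c B \<in> quotient_ker j" by (simp add: qk ker_def)
    then show "\<exists>c. A - msmult c B \<in> quotient_ker j" ..
  qed
qed

text \<open>For j < q the kernel is traceless, hence inside \<open>quotient_ker j\<close>, and every
  solution of X^j x = c is c times \<open>A1 j\<close> modulo the kernel. One dimension is gained
  iff \<open>A1 j\<close> is traceless, which can fail only at j = q - 1, where it is A0.\<close>

lemma mdim_small:
  assumes "even CARD('n)" "j < q"
  shows "mdim (quotient_ker j) = mdim (ker j) + (if j = q - 1 \<and> sqtrace A0 \<noteq> 0 then 0 else 1)"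
proof -
  have sub: "ker j \<subseteq> quotient_ker j"
    using ker_sqtrace_0[OF assms(2)] assms(1)
    by (auto simp: quotient_ker_even ker_def scalar_simps intro!: exI[of _ 0])
  obtain a where a: "A1 j = to_sqmat a" using to_sqmat_surj by blast
  have ker: "x - msmult c a \<in> ker j" if "ad_pow N j (to_sqmat x) = scalar c * U ^ j" for x c
    using that ad_A1[OF assms(2)]
    by (simp add: ker_def to_sqmat_simps to_sqmat_msmult minus_eq ad_pow_linear ad_scalar add_self flip: a)
  show ?thesis
  proof (cases "sqtrace (A1 j) = 0")
    case True
    then have "\<not> (j = q - 1 \<and> sqtrace A0 \<noteq> 0)" by (auto simp: A1_def)
    moreover have "mdim (quotient_ker j) = mdim (ker j) + 1"
    proof (rule mdim_hyperplane[OF subspace_ker(1) sub subspace_ker(2)])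
      show "a \<in> quotient_ker j"
        using True ad_A1[OF assms(2)] assms(1)
        by (auto simp: quotient_ker_even scalar_simps simp flip: a intro!: exI[of _ 1])
      show "a \<notin> ker j"
        using ad_A1[OF assms(2)] uv_pow[of j] by (auto simp: ker_def simp flip: a)
      show "\<exists>c. x - msmult c a \<in> ker j" if "x \<in> quotient_ker j" for x
        using that ker by (auto simp: quotient_ker_def)
    qed
    ultimately show ?thesis by simp
  next
    case False
    then have "\<not> j < q - 1" using sqtrace_A1 by blast
    then have j: "j = q - 1" using assms(2) by simp
    then have "A1 j = A0" by (simp add: A1_def)
    have "quotient_ker j \<subseteq> ker j"
    proof
      fix x assume "x \<in> quotient_ker j"
      then obtain c where c: "sqtrace (to_sqmat x) = 0" "ad_pow N j (to_sqmat x) = scalar c * U ^ j"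
        using assms(1) by (auto simp: quotient_ker_even)
      have "sqtrace (to_sqmat (x - msmult c a)) = 0"
        using ker[OF c(2)] ker_sqtrace_0[OF assms(2)] by (simp add: ker_def)
      then have "c * sqtrace (A1 j) = 0"
        using c(1) by (simp add: to_sqmat_simps to_sqmat_msmult tr_diff scalar_simps flip: a)
      then show "x \<in> ker j" using False c(2) by (simp add: ker_def scalar_simps)
    qed
    with sub have "quotient_ker j = ker j" by blast
    then show ?thesis using False j \<open>A1 j = A0\<close> by simp
  qed
qed

text \<open>If b commutes with N, then X^(q-1) (A0 b) = (X^(q-1) A0) b = b, so ker X lies in the
  image of X^(q-1) and \<open>blocks_large\<close> applies.\<close>

lemma no_small_blocks:
  assumes "jordan_blocks msmult (XVV u) UNIV {0 :: 'k ^ 'n ^ 'n} s" "1 \<le> d" "d < q"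
  shows "mult s d = 0"
proof -
  obtain B where B: "finite_dimensional_vector_space (msmult :: 'k \<Rightarrow> 'k ^ 'n ^ 'n \<Rightarrow> _) B"
    using msmult_finite_dimensional by blast
  interpret subquotient_operator msmult B "XVV u" UNIV "{0 :: 'k ^ 'n ^ 'n}"
    by (rule subquotient_full[OF B])
  obtain w where "subquotient_blocks msmult B (XVV u) UNIV {0 :: 'k ^ 'n ^ 'n} s w"
    using subquotient_blocks_ex[OF assms(1)] by blast
  then interpret subquotient_blocks msmult B "XVV u" UNIV "{0 :: 'k ^ 'n ^ 'n}" s w .
  have "\<exists>c\<in>UNIV. (XVV u ^^ (q - 1)) c = b" if "XVV u b = 0" for b
  proof -
    define b' where "b' = to_sqmat b"
    have "N * b' = b' * N"
      using that XVV_eq_0_iff[of 1 b] by (simp add: commutator_def b'_def)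
    then have "b' * U = U * b'" by (simp add: u_def algebra_simps)
    then have bU: "b' * U ^ (q - 1) = U ^ (q - 1) * b'" by (rule commute_power)
    obtain c where c: "A0 * b' = to_sqmat c" using to_sqmat_surj by blast
    have "to_sqmat ((XVV u ^^ (q - 1)) c) = ad_pow N (q - 1) A0 * b' * V ^ (q - 1)"
      using \<open>N * b' = b' * N\<close> by (simp only: to_sqmat_XVV c[symmetric] ad_pow_mult_right)
    also have "\<dots> = b' * (U ^ (q - 1) * V ^ (q - 1))"
      by (simp only: A0 bU[symmetric] mult.assoc)
    finally have "(XVV u ^^ (q - 1)) c = b"
      by (simp only: uv_pow mult.right_neutral b'_def to_sqmat_eq_iff)
    then show ?thesis by blast
  qed
  then have "q - 1 < s ! i" if "i < length s" for i
    using blocks_large[of "q - 1" i] that by blast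
  then have "d \<notin> set s" using assms(3) by (fastforce simp: in_set_conv_nth)
  then show ?thesis by (simp add: mult_def count_eq_zero_iff)
qed

text \<open>The correction is 1 + dim \<open>ker j\<close> - dim \<open>quotient_ker j\<close>, the
  1 coming from \<open>span_gamma\<close>.\<close>

lemma truncated_sum_even:
  assumes "even CARD('n)"
    and s: "jordan_blocks msmult (XVV u) UNIV {0 :: 'k ^ 'n ^ 'n} s"
    and s': "jordan_blocks msmult (XVV u) perp_gamma (span_gamma :: ('k ^ 'n ^ 'n) set) s'"
  shows "int (truncated_sum s' j) = int (truncated_sum s j)
    - (if j < q - 1 then 0 else if j = q - 1 then (if odd (CARD('n) div q) then 1 else 0) else 2)"
proof (cases "j < q")
  case True
  have "1 + truncated_sum s' j = truncated_sum s j + (if j = q - 1 \<and> odd (CARD('n) div q) then 0 else 1)"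
    using mdim_small[OF assms(1) True] sqtrace_A0 mdim_ker[OF s] mdim_quotient_ker[OF s'] by simp
  moreover have "j < q - 1 \<or> j = q - 1" using True by linarith
  ultimately show ?thesis by (elim disjE) (simp_all split: if_splits)
next
  case False
  then have "truncated_sum s j = truncated_sum s' j + 2"
    using mdim_large[OF assms(1), of j] mdim_ker[OF s] mdim_quotient_ker[OF s'] by simp
  moreover have "\<not> j < q - 1" "j \<noteq> q - 1" using False q_pos by auto
  ultimately show ?thesis by simp
qed

text \<open>Witnesses must be traceless to lie in \<open>perp_gamma\<close>:
  \<open>occurs_witness\<close> provides this for the values already present, and
  \<open>A1 d\<close> has it because d = q - 2 < q - 1.\<close>

lemma eps_quotient_even:
  assumes "1 \<le> d" "even CARD('n)"
  shows "eps bV (XVV u) perp_gamma span_gamma d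
    = (if occurs d \<or> (2 \<le> d \<and> d + 2 = q \<and> odd (CARD('n) div q)) then 1 else 0)"
proof -
  have "(\<exists>v\<in>perp_gamma. (XVV u ^^ d) v \<in> span_gamma \<and> bV ((XVV u ^^ (d - 1)) v) v \<noteq> 0)
      \<longleftrightarrow> occurs d \<or> (2 \<le> d \<and> d + 2 = q \<and> odd (CARD('n) div q))"
  proof
    assume "\<exists>v\<in>perp_gamma. (XVV u ^^ d) v \<in> span_gamma \<and> bV ((XVV u ^^ (d - 1)) v) v \<noteq> 0"
    then obtain v where v: "v \<in> perp_gamma" "(XVV u ^^ d) v \<in> span_gamma" "bV ((XVV u ^^ (d - 1)) v) v \<noteq> 0"
      by blast
    have tr: "sqtrace (to_sqmat v) = 0" using v(1) assms(2) by (simp add: mem_perp_gamma)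
    obtain c where c: "ad_pow N d (to_sqmat v) = scalar c * U ^ d"
      using v(2) by (auto simp: XVV_span_gamma_iff)
    have d: "2 \<le> d" and quad: "quad d (to_sqmat v) \<noteq> 0"
      using v(3) bV_XVV[OF assms(1), of v] assms(1) by (auto split: if_splits)
    show "occurs d \<or> (2 \<le> d \<and> d + 2 = q \<and> odd (CARD('n) div q))"
    proof (cases "c = 0")
      case True
      then show ?thesis using quad_ne0_imp_occurs[OF d _ quad] c by (simp add: scalar_simps)
    next
      case False
      then show ?thesis using quad_scalar_value[OF d c tr] quad d sqtrace_A0 by simp
    qed
  next
    assume "occurs d \<or> (2 \<le> d \<and> d + 2 = q \<and> odd (CARD('n) div q))"
    then obtain W c where W: "2 \<le> d" "ad_pow N d W = scalar c * U ^ d" "sqtrace W = 0" "quad d W \<noteq> 0"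
    proof
      assume "occurs d"
      then obtain W where "2 \<le> d" "ad_pow N d W = 0" "sqtrace W = 0" "quad d W \<noteq> 0"
        by (rule occurs_witness)
      then show ?thesis using that[of W 0] by (simp add: scalar_simps)
    next
      assume *: "2 \<le> d \<and> d + 2 = q \<and> odd (CARD('n) div q)"
      then have "d < q - 1" "d < q" by auto
      moreover have "quad d (A1 d) \<noteq> 0" using quad_A1[of d] * sqtrace_A0 by simp
      ultimately show ?thesis
        using that[of "A1 d" 1] * sqtrace_A1[of d] ad_A1[of d] by (simp add: scalar_simps)
    qed
    obtain v where v: "W = to_sqmat v" using to_sqmat_surj by blast
    have "v \<in> perp_gamma" using W(3) assms(2) by (simp add: mem_perp_gamma v)
    moreover have "(XVV u ^^ d) v \<in> span_gamma" using W(2) by (auto simp: XVV_span_gamma_iff v)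
    moreover have "bV ((XVV u ^^ (d - 1)) v) v \<noteq> 0" using bV_XVV[OF assms(1), of v] W(1,4) v by simp
    ultimately show "\<exists>v\<in>perp_gamma. (XVV u ^^ d) v \<in> span_gamma \<and> bV ((XVV u ^^ (d - 1)) v) v \<noteq> 0"
      by blast
  qed
  then show ?thesis by (simp add: eps_def)
qed

end

section \<open>The common power of 2 of the block sizes, and the final case analysis\<close>

lemma ex_odd_quotient_Gcd:
  fixes ds :: "nat list"
  assumes "ds \<noteq> []" "\<And>d. d \<in> set ds \<Longrightarrow> 0 < d"
  defines "q \<equiv> 2 ^ multiplicity 2 (Gcd (set ds))"
  shows "\<exists>r<length ds. odd (ds ! r div q)" "d \<in> set ds \<Longrightarrow> q dvd d"
proof -
  have Gcd: "Gcd (set ds) \<noteq> 0"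
    using assms(1,2) by (cases ds) (auto simp: Gcd_0_iff)
  have "q dvd Gcd (set ds)" unfolding q_def by (rule multiplicity_dvd)
  then show dvd: "q dvd d" if "d \<in> set ds" for d
    using that Gcd_dvd dvd_trans by blast
  show "\<exists>r<length ds. odd (ds ! r div q)"
  proof (rule ccontr)
    assume even: "\<not> (\<exists>r<length ds. odd (ds ! r div q))"
    have "2 * q dvd d" if d: "d \<in> set ds" for d
    proof -
      have "2 dvd d div q" using even d by (auto simp: in_set_conv_nth)
      then have "2 * q dvd d div q * q" by (rule mult_dvd_mono) simp
      then show ?thesis using dvd[OF d] by simp
    qed
    then have "2 * q dvd Gcd (set ds)" by (intro Gcd_greatest) auto
    then have "2 ^ Suc (multiplicity 2 (Gcd (set ds))) dvd Gcd (set ds)" by (simp add: q_def)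
    then have "Suc (multiplicity 2 (Gcd (set ds))) \<le> multiplicity 2 (Gcd (set ds))"
      using Gcd by (intro multiplicity_geI) auto
    then show False by simp
  qed
qed

theorem theoremA:
  fixes u :: "'k::alg_closed_field ^'n::finite^'n"
    and ds s s' :: "nat list"
  assumes char2: "CHAR('k) = 2"
    and n2: "CARD('n) \<ge> 2"
    and detu: "det u = 1"
    and unip: "unipotent u"
    and dsV: "jordan_blocks vsmult (\<lambda>v. (u - mat 1) *v v) UNIV {0} ds"
    and sVV: "jordan_blocks msmult (XVV u) UNIV {0} s"
    and sL: "jordan_blocks msmult (XVV u) perp_gamma span_gamma s'"
  defines "n \<equiv> CARD('n)"
    and "\<alpha> \<equiv> multiplicity (2::nat) (Gcd (set ds))"
    and "lamb \<equiv> mult s"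
    and "lamb' \<equiv> mult s'"
    and "\<epsilon> \<equiv> eps bV (XVV u) UNIV {0}"
    and "\<epsilon>' \<equiv> eps bV (XVV u) perp_gamma span_gamma"
    and "caseb \<equiv> (even CARD('n) \<and> multiplicity (2::nat) (Gcd (set ds)) > 1
                  \<and> odd (CARD('n) div 2 ^ multiplicity (2::nat) (Gcd (set ds))))"
  shows
    "(odd n \<longrightarrow> int (lamb' 1) = int (lamb 1) - 1 \<and> (\<forall>d>1. lamb' d = lamb d))
   \<and> (even n \<and> \<alpha> = 0 \<longrightarrow> int (lamb' 1) = int (lamb 1) - 2 \<and> (\<forall>d>1. lamb' d = lamb d))
   \<and> (even n \<and> \<alpha> > 0 \<and> even (n div 2 ^ \<alpha>) \<longrightarrow>
        int (lamb' (2 ^ \<alpha>)) = int (lamb (2 ^ \<alpha>)) - 2 \<and> lamb' (2 ^ \<alpha> - 1) = 2 \<and>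
        (\<forall>d\<ge>1. d \<noteq> 2 ^ \<alpha> \<and> d \<noteq> 2 ^ \<alpha> - 1 \<longrightarrow> lamb' d = lamb d))
   \<and> (even n \<and> \<alpha> > 1 \<and> odd (n div 2 ^ \<alpha>) \<longrightarrow>
        int (lamb' (2 ^ \<alpha>)) = int (lamb (2 ^ \<alpha>)) - 1 \<and> lamb' (2 ^ \<alpha> - 2) = 1 \<and>
        (\<forall>d\<ge>1. d \<noteq> 2 ^ \<alpha> \<and> d \<noteq> 2 ^ \<alpha> - 2 \<longrightarrow> lamb' d = lamb d))
   \<and> (even n \<and> \<alpha> = 1 \<and> odd (n div 2) \<longrightarrow>
        int (lamb' 2) = int (lamb 2) - 1 \<and> (\<forall>d\<ge>1. d \<noteq> 2 \<longrightarrow> lamb' d = lamb d))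
   \<and> (\<forall>d\<ge>1. \<epsilon> d = 1 \<longleftrightarrow>
        (\<exists>\<beta>. d = 2 ^ \<beta> \<and> d > 1 \<and> (\<exists>r<length ds. occurs_in_cob \<beta> (ds ! r))))
   \<and> (caseb \<longrightarrow> \<epsilon> (2 ^ \<alpha> - 2) = 0 \<and> \<epsilon>' (2 ^ \<alpha> - 2) = 1 \<and>
        (\<forall>d\<ge>1. d \<noteq> 2 ^ \<alpha> - 2 \<longrightarrow> \<epsilon>' d = \<epsilon> d))
   \<and> (\<not> caseb \<longrightarrow> (\<forall>d\<ge>1. \<epsilon>' d = \<epsilon> d))"
proof -
  define q :: nat where "q = 2 ^ \<alpha>"
  obtain lab :: "'n \<Rightarrow> nat \<times> nat" and P Q :: "('k, 'n) sqmat" where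
    labPQ: "jordan_labelling ds lab" "P * Q = 1" "Q * P = 1"
      "to_sqmat (u - mat 1) * P = P * jordan_labelling.J lab" "sum_list ds = CARD('n)"
    using jordan_labelling_ex[OF dsV] by metis
  have ds_pos: "0 < d" if "d \<in> set ds" for d
    using dsV that unfolding jordan_blocks_def by (metis in_set_conv_nth less_le_trans zero_less_one)
  interpret jordan_labelling ds lab by (rule labPQ)
  interpret char2_unipotent ds lab u P Q
    by unfold_locales (use char2 ds_pos labPQ detu in \<open>simp_all add: invertible_det_nz\<close>)
  have "ds \<noteq> []" using labPQ(5) n2 by auto
  note Gcd = ex_odd_quotient_Gcd[OF \<open>ds \<noteq> []\<close> ds_pos, folded \<alpha>_def q_def]
  obtain A0 where A0: "ad_pow N (q - 1) A0 = U ^ (q - 1)" "sqtrace A0 = of_nat (CARD('n) div q)"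
    using root_of_one[of q \<alpha>] Gcd(2) q_def by metis
  interpret char2_unipotent_divisible ds lab u P Q \<alpha> q A0
    by unfold_locales (use q_def Gcd A0 in auto)
  \<comment> \<open>For even n this is the excess of the truncated sum of \<open>s\<close> over that
    of \<open>s'\<close>.\<close>
  define \<delta> :: "nat \<Rightarrow> int" where
    "\<delta> j = (if j < q - 1 then 0 else if j = q - 1 then (if odd (n div q) then 1 else 0) else 2)" for j
  have \<delta>: "j + 1 < q \<Longrightarrow> \<delta> j = 0" "j + 1 = q \<Longrightarrow> \<delta> j = (if odd (n div q) then 1 else 0)"
    "q \<le> j \<Longrightarrow> \<delta> j = 2" for j
    using q_pos by (auto simp: \<delta>_def)
  have odd: "int (lamb' d) = int (lamb d) - (if d = 1 then 1 else 0)" if "odd n" "1 \<le> d" for d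
  proof -
    \<comment> \<open>The jump between j = 0 and j = 1 removes one block of size 1 and changes
      nothing else.\<close>
    have "int (truncated_sum s j) = (if j = 0 then 0 else 1) + int (truncated_sum s' j)" for j
      using truncated_sum_odd[OF _ _ sVV sL, of j] that(1) by (cases "j = 0") (auto simp: n_def)
    then show ?thesis
      unfolding lamb_def lamb'_def mult_eq_second_difference[OF that(2)] using that(2) by auto
  qed
  have ev: "int (lamb' d) = int (lamb d) - 2 * \<delta> d + \<delta> (d - 1) + \<delta> (d + 1)" if "even n" "1 \<le> d" for d
    unfolding lamb_def lamb'_def mult_eq_second_difference[OF that(2)] \<delta>_def
    using that truncated_sum_even[OF _ sVV sL, folded n_def] by simp
  \<comment> \<open>Since V (x) V-dual has no blocks shorter than q, the gains at q - 1 and q - 2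
    are the full multiplicities there.\<close>
  have small: "lamb d = 0" if "1 \<le> d" "d < q" for d
    unfolding lamb_def using no_small_blocks[OF sVV that] .
  have eps: "\<epsilon> d = (if occurs d then 1 else 0)" if "1 \<le> d" for d
    unfolding \<epsilon>_def using eps_full[OF that] .
  have caseb: "caseb \<longleftrightarrow> even n \<and> 1 < \<alpha> \<and> odd (n div q)"
    by (simp add: caseb_def n_def \<alpha>_def q_def)
  have eps': "\<epsilon>' d = (if occurs d \<or> (caseb \<and> d = q - 2) then 1 else 0)" if "1 \<le> d" for d
  proof (cases "even n")
    case True
    \<comment> \<open>For q <= 2 the natural number q - 2 is 0 and no d qualifies, in accordance
      with the condition \<alpha> > 1 in \<open>caseb\<close>.\<close>
    have "2 \<le> d \<and> d + 2 = q \<longleftrightarrow> 1 < \<alpha> \<and> d = q - 2"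
    proof (cases "1 < \<alpha>")
      case True
      then have "(2::nat) ^ 2 \<le> 2 ^ \<alpha>" by (intro power_increasing) auto
      then show ?thesis using True by (auto simp: q_def)
    next
      case False
      then have "q \<le> 2" using power_increasing[of \<alpha> 1 "2::nat"] by (simp add: q_def)
      then show ?thesis using False by auto
    qed
    then show ?thesis
      unfolding \<epsilon>'_def caseb using eps_quotient_even[OF that] True by (auto simp: n_def)
  next
    case False
    then show ?thesis
      unfolding \<epsilon>'_def caseb using eps_quotient_odd[OF that] eps[OF that] by (simp add: n_def \<epsilon>_def)
  qed
  have q_ge: "1 < \<alpha> \<Longrightarrow> 4 \<le> q" "0 < \<alpha> \<Longrightarrow> 2 \<le> q"
    using power_increasing[of 2 \<alpha> "2::nat"] power_increasing[of 1 \<alpha> "2::nat"] by (auto simp: q_def)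
  have unchanged_odd: "lamb' d = lamb d" if *: "even n" "odd (n div q)" "1 \<le> d" "d \<noteq> q" "d \<noteq> q - 2" for d
  proof -
    consider "d + 1 < q - 1" | "d = q - 1" | "q < d" using *(3-5) by linarith
    \<comment> \<open>At d = q - 1 the three values are 0, 1, 2, an arithmetic progression; in the
      other two cases they are all equal.\<close>
    then have "2 * \<delta> d = \<delta> (d - 1) + \<delta> (d + 1)"
      using *(2,3) q_pos by cases (auto simp: \<delta>_def)
    then show ?thesis using ev[OF *(1,3)] by simp
  qed
  have "(odd n \<longrightarrow> int (lamb' 1) = int (lamb 1) - 1 \<and> (\<forall>d>1. lamb' d = lamb d))"
  proof (intro impI conjI allI)
    assume n: "odd n"
    show "int (lamb' 1) = int (lamb 1) - 1" using odd[OF n, of 1] by simp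
    show "lamb' d = lamb d" if "d > 1" for d using odd[OF n, of d] that by simp
  qed
  moreover have "(even n \<and> \<alpha> = 0 \<longrightarrow> int (lamb' 1) = int (lamb 1) - 2 \<and> (\<forall>d>1. lamb' d = lamb d))"
  proof (intro impI conjI allI; elim conjE)
    assume n: "even n" and "\<alpha> = 0"
    then have "q = 1" by (simp add: q_def)
    \<comment> \<open>For q = 1 the middle value of \<open>\<delta>\<close> sits at j = 0 and is 0
      because n is even.\<close>
    show "int (lamb' 1) = int (lamb 1) - 2"
      using ev[OF n, of 1] n by (simp add: \<delta>_def \<open>q = 1\<close>)
    show "lamb' d = lamb d" if "d > 1" for d
      using ev[OF n, of d] that by (simp add: \<delta>_def \<open>q = 1\<close> split: if_splits)
  qed
  moreover have "(even n \<and> \<alpha> > 0 \<and> even (n div 2 ^ \<alpha>) \<longrightarrow>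
        int (lamb' (2 ^ \<alpha>)) = int (lamb (2 ^ \<alpha>)) - 2 \<and> lamb' (2 ^ \<alpha> - 1) = 2 \<and>
        (\<forall>d\<ge>1. d \<noteq> 2 ^ \<alpha> \<and> d \<noteq> 2 ^ \<alpha> - 1 \<longrightarrow> lamb' d = lamb d))"
    unfolding q_def[symmetric]
  proof (intro impI conjI allI; elim conjE)
    assume n: "even n" "even (n div q)" and "\<alpha> > 0"
    then have "2 \<le> q" using q_ge by blast
    have \<delta>: "\<delta> j = (if j < q then 0 else 2)" for j
      using n(2) \<open>2 \<le> q\<close> by (simp add: \<delta>_def) linarith
    show "int (lamb' q) = int (lamb q) - 2"
      using ev[OF n(1), of q] \<open>2 \<le> q\<close> by (simp add: \<delta>)
    show "lamb' (q - 1) = 2"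
      using ev[OF n(1), of "q - 1"] small[of "q - 1"] \<open>2 \<le> q\<close> by (simp add: \<delta>)
    show "lamb' d = lamb d" if "1 \<le> d" "d \<noteq> q" "d \<noteq> q - 1" for d
    proof -
      have "Suc d < q \<or> q \<le> d - 1" using that by linarith
      then have "2 * \<delta> d = \<delta> (d - 1) + \<delta> (d + 1)" using that by (auto simp: \<delta>)
      then show ?thesis using ev[OF n(1) that(1)] by simp
    qed
  qed
  moreover have "(even n \<and> \<alpha> > 1 \<and> odd (n div 2 ^ \<alpha>) \<longrightarrow>
        int (lamb' (2 ^ \<alpha>)) = int (lamb (2 ^ \<alpha>)) - 1 \<and> lamb' (2 ^ \<alpha> - 2) = 1 \<and>
        (\<forall>d\<ge>1. d \<noteq> 2 ^ \<alpha> \<and> d \<noteq> 2 ^ \<alpha> - 2 \<longrightarrow> lamb' d = lamb d))"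
    unfolding q_def[symmetric]
  proof (intro impI conjI allI; elim conjE)
    assume n: "even n" "odd (n div q)" and "\<alpha> > 1"
    then have "4 \<le> q" using q_ge by blast
    then have v: "\<delta> q = 2" "\<delta> (q + 1) = 2" "\<delta> (q - 1) = 1" "\<delta> (q - 2) = 0" "\<delta> (q - 3) = 0"
      using n(2) by (simp_all add: \<delta>)
    show "int (lamb' q) = int (lamb q) - 1"
      using ev[OF n(1), of q] v \<open>4 \<le> q\<close> by simp
    have "q - 2 - 1 = q - 3" "q - 2 + 1 = q - 1" using \<open>4 \<le> q\<close> by simp_all
    then show "lamb' (q - 2) = 1"
      using ev[OF n(1), of "q - 2"] small[of "q - 2"] v \<open>4 \<le> q\<close> by simp
    show "lamb' d = lamb d" if d: "1 \<le> d" "d \<noteq> q" "d \<noteq> q - 2" for d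
      by (rule unchanged_odd[OF n d])
  qed
  moreover have "(even n \<and> \<alpha> = 1 \<and> odd (n div 2) \<longrightarrow>
        int (lamb' 2) = int (lamb 2) - 1 \<and> (\<forall>d\<ge>1. d \<noteq> 2 \<longrightarrow> lamb' d = lamb d))"
  proof (intro impI conjI allI; elim conjE)
    assume n: "even n" "odd (n div 2)" and "\<alpha> = 1"
    then have "q = 2" by (simp add: q_def)
    show "int (lamb' 2) = int (lamb 2) - 1"
      using ev[OF n(1), of 2] n(2) by (simp add: \<delta>_def \<open>q = 2\<close>)
    \<comment> \<open>For q = 2 the new block would have size q - 2 = 0, so it disappears.\<close>
    show "lamb' d = lamb d" if "1 \<le> d" "d \<noteq> 2" for d
      using unchanged_odd[of d] n that by (simp add: \<open>q = 2\<close>)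
  qed
  moreover have "(\<forall>d\<ge>1. \<epsilon> d = 1 \<longleftrightarrow>
        (\<exists>\<beta>. d = 2 ^ \<beta> \<and> d > 1 \<and> (\<exists>r<length ds. occurs_in_cob \<beta> (ds ! r))))"
    unfolding occurs_def[symmetric] using eps by simp
  moreover have "(caseb \<longrightarrow> \<epsilon> (2 ^ \<alpha> - 2) = 0 \<and> \<epsilon>' (2 ^ \<alpha> - 2) = 1 \<and>
        (\<forall>d\<ge>1. d \<noteq> 2 ^ \<alpha> - 2 \<longrightarrow> \<epsilon>' d = \<epsilon> d))"
    unfolding q_def[symmetric]
    using eps eps' q_ge(1) not_occurs_small[of "q - 2"] caseb by auto
  moreover have "(\<not> caseb \<longrightarrow> (\<forall>d\<ge>1. \<epsilon>' d = \<epsilon> d))"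
    using eps eps' by simp
  ultimately show ?thesis by blast
qed

end
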